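(* Fix $\ell\ge1$ and a word $w\in\{+,-\}^{2\ell}$ containing at least one $+$ and at least one $-$. Let $C_w(q)$ be the generating function of cylindric steep tilings of width $2\ell$ with asymptotic data $w$ (up to translation), where the exponent of $q$ is the minimal number of flips needed to obtain the tiling from the minimal cylindric tiling. With $\varphi_{i,j}(x)=1+x$ if $j-i$ is odd and $\varphi_{i,j}(x)=1/(1-x)$ if $j-i$ is even, and $T_w(q)=\prod_{i<j,\ w_i=+,\ w_j=-}\varphi_{i,j}(q^{j-i})$, one has $$C_w(q)=T_w(q)\prod_{k=1}^{\infty}\left(\frac{1}{1-q^{2k\ell}}\prod_{\substack{i,j\\ w_i=+,\ w_j=-}}\varphi_{i,j}(q^{2k\ell+j-i})\right),$$ where the inner product runs over all pairs $(i,j)$ in $\{1,\dots,2\ell\}^2$ with $w_i=+$, $w_j=-$.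
   Context: A domino is a closed $2\times1$ or $1\times2$ rectangle with integer corners; a horizontal (resp. vertical) domino is north-going (resp. east-going) if the sum of the coordinates of its top left corner is odd, and south-going (resp. west-going) otherwise. A cylindric steep tiling of width $2\ell$ is a domino tiling of the plane invariant under translation by $(c,c-2\ell)$ for some integer $c$, such that for some $B$ all dominos in $\{x+y>B\}$ are north- or east-going and all dominos in $\{x+y<-B\}$ are south- or west-going. Cutting it along the lattice paths following domino boundaries that stay closest to the lines $y=x$ and $y=x-2\ell$ gives a fundamental domain, which is a steep tiling of the oblique strip of width $2\ell$ (a set of dominos with disjoint interiors whose union $R$ satisfies $\{|x-y-\ell|\le\ell-1\}\subseteq R\subseteq\{|x-y-\ell|\le\ell+1\}$) whose two boundaries fit into each other. The asymptotic data is the word $w\in\{+,-\}^{2\ell}$ such that for each $k\in\{1,\dots,\ell\}$: for large $x$ the unit square with bottom right corner $(x,x-2k)$ is covered by a north-going domino if $w_{2k-1}=+$ and an east-going one if $-$; for negative enough $x$ the unit square with top left corner $(x,x-2k+2)$ is covered by a west-going domino if $w_{2k}=+$ and a south-going one if $-$. A flip of a cylindric tiling replaces two horizontal dominos forming a $2\times2$ square by two vertical ones (or vice versa) simultaneously with all its translates by multiples of $(c,c-2\ell)$. Particle configuration (of the fundamental domain): a site $(x,y)\in(\mathbb{Z}+\frac12)^2$, $0\le x-y\le 2\ell$, is occupied if covered by a south- or west-going domino or uncovered on $y=x$, empty if covered by a north- or east-going domino or uncovered on $y=x-2\ell$. Let $c_0=0$, $c_{2k-1}=c_{2k-2}+[w_{2k-1}=+]$,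 $c_{2k}=c_{2k-1}+[w_{2k}=-]$. The minimal cylindric tiling is the one with translation vector $(c_{2\ell},c_{2\ell}-2\ell)$ whose fundamental domain has the site $(x,x-m)$ occupied iff $x<c_m$, for all $m\in\{0,\dots,2\ell\}$, $x\in\mathbb{Z}+\frac12$.
   Formalization: The steepness condition (north-/east-going for x+y>B, south-/west-going for x+y<-B) is imposed only on dominos of the fundamental domain: imposed on the whole plane it leaves no tilings when c differs from ℓ (e.g. ℓ=1, w=+-), and for c=ℓ the two agree. *)

theory Defs
  imports
    "HOL-Analysis.Analysis"
    "HOL-Computational_Algebra.Formal_Power_Series"
begin

section \<open>Domino tilings of the plane\<close>

text \<open>The integer arguments are the coordinates of the top left corner.\<close>

datatype domino = Hor int int | Ver int int

fun rect :: "domino \<Rightarrow> (real \<times> real) set" where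
  "rect (Hor x y) = {of_int x .. of_int x + 2} \<times> {of_int y - 1 .. of_int y}"
| "rect (Ver x y) = {of_int x .. of_int x + 1} \<times> {of_int y - 2 .. of_int y}"

fun north :: "domino \<Rightarrow> bool" where
  "north (Hor x y) \<longleftrightarrow> odd (x + y)"
| "north (Ver x y) \<longleftrightarrow> False"

fun south :: "domino \<Rightarrow> bool" where
  "south (Hor x y) \<longleftrightarrow> even (x + y)"
| "south (Ver x y) \<longleftrightarrow> False"

fun east :: "domino \<Rightarrow> bool" where
  "east (Hor x y) \<longleftrightarrow> False"
| "east (Ver x y) \<longleftrightarrow> odd (x + y)"

fun west :: "domino \<Rightarrow> bool" where
  "west (Hor x y) \<longleftrightarrow> False"
| "west (Ver x y) \<longleftrightarrow> even (x + y)"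

fun translate :: "int \<Rightarrow> int \<Rightarrow> domino \<Rightarrow> domino" where
  "translate a b (Hor x y) = Hor (x + a) (y + b)"
| "translate a b (Ver x y) = Ver (x + a) (y + b)"

definition nonoverlapping :: "domino set \<Rightarrow> bool" where
  "nonoverlapping T \<longleftrightarrow> pairwise (\<lambda>d e. interior (rect d) \<inter> interior (rect e) = {}) T"

definition plane_tiling :: "domino set \<Rightarrow> bool" where
  "plane_tiling T \<longleftrightarrow> nonoverlapping T \<and> (\<Union>d\<in>T. rect d) = UNIV"

definition invariant :: "nat \<Rightarrow> int \<Rightarrow> domino set \<Rightarrow> bool" where
  "invariant l c T \<longleftrightarrow> translate c (c - 2 * int l) ` T = T"


section \<open>The fundamental domain and cylindric steep tilings\<close>

definition oblique_strip :: "nat \<Rightarrow> real \<Rightarrow> (real \<times> real) set" where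
  "oblique_strip l r = {(x, y). \<bar>x - y - real l\<bar> \<le> r}"

text \<open>
  In a tiling of the plane, the dominos lying between the two lattice paths closest to
  \<open>y = x\<close> and \<open>y = x - 2l\<close> are those contained in the strip \<open>\<bar>x - y - l\<bar> \<le> l + 1\<close>.
  Indeed call a unit square \<open>[a, a+1] \<times> [b, b+1]\<close> even or odd according to the parity of
  \<open>a - b\<close>; every domino consists of an even and an odd square, a north- or east-going one of
  squares with \<open>a - b = 2k - 2\<close> and \<open>2k - 1\<close>, a south- or west-going one of squares with
  \<open>a - b = 2k - 1\<close> and \<open>2k\<close>, and the dominos cut out are those with \<open>1 \<le> k \<le> l\<close>.
  Lemma \<open>fundamental_domain_unique\<close> below confirms that no other set of dominos of the
  tiling has a union between the strips of half-widths \<open>l - 1\<close> and \<open>l + 1\<close>.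
\<close>

definition fundamental_domain :: "nat \<Rightarrow> domino set \<Rightarrow> domino set" where
  "fundamental_domain l T = {d \<in> T. rect d \<subseteq> oblique_strip l (real l + 1)}"

lemma interior_rect:
  "interior (rect (Hor x y)) = {of_int x <..< of_int x + 2} \<times> {of_int y - 1 <..< of_int y}"
  "interior (rect (Ver x y)) = {of_int x <..< of_int x + 1} \<times> {of_int y - 2 <..< of_int y}"
  by (simp_all add: interior_Times)

lemma rect_closure: "rect d \<subseteq> closure (interior (rect d))"
  by (cases d) (simp_all only: interior_rect closure_Times, simp_all)

lemma covering_domino_unique:
  assumes "nonoverlapping T" "d \<in> T" "e \<in> T" "p \<in> interior (rect d)" "p \<in> rect e"
  shows "d = e"
proof (rule ccontr)
  assume "d \<noteq> e"
  then have "interior (rect d) \<inter> interior (rect e) = {}"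
    using assms by (auto simp: nonoverlapping_def pairwise_def)
  then have "interior (rect d) \<inter> closure (interior (rect e)) = {}"
    using open_Int_closure_eq_empty[OF open_interior] by blast
  then show False using assms rect_closure[of e] by blast
qed

lemma fundamental_domain_unique:
  assumes T: "plane_tiling T" and l: "l \<ge> 1" and D: "D \<subseteq> T"
  shows "oblique_strip l (real l - 1) \<subseteq> (\<Union>d\<in>D. rect d) \<and>
         (\<Union>d\<in>D. rect d) \<subseteq> oblique_strip l (real l + 1) \<longleftrightarrow> D = fundamental_domain l T"
    (is "?inner \<and> ?outer \<longleftrightarrow> _")
proof
  assume *: "?inner \<and> ?outer"
  show "D = fundamental_domain l T"
  proof
    show "D \<subseteq> fundamental_domain l T"
      using * D by (force simp: fundamental_domain_def)
    show "fundamental_domain l T \<subseteq> D"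
    proof
      fix d assume "d \<in> fundamental_domain l T"
      then have d: "d \<in> T" "rect d \<subseteq> oblique_strip l (real l + 1)"
        by (auto simp: fundamental_domain_def)
      have "\<exists>p \<in> interior (rect d). p \<in> oblique_strip l (real l - 1)"
      proof (cases d)
        case (Hor x y)
        have "(real_of_int x, real_of_int y) \<in> oblique_strip l (real l + 1)"
          "(of_int x + 2, of_int y - 1) \<in> oblique_strip l (real l + 1)"
          by (rule subsetD[OF d(2)], simp add: Hor)+
        then have "\<bar>real_of_int x - of_int y - real l\<bar> \<le> real l + 1"
          "\<bar>real_of_int x - of_int y + 3 - real l\<bar> \<le> real l + 1"
          by (simp_all add: oblique_strip_def algebra_simps)
        then have xy: "x - y \<ge> - 1" "x - y + 3 \<le> 2 * int l + 1" by linarith+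
        show ?thesis
        proof (cases "x - y = - 1")
          case True
          then have "real_of_int x = of_int y - 1" by linarith
          then show ?thesis using Hor l
            by (intro bexI[of _ "(of_int x + 3/2, of_int y - 1/2)"])
              (auto simp: oblique_strip_def interior_Times)
        next
          case False
          then have "real_of_int x \<ge> of_int y" "real_of_int x - of_int y + 2 \<le> 2 * real l"
            using xy by linarith+
          then show ?thesis using Hor l
            by (intro bexI[of _ "(of_int x + 1/2, of_int y - 1/2)"])
              (auto simp: oblique_strip_def interior_Times abs_le_iff)
        qed
      next
        case (Ver x y)
        have "(real_of_int x, real_of_int y) \<in> oblique_strip l (real l + 1)"
          "(of_int x + 1, of_int y - 2) \<in> oblique_strip l (real l + 1)"
          by (rule subsetD[OF d(2)], simp add: Ver)+
        then have "\<bar>real_of_int x - of_int y - real l\<bar> \<le> real l + 1"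
          "\<bar>real_of_int x - of_int y + 3 - real l\<bar> \<le> real l + 1"
          by (simp_all add: oblique_strip_def algebra_simps)
        then have xy: "x - y \<ge> - 1" "x - y + 3 \<le> 2 * int l + 1" by linarith+
        show ?thesis
        proof (cases "x - y = - 1")
          case True
          then have "real_of_int x = of_int y - 1" by linarith
          then show ?thesis using Ver l
            by (intro bexI[of _ "(of_int x + 1/2, of_int y - 3/2)"])
              (auto simp: oblique_strip_def interior_Times)
        next
          case False
          then have "real_of_int x \<ge> of_int y" "real_of_int x - of_int y + 2 \<le> 2 * real l"
            using xy by linarith+
          then show ?thesis using Ver l
            by (intro bexI[of _ "(of_int x + 1/2, of_int y - 1/2)"])
              (auto simp: oblique_strip_def interior_Times abs_le_iff)
        qed
      qed
      then obtain p e where "p \<in> interior (rect d)" "e \<in> D" "p \<in> rect e"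
        using * by blast
      then show "d \<in> D"
        using covering_domino_unique[of T d e p] T D d by (auto simp: plane_tiling_def)
    qed
  qed
next
  assume D_eq: "D = fundamental_domain l T"
  have "p \<in> (\<Union>d\<in>D. rect d)" if p: "p \<in> oblique_strip l (real l - 1)" for p
  proof -
    obtain x y where xy: "p = (x, y)" by (cases p)
    define a b where "a = \<lfloor>x\<rfloor>" and "b = \<lfloor>y\<rfloor>"
    have ab: "of_int a \<le> x" "x < of_int a + 1" "of_int b \<le> y" "y < of_int b + 1"
      unfolding a_def b_def by linarith+
    have "x - y \<ge> 1" "x - y \<le> 2 * real l - 1"
      using p xy by (auto simp: oblique_strip_def abs_le_iff)
    then have m: "a - b \<ge> 1" "a - b \<le> 2 * int l - 1" using ab by linarith+
    obtain d where d: "d \<in> T" "(of_int a + 1/2, of_int b + 1/2) \<in> rect d"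
      using T by (auto simp: plane_tiling_def)
    have mr: "real_of_int a - of_int b \<ge> 1" "real_of_int a - of_int b \<le> 2 * real l - 1"
      using m by linarith+
    have "(x, y) \<in> rect d \<and> rect d \<subseteq> oblique_strip l (real l + 1)"
    proof (cases d)
      case (Hor u v)
      then have "real_of_int u \<le> of_int a + 1/2" "real_of_int a + 1/2 \<le> of_int u + 2"
        "real_of_int v - 1 \<le> of_int b + 1/2" "real_of_int b + 1/2 \<le> of_int v"
        using d by auto
      then have "u \<le> a" "a \<le> u + 1" "v = b + 1" by linarith+
      then have "real_of_int u \<le> of_int a" "real_of_int a \<le> of_int u + 1"
        "real_of_int v = of_int b + 1" by linarith+
      then show ?thesis using Hor ab mr by (auto simp: oblique_strip_def abs_le_iff)
    next
      case (Ver u v)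
      then have "real_of_int u \<le> of_int a + 1/2" "real_of_int a + 1/2 \<le> of_int u + 1"
        "real_of_int v - 2 \<le> of_int b + 1/2" "real_of_int b + 1/2 \<le> of_int v"
        using d by auto
      then have "u = a" "b + 1 \<le> v" "v \<le> b + 2" by linarith+
      then have "real_of_int u = of_int a" "real_of_int b + 1 \<le> of_int v"
        "real_of_int v \<le> of_int b + 2" by linarith+
      then show ?thesis using Ver ab mr by (auto simp: oblique_strip_def abs_le_iff)
    qed
    then show ?thesis using d xy by (auto simp: D_eq fundamental_domain_def)
  qed
  then show "?inner \<and> ?outer" by (auto simp: D_eq fundamental_domain_def)
qed

text \<open>
  The steepness bounds are imposed on one period of the tiling: when \<open>c \<noteq> l\<close> the half-planes
  \<open>x + y > B\<close> and \<open>x + y < -B\<close> contain translates of every domino of the tiling, so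
  the bounds make sense only within a strip parallel to \<open>y = x\<close>.
\<close>

definition steep :: "nat \<Rightarrow> domino set \<Rightarrow> bool" where
  "steep l T \<longleftrightarrow> (\<exists>B :: real. \<forall>d \<in> fundamental_domain l T.
     (rect d \<subseteq> {(x, y). x + y > B} \<longrightarrow> north d \<or> east d) \<and>
     (rect d \<subseteq> {(x, y). x + y < - B} \<longrightarrow> south d \<or> west d))"

definition cylindric_steep_tiling :: "nat \<Rightarrow> domino set \<Rightarrow> bool" where
  "cylindric_steep_tiling l T \<longleftrightarrow>
     plane_tiling T \<and> (\<exists>c. invariant l c T) \<and> steep l T"


section \<open>Asymptotic data\<close>

datatype sign = Plus | Minus

text \<open>Letters of a word are numbered from 1.\<close>

definition letter :: "sign list \<Rightarrow> nat \<Rightarrow> sign" where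
  "letter w i = w ! (i - 1)"

definition unit_square :: "int \<Rightarrow> int \<Rightarrow> (real \<times> real) set" where
  \<comment> \<open>with bottom left corner \<open>(a, b)\<close>\<close>
  "unit_square a b = {of_int a .. of_int a + 1} \<times> {of_int b .. of_int b + 1}"

definition square_covered :: "domino set \<Rightarrow> (domino \<Rightarrow> bool) \<Rightarrow> int \<Rightarrow> int \<Rightarrow> bool" where
  "square_covered T P a b \<longleftrightarrow> (\<exists>d\<in>T. P d \<and> unit_square a b \<subseteq> rect d)"

text \<open>
  The square with bottom right corner \<open>(x, x - 2k)\<close> has bottom left corner \<open>(x - 1, x - 2k)\<close>,
  the one with top left corner \<open>(x, x - 2k + 2)\<close> has bottom left corner \<open>(x, x - 2k + 1)\<close>.
\<close>

definition asymptotic_data :: "nat \<Rightarrow> sign list \<Rightarrow> domino set \<Rightarrow> bool" where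
  "asymptotic_data l w T \<longleftrightarrow> (\<forall>k\<in>{1..l}.
     (\<forall>\<^sub>F x in at_top. square_covered T
        (case letter w (2 * k - 1) of Plus \<Rightarrow> north | Minus \<Rightarrow> east) (x - 1) (x - 2 * int k)) \<and>
     (\<forall>\<^sub>F x in at_bot. square_covered T
        (case letter w (2 * k) of Plus \<Rightarrow> west | Minus \<Rightarrow> south) x (x - 2 * int k + 1)))"


section \<open>The minimal tiling\<close>

definition covered_by :: "domino set \<Rightarrow> (domino \<Rightarrow> bool) \<Rightarrow> real \<times> real \<Rightarrow> bool" where
  "covered_by D P p \<longleftrightarrow> (\<exists>d\<in>D. P d \<and> p \<in> rect d)"

definition occupied :: "domino set \<Rightarrow> real \<times> real \<Rightarrow> bool" where
  "occupied D p \<longleftrightarrow> covered_by D (\<lambda>d. south d \<or> west d) p \<or>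
     (\<not> covered_by D (\<lambda>_. True) p \<and> snd p = fst p)"

primrec charge :: "sign list \<Rightarrow> nat \<Rightarrow> int" where
  "charge w 0 = 0"
| "charge w (Suc m) = charge w m +
     of_bool (letter w (Suc m) = (if odd (Suc m) then Plus else Minus))"

definition minimal_tiling :: "nat \<Rightarrow> sign list \<Rightarrow> domino set" where
  "minimal_tiling l w = (THE T. cylindric_steep_tiling l T \<and> invariant l (charge w (2 * l)) T \<and>
     (\<forall>m\<in>{0..2 * l}. \<forall>a::int. let x = of_int a + 1 / 2 in
        occupied (fundamental_domain l T) (x, x - real m) \<longleftrightarrow> x < of_int (charge w m)))"


section \<open>Flips\<close>

text \<open>The two tilings of the \<open>2 \<times> 2\<close> square with top left corner \<open>(x, y)\<close>.\<close>

definition hor_pair :: "int \<Rightarrow> int \<Rightarrow> domino set" where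
  "hor_pair x y = {Hor x y, Hor x (y - 1)}"

definition ver_pair :: "int \<Rightarrow> int \<Rightarrow> domino set" where
  "ver_pair x y = {Ver x y, Ver (x + 1) y}"

definition translates :: "nat \<Rightarrow> int \<Rightarrow> domino set \<Rightarrow> domino set" where
  "translates l c P = (\<Union>n::int. translate (n * c) (n * (c - 2 * int l)) ` P)"

definition flip :: "nat \<Rightarrow> int \<Rightarrow> domino set \<Rightarrow> domino set \<Rightarrow> bool" where
  "flip l c T T' \<longleftrightarrow> (\<exists>x y.
     hor_pair x y \<subseteq> T \<and>
       T' = (T - translates l c (hor_pair x y)) \<union> translates l c (ver_pair x y) \<or>
     ver_pair x y \<subseteq> T \<and>
       T' = (T - translates l c (ver_pair x y)) \<union> translates l c (hor_pair x y))"


section \<open>The generating function\<close>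

text \<open>
  Tilings are identified up to translation along \<open>y = x\<close>. Translations in other directions
  move the lines \<open>y = x - 2k\<close> to which the asymptotic data refer.
\<close>

definition diagonal_translation :: "(domino set \<times> domino set) set" where
  "diagonal_translation = {(T, T'). \<exists>t. T' = translate t t ` T}"

definition tiling_classes :: "nat \<Rightarrow> sign list \<Rightarrow> domino set set set" where
  "tiling_classes l w =
     {T. cylindric_steep_tiling l T \<and> asymptotic_data l w T} // diagonal_translation"

definition reached_by_flips :: "nat \<Rightarrow> sign list \<Rightarrow> nat \<Rightarrow> domino set set \<Rightarrow> bool" where
  "reached_by_flips l w n K \<longleftrightarrow>
     (\<exists>T\<in>K. (flip l (charge w (2 * l)) ^^ n) (minimal_tiling l w) T)"

definition flip_number :: "nat \<Rightarrow> sign list \<Rightarrow> domino set set \<Rightarrow> nat" where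
  "flip_number l w K = (LEAST n. reached_by_flips l w n K)"

definition C_gf :: "nat \<Rightarrow> sign list \<Rightarrow> rat fps" where
  "C_gf l w = Abs_fps (\<lambda>n. of_nat (card {K \<in> tiling_classes l w. flip_number l w K = n}))"


section \<open>The product formula\<close>

definition phi :: "nat \<Rightarrow> nat \<Rightarrow> rat fps \<Rightarrow> rat fps" where
  "phi i j x = (if odd (int j - int i) then 1 + x else 1 / (1 - x))"

definition pm_pairs :: "nat \<Rightarrow> sign list \<Rightarrow> (nat \<times> nat) set" where
  "pm_pairs l w = {(i, j) \<in> {1..2 * l} \<times> {1..2 * l}. letter w i = Plus \<and> letter w j = Minus}"

definition T_gf :: "nat \<Rightarrow> sign list \<Rightarrow> rat fps" where
  "T_gf l w = (\<Prod>(i, j) \<in> {(i, j) \<in> pm_pairs l w. i < j}. phi i j (fps_X ^ (j - i)))"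

end

theory Submission
  imports Defs
begin

text \<open>
  Encode a tiling by its particle configurations on the diagonals \<open>x - y = m\<close>: the dominos between
  two consecutive diagonals match particles (\<open>m\<close> odd) or holes (\<open>m\<close> even), moving each by 0 or 1, and
  this matching is determined by the configurations. With Maya diagrams read as partitions, a
  cylindric steep tiling becomes a periodic sequence of partitions whose consecutive terms differ
  by horizontal or vertical strips, added or removed according to the letters of the word. A flip
  adds or removes one box, and every nonzero sequence has a removable box, so the number of flips
  is the total size of the partitions in a period.

  The generating function of such sequences is computed by commuting the steps. Exchanging an
  adjacent added and removed strip is a toggle of the partition between them, and costs a
  factor \<open>1 / (1 - x)\<close> or \<open>1 + x\<close>. Sorting the word gives \<open>T_w\<close>; carrying all added strips once around
  the cylinder and sorting again gives one factor of the infinite product, up to the partition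
  generating function that remains in the limit.
\<close>

section \<open>Partitions and strips\<close>

text \<open>Each translation class contains exactly one tiling whose charges are those of
  \<open>periodic_charge\<close>, and flips preserve charges. So reaching a class from the minimal
  tiling means reaching this one representative, and the minimum over a class becomes a statement
  about a single partition sequence. The generating series are defined by \<open>card\<close>, which
  returns 0 on infinite sets, so every rewriting of the word has to keep the levels finite.
  Finiteness is proved for the original word, where the exponent is a sum of sizes, and each
  exchange passes it on: the new sequences embed into the old ones with multiplicity 0. Every round
  lowers the labels of the added strips by 2l. After many rounds a sequence that is not constant has
  a large exponent, so each fixed coefficient sees only constant sequences. A constant sequence with
  value p has exponent 2l|p|, and these contribute the product of the 1/(1 - q^(2kl)).\<close>

definition is_partition :: "(nat \<Rightarrow> nat) \<Rightarrow> bool" where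
  "is_partition p \<longleftrightarrow> decseq p \<and> (\<exists>n. \<forall>i\<ge>n. p i = 0)"

definition young :: "(nat \<Rightarrow> nat) \<Rightarrow> (nat \<times> nat) set" where
  "young p = {(i, j). j < p i}"

definition psize :: "(nat \<Rightarrow> nat) \<Rightarrow> nat" where
  "psize p = card (young p)"

text \<open>The conjugate partition: as \<open>p\<close> decreases, the first index with
  \<open>p i \<le> j\<close> is the number of rows longer than \<open>j\<close>, that is, the length
  of column \<open>j\<close>.\<close>

definition conj_part :: "(nat \<Rightarrow> nat) \<Rightarrow> nat \<Rightarrow> nat" where
  "conj_part p j = (LEAST i. p i \<le> j)"

lemma partition_decseq: "is_partition p \<Longrightarrow> i \<le> j \<Longrightarrow> p j \<le> p i"
  by (auto simp: is_partition_def decseq_def)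

lemma partition_zero: "is_partition (\<lambda>_. 0)"
  by (auto simp: is_partition_def decseq_def)

lemma partitionI: "(\<And>i. p (Suc i) \<le> p i) \<Longrightarrow> (\<And>i. i \<ge> n \<Longrightarrow> p i = 0) \<Longrightarrow> is_partition p"
  by (auto simp: is_partition_def decseq_Suc_iff)

lemma less_conj_part_iff:
  assumes "is_partition p"
  shows "i < conj_part p j \<longleftrightarrow> j < p i"
proof -
  have ex: "\<exists>i. p i \<le> j"
    using assms unfolding is_partition_def by (metis le_refl zero_le)
  show ?thesis
  proof
    assume "i < conj_part p j"
    then show "j < p i"
      unfolding conj_part_def using not_less_Least by (meson not_le)
  next
    assume *: "j < p i"
    have "p (conj_part p j) \<le> j"
      unfolding conj_part_def using ex by (rule LeastI_ex)
    then show "i < conj_part p j"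
      using * partition_decseq[OF assms, of "conj_part p j" i] by (meson leD leI order.trans)
  qed
qed

lemma partition_eqI: "(\<And>i j. j < p i \<longleftrightarrow> j < q i) \<Longrightarrow> p = (q :: nat \<Rightarrow> nat)"
  by (metis ext linorder_neqE_nat less_irrefl)

lemma partition_conj [intro]:
  assumes "is_partition p"
  shows "is_partition (conj_part p)"
proof (rule partitionI)
  show "conj_part p (Suc i) \<le> conj_part p i" for i
    using less_conj_part_iff[OF assms] by (meson Suc_lessD leI less_irrefl)
  show "conj_part p i = 0" if "i \<ge> p 0" for i
    using less_conj_part_iff[OF assms, of 0 i] that by auto
qed

lemma conj_conj [simp]: "is_partition p \<Longrightarrow> conj_part (conj_part p) = p"
  by (rule partition_eqI) (simp add: less_conj_part_iff partition_conj)

lemma psize_conj: "is_partition p \<Longrightarrow> psize (conj_part p) = psize p"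
  unfolding psize_def young_def
  by (rule bij_betw_same_card[of prod.swap])
     (auto simp: bij_betw_def inj_on_def less_conj_part_iff image_iff)

lemma young_Sigma: "(\<And>i. i \<ge> n \<Longrightarrow> p i = 0) \<Longrightarrow> young p = Sigma {..<n} (\<lambda>i. {..<p i})"
  by (auto simp: young_def) (metis not_less not_less_zero)

lemma psize_eq_sum:
  assumes "\<And>i. i \<ge> n \<Longrightarrow> p i = 0"
  shows "psize p = (\<Sum>i<n. p i)"
  unfolding psize_def by (subst young_Sigma[of n p]) (auto simp: assms)

lemma finite_young: "is_partition p \<Longrightarrow> finite (young p)"
  unfolding is_partition_def using young_Sigma by (metis finite_SigmaI finite_lessThan)

lemma psize_mono_eq:
  assumes "is_partition q" "\<And>i. p i \<le> q i" "psize p = psize q"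
  shows "p = q"
proof -
  have "young p \<subseteq> young q" using assms(2) by (auto simp: young_def intro: less_le_trans)
  then have "young p = young q"
    using assms finite_young[of q] by (intro card_subset_eq) (auto simp: psize_def)
  then show ?thesis
    by (intro partition_eqI) (auto simp: young_def set_eq_iff)
qed

lemma psize_mono:
  assumes "is_partition q" "\<And>i. p i \<le> q i"
  shows "psize p \<le> psize q"
proof -
  have "young p \<subseteq> young q" using assms(2) by (auto simp: young_def intro: less_le_trans)
  then show ?thesis
    using assms finite_young[of q] by (auto simp: psize_def intro!: card_mono)
qed

lemma part_le_psize:
  assumes "is_partition p"
  shows "p i \<le> psize p"
proof -
  have "card ({i} \<times> {..<p i}) \<le> card (young p)"
    by (rule card_mono[OF finite_young[OF assms]]) (auto simp: young_def)
  then show ?thesis by (simp add: psize_def card_cartesian_product)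
qed

text \<open>The number of nonzero parts is \<open>conj_part p 0\<close>, a part of the conjugate and
  hence at most its size.\<close>

lemma part_zero_beyond_psize:
  assumes "is_partition p" "i \<ge> psize p"
  shows "p i = 0"
  using part_le_psize[OF partition_conj[OF assms(1)], of 0] psize_conj[OF assms(1)]
    less_conj_part_iff[OF assms(1), of i 0] assms(2) by auto

text \<open>Such a partition has at most \<open>n\<close> nonzero parts, each at most
  \<open>n\<close>, so a list of \<open>n\<close> bounded entries encodes it.\<close>

lemma finite_partitions: "finite {p. is_partition p \<and> psize p \<le> n}"
proof (rule finite_subset)
  show "{p. is_partition p \<and> psize p \<le> n} \<subseteq>
    (\<lambda>xs i. if i < n then xs ! i else 0) ` {xs. set xs \<subseteq> {..n} \<and> length xs = n}"
  proof
    fix p assume "p \<in> {p. is_partition p \<and> psize p \<le> n}"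
    then have p: "is_partition p" "psize p \<le> n" by auto
    have "p = (\<lambda>i. if i < n then map p [0..<n] ! i else 0)"
      using part_zero_beyond_psize[OF p(1)] p(2) by auto
    moreover have "set (map p [0..<n]) \<subseteq> {..n}"
      using part_le_psize[OF p(1)] p(2) by (auto intro: order.trans)
    ultimately show "p \<in> (\<lambda>xs i. if i < n then xs ! i else 0) ` {xs. set xs \<subseteq> {..n} \<and> length xs = n}"
      by (intro image_eqI[of _ _ "map p [0..<n]"]) auto
  qed
  show "finite ((\<lambda>xs i. if i < n then xs ! i else 0) ` {xs. set xs \<subseteq> {..n} \<and> length xs = n})"
    by (intro finite_imageI finite_lists_length_eq) auto
qed


text \<open>The skew shape \<open>q / p\<close> is a horizontal strip (if \<open>h\<close>) or a vertical strip.\<close>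

definition strip :: "bool \<Rightarrow> (nat \<Rightarrow> nat) \<Rightarrow> (nat \<Rightarrow> nat) \<Rightarrow> bool" where
  "strip h p q \<longleftrightarrow>
     (\<forall>i. p i \<le> q i \<and> (if h then q (Suc i) \<le> p i else q i \<le> Suc (p i)))"

lemma le_iff_less_imp: "a \<le> b \<longleftrightarrow> (\<forall>j. j < a \<longrightarrow> j < (b::nat))"
  by (meson leI less_le_trans less_irrefl)

lemma conj_part_mono_iff:
  assumes "is_partition p" "is_partition q"
  shows "(\<forall>i. conj_part p i \<le> conj_part q i) \<longleftrightarrow> (\<forall>i. p i \<le> q i)"
  by (simp add: le_iff_less_imp less_conj_part_iff assms) blast

text \<open>Transposing exchanges the bounds on rows and columns. One direction of the exchange is
  proved for arbitrary partitions and then applied both to \<open>p\<close>, \<open>q\<close> and to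
  their conjugates.\<close>

lemma strip_conj:
  assumes "is_partition p" "is_partition q"
  shows "strip h (conj_part p) (conj_part q) \<longleftrightarrow> strip (\<not> h) p q"
proof -
  have *: "(\<forall>j. conj_part q j \<le> Suc (conj_part p j)) \<longleftrightarrow> (\<forall>i. q (Suc i) \<le> p i)"
    if "is_partition p" "is_partition q" for p q
  proof -
    have "(\<forall>j. conj_part q j \<le> Suc (conj_part p j)) \<longleftrightarrow>
        (\<forall>j i. Suc i < conj_part q j \<longrightarrow> i < conj_part p j)"
      by (metis Suc_less_eq less_Suc_eq_0_disj le_iff_less_imp Suc_lessD lessI not_less zero_less_Suc)
    also have "\<dots> \<longleftrightarrow> (\<forall>i. q (Suc i) \<le> p i)"
      by (simp add: less_conj_part_iff that le_iff_less_imp) blast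
    finally show ?thesis .
  qed
  show ?thesis
    using conj_part_mono_iff[OF assms] *[OF assms]
      *[OF partition_conj[OF assms(1)] partition_conj[OF assms(2)]] assms
    by (cases h) (simp_all add: strip_def all_conj_distrib)
qed

lemma strip_size: "strip h p q \<Longrightarrow> is_partition q \<Longrightarrow> psize p \<le> psize q"
  by (rule psize_mono) (auto simp: strip_def)

lemma strip_size_eq: "strip h p q \<Longrightarrow> is_partition q \<Longrightarrow> psize p = psize q \<Longrightarrow> p = q"
  by (rule psize_mono_eq) (auto simp: strip_def)

lemma strip_refl: "is_partition p \<Longrightarrow> strip h p p"
  by (auto simp: strip_def partition_decseq)


section \<open>Exchanging an added and a removed strip\<close>

definition uppers :: "bool \<Rightarrow> bool \<Rightarrow> (nat \<Rightarrow> nat) \<Rightarrow> (nat \<Rightarrow> nat) \<Rightarrow> (nat \<Rightarrow> nat) set" where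
  "uppers g h \<mu> \<nu> = {p. is_partition p \<and> strip g \<mu> p \<and> strip h \<nu> p}"

text \<open>The kinds stay with the strips while the order changes: in \<open>uppers\<close> the
  strip of kind \<open>g\<close> is added before that of kind \<open>h\<close> is removed, here the
  strip of kind \<open>h\<close> is removed first.\<close>

definition lowers :: "bool \<Rightarrow> bool \<Rightarrow> (nat \<Rightarrow> nat) \<Rightarrow> (nat \<Rightarrow> nat) \<Rightarrow> (nat \<Rightarrow> nat) set" where
  "lowers g h \<mu> \<nu> = {p. is_partition p \<and> strip h p \<mu> \<and> strip g p \<nu>}"

text \<open>The exponents occurring in \<open>1 / (1 - x)\<close> and in \<open>1 + x\<close>, the
  two possible commutation factors.\<close>

definition multiplicities :: "bool \<Rightarrow> bool \<Rightarrow> nat set" where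
  "multiplicities g h = (if g = h then UNIV else {0, 1})"

text \<open>Bijective form of the commutation relation between an adding and a removing transfer
  operator; the size defect \<open>snd (f p)\<close> becomes the exponent in the commutation
  factor.\<close>

definition toggle :: "bool \<Rightarrow> bool \<Rightarrow> (nat \<Rightarrow> nat) \<Rightarrow> (nat \<Rightarrow> nat) \<Rightarrow>
    ((nat \<Rightarrow> nat) \<Rightarrow> (nat \<Rightarrow> nat) \<times> nat) \<Rightarrow> bool" where
  "toggle g h \<mu> \<nu> f \<longleftrightarrow>
     bij_betw f (uppers g h \<mu> \<nu>) (lowers g h \<mu> \<nu> \<times> multiplicities g h) \<and>
     (\<forall>p \<in> uppers g h \<mu> \<nu>. psize p + psize (fst (f p)) = psize \<mu> + psize \<nu> + snd (f p))"

text \<open>Row \<open>Suc i\<close> of an upper partition and row \<open>i\<close> of a lower one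
  range over the same interval from \<open>a (Suc i)\<close> to \<open>b i\<close>, independently of
  the other rows, and \<open>f\<close> reflects the entry in this interval. Row 0 of an upper
  partition is only bounded below, by \<open>a 0\<close>; its excess is the multiplicity.\<close>

lemma toggle_horizontal:
  assumes \<mu>: "is_partition \<mu>" and \<nu>: "is_partition \<nu>"
  shows "\<exists>f. toggle True True \<mu> \<nu> f"
proof -
  define a b where "a i = max (\<mu> i) (\<nu> i)" and "b i = min (\<mu> i) (\<nu> i)" for i
  define f where "f p = ((\<lambda>i. b i + a (Suc i) - p (Suc i)), p 0 - a 0)" for p :: "nat \<Rightarrow> nat"
  define g where "g x = (\<lambda>i. case i of 0 \<Rightarrow> a 0 + snd x | Suc i \<Rightarrow> b i + a (Suc i) - fst x i)"
    for x :: "(nat \<Rightarrow> nat) \<times> nat"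
  obtain n1 n2 where n12: "\<And>i. i \<ge> n1 \<Longrightarrow> \<mu> i = 0" "\<And>i. i \<ge> n2 \<Longrightarrow> \<nu> i = 0"
    using \<mu> \<nu> by (auto simp: is_partition_def)
  define n where "n = max n1 n2"
  have n: "\<mu> i = 0" "\<nu> i = 0" "a i = 0" "b i = 0" if "i \<ge> n" for i
    using n12 that by (auto simp: n_def a_def b_def)
  have U: "p \<in> uppers True True \<mu> \<nu> \<longleftrightarrow> a 0 \<le> p 0 \<and> (\<forall>i. a (Suc i) \<le> p (Suc i) \<and> p (Suc i) \<le> b i)"
    (is "_ \<longleftrightarrow> ?R") for p
  proof
    assume "p \<in> uppers True True \<mu> \<nu>"
    then show ?R by (auto simp: uppers_def strip_def a_def b_def)
  next
    assume R: ?R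
    then have ap: "a i \<le> p i" for i by (cases i) auto
    have "is_partition p"
    proof (rule partitionI[of _ "Suc n"])
      show "p (Suc i) \<le> p i" for i
        using R ap[of i] by (simp add: a_def b_def) (meson order.trans)
      show "p i = 0" if "i \<ge> Suc n" for i
        using R that n(4)[of "i - 1"] by (cases i) (auto, metis le_zero_eq)
    qed
    then show "p \<in> uppers True True \<mu> \<nu>"
      using R ap by (auto simp: uppers_def strip_def a_def b_def)
  qed
  have L: "p \<in> lowers True True \<mu> \<nu> \<longleftrightarrow> (\<forall>i. a (Suc i) \<le> p i \<and> p i \<le> b i)" (is "_ \<longleftrightarrow> ?R") for p
  proof
    assume "p \<in> lowers True True \<mu> \<nu>"
    then show ?R by (auto simp: lowers_def strip_def a_def b_def)
  next
    assume R: ?R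
    have "is_partition p"
    proof (rule partitionI[of _ n])
      show "p (Suc i) \<le> p i" for i
        using R[rule_format, of i] R[rule_format, of "Suc i"] by (simp add: a_def b_def)
      show "p i = 0" if "i \<ge> n" for i
        using R that n(4)[of i] by (metis le_zero_eq)
    qed
    then show "p \<in> lowers True True \<mu> \<nu>"
      using R by (auto simp: lowers_def strip_def a_def b_def)
  qed
  have "bij_betw f (uppers True True \<mu> \<nu>) (lowers True True \<mu> \<nu> \<times> UNIV)"
  proof (rule bij_betw_byWitness[of _ g])
    show "\<forall>p\<in>uppers True True \<mu> \<nu>. g (f p) = p"
      by (auto simp: U f_def g_def fun_eq_iff split: nat.split) (metis add.commute diff_diff_cancel trans_le_add1)
    show "\<forall>x\<in>lowers True True \<mu> \<nu> \<times> UNIV. f (g x) = x"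
      by (auto simp: L f_def g_def fun_eq_iff) (metis diff_diff_cancel trans_le_add1)
    show "f ` uppers True True \<mu> \<nu> \<subseteq> lowers True True \<mu> \<nu> \<times> UNIV"
    proof
      fix y assume "y \<in> f ` uppers True True \<mu> \<nu>"
      then obtain p where p: "p \<in> uppers True True \<mu> \<nu>" and y: "y = f p" by blast
      have "a (Suc i) \<le> fst y i \<and> fst y i \<le> b i" for i
        using spec[OF conjunct2[OF p[unfolded U]], of i] by (auto simp: y f_def)
      then show "y \<in> lowers True True \<mu> \<nu> \<times> UNIV" by (simp add: mem_Times_iff L)
    qed
    show "g ` (lowers True True \<mu> \<nu> \<times> UNIV) \<subseteq> uppers True True \<mu> \<nu>"
    proof
      fix p assume "p \<in> g ` (lowers True True \<mu> \<nu> \<times> UNIV)"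
      then obtain x where x: "fst x \<in> lowers True True \<mu> \<nu>" and p: "p = g x" by auto
      have "a (Suc i) \<le> p (Suc i) \<and> p (Suc i) \<le> b i" for i
        using spec[OF x[unfolded L], of i] by (auto simp: p g_def)
      then show "p \<in> uppers True True \<mu> \<nu>" by (simp add: U) (simp add: p g_def)
    qed
  qed
  moreover have "psize p + psize (fst (f p)) = psize \<mu> + psize \<nu> + snd (f p)"
    if p: "p \<in> uppers True True \<mu> \<nu>" for p
  proof -
    have pz: "p i = 0" if "i \<ge> Suc n" for i
      using p that n(4)[of "i - 1"] unfolding U by (cases i) (auto, metis le_zero_eq)
    have "psize p = (\<Sum>i<Suc n. p i)" by (rule psize_eq_sum) (rule pz)
    also have "\<dots> = p 0 + (\<Sum>i<n. p (Suc i))" by (rule sum.lessThan_Suc_shift)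
    finally have 1: "psize p = p 0 + (\<Sum>i<n. p (Suc i))" .
    have 2: "psize (fst (f p)) = (\<Sum>i<n. b i + a (Suc i) - p (Suc i))"
      by (subst psize_eq_sum[of n]) (auto simp: f_def n)
    have 3: "(\<Sum>i<n. p (Suc i)) + (\<Sum>i<n. b i + a (Suc i) - p (Suc i)) = (\<Sum>i<n. b i + a (Suc i))"
      unfolding sum.distrib[symmetric] using p[unfolded U]
      by (intro sum.cong) (auto simp: trans_le_add1)
    have "(\<Sum>i<n. a (Suc i)) + a 0 = (\<Sum>i<Suc n. a i)"
      by (subst sum.lessThan_Suc_shift) simp
    then have 4: "(\<Sum>i<n. a (Suc i)) + a 0 = (\<Sum>i<n. a i)" by (simp add: n)
    have "psize \<mu> + psize \<nu> = (\<Sum>i<n. \<mu> i) + (\<Sum>i<n. \<nu> i)"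
      using psize_eq_sum n by metis
    also have "\<dots> = (\<Sum>i<n. a i) + (\<Sum>i<n. b i)"
      unfolding sum.distrib[symmetric] by (intro sum.cong) (auto simp: a_def b_def)
    finally have 5: "psize \<mu> + psize \<nu> = (\<Sum>i<n. a i) + (\<Sum>i<n. b i)" .
    have "snd (f p) + a 0 = p 0" using p unfolding U f_def by simp
    then show ?thesis using 1 2 3 4 5 by (simp add: sum.distrib)
  qed
  ultimately show ?thesis by (auto simp: toggle_def multiplicities_def)
qed

text \<open>Conjugation preserves sizes and turns the situation into the horizontal one.\<close>

lemma toggle_vertical:
  assumes \<mu>: "is_partition \<mu>" and \<nu>: "is_partition \<nu>"
  shows "\<exists>f. toggle False False \<mu> \<nu> f"
proof -
  have bc: "bij_betw conj_part (uppers False False \<mu> \<nu>) (uppers True True (conj_part \<mu>) (conj_part \<nu>))"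
    by (rule bij_betw_byWitness[of _ conj_part])
       (use strip_conj[of _ _ True] strip_conj[of _ _ False] assms in
         \<open>auto simp: uppers_def, (metis conj_conj partition_conj)+\<close>)
  have bl: "bij_betw (map_prod conj_part id) (lowers True True (conj_part \<mu>) (conj_part \<nu>) \<times> UNIV)
      (lowers False False \<mu> \<nu> \<times> (UNIV :: nat set))"
    by (rule bij_betw_byWitness[of _ "map_prod conj_part id"])
       (use strip_conj[of _ _ True] strip_conj[of _ _ False] assms in
         \<open>auto simp: lowers_def, (metis conj_conj partition_conj)+\<close>)
  obtain f where f: "toggle True True (conj_part \<mu>) (conj_part \<nu>) f"
    using toggle_horizontal assms by blast
  have "bij_betw (map_prod conj_part id \<circ> f \<circ> conj_part)
      (uppers False False \<mu> \<nu>) (lowers False False \<mu> \<nu> \<times> UNIV)"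
    using bc f bl unfolding toggle_def multiplicities_def by (auto intro!: bij_betw_trans simp: comp_assoc)
  moreover have "psize p + psize (fst ((map_prod conj_part id \<circ> f \<circ> conj_part) p)) =
      psize \<mu> + psize \<nu> + snd ((map_prod conj_part id \<circ> f \<circ> conj_part) p)"
    if p: "p \<in> uppers False False \<mu> \<nu>" for p
  proof -
    have pc: "conj_part p \<in> uppers True True (conj_part \<mu>) (conj_part \<nu>)"
      using bij_betwE[OF bc] p by blast
    moreover have "is_partition (fst (f (conj_part p)))"
      using f pc unfolding toggle_def by (auto dest!: bij_betwE simp: lowers_def)
    moreover have "is_partition p" using p by (simp add: uppers_def)
    ultimately show ?thesis
      using f assms unfolding toggle_def by (auto simp: psize_conj)
  qed
  ultimately show ?thesis unfolding toggle_def multiplicities_def by auto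
qed

text \<open>
  For a mixed pair of strips the free rows of the upper and of the lower partitions alternate,
  starting and ending with a free upper row. The toggle exchanges each free lower row with the
  next free upper row, so that the first free upper row yields the multiplicity; \<open>carry\<close> reads
  off the state of the next free upper row.
\<close>

lemma toggle_mixed:
  assumes \<mu>: "is_partition \<mu>" and \<nu>: "is_partition \<nu>"
  shows "\<exists>f. toggle True False \<mu> \<nu> f"
proof -
  define A where "A i \<longleftrightarrow> \<mu> i \<le> \<nu> i" for i
  \<comment> \<open>Outside \<open>A\<close> the row has only one possible entry, in the upper as in
    the lower partition (\<open>nA_up\<close>, \<open>nA_low\<close> below). \<open>nxt i\<close> is
    the first row from \<open>i\<close> on that lies in \<open>A\<close>.\<close>
  define nxt where "nxt i = (LEAST j. i \<le> j \<and> A j)" for i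
  define carry where "carry p i = p (nxt i) - \<nu> (nxt i)" for p i
  define f where "f p = ((\<lambda>i. if A i then \<mu> i - carry p (Suc i) else \<nu> i), carry p 0)" for p
  \<comment> \<open>For the inverse the carries are rebuilt from the top row downwards, starting
    with the multiplicity, whereas \<open>carry\<close> looks ahead to a later row.\<close>
  define c where "c x = rec_nat (snd x) (\<lambda>i k. if A i then \<mu> i - fst x i else k)"
    for x :: "(nat \<Rightarrow> nat) \<times> nat"
  define g where "g x = (\<lambda>i. if A i then \<nu> i + c x i else \<mu> i)" for x
  have c0 [simp]: "c x 0 = snd x" and cSuc: "c x (Suc i) = (if A i then \<mu> i - fst x i else c x i)" for x i
    by (simp_all add: c_def)
  obtain n1 n2 where n12: "\<And>i. i \<ge> n1 \<Longrightarrow> \<mu> i = 0" "\<And>i. i \<ge> n2 \<Longrightarrow> \<nu> i = 0"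
    using \<mu> \<nu> by (auto simp: is_partition_def)
  define n where "n = max n1 n2"
  have n: "\<mu> i = 0" "\<nu> i = 0" "A i" if "i \<ge> n" for i
    using n12 that by (auto simp: n_def A_def)
  have "nxt i = i" if "A i" for i
    unfolding nxt_def by (rule Least_equality) (use that in auto)
  moreover have "nxt i = nxt (Suc i)" if "\<not> A i" for i
    unfolding nxt_def by (rule arg_cong[of _ _ Least]) (use that le_antisym in \<open>fastforce simp: not_less_eq_eq\<close>)
  ultimately have carry: "carry p i = (if A i then p i - \<nu> i else carry p (Suc i))" for p i
    by (simp add: carry_def)
  have nA: "nxt i \<ge> i \<and> A (nxt i)" for i
    unfolding nxt_def by (rule LeastI[of _ "max i n"]) (use n in auto)
  have U: "p \<in> uppers True False \<mu> \<nu> \<longleftrightarrow>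
      (\<forall>i. \<mu> i \<le> p i \<and> \<nu> i \<le> p i \<and> p i \<le> Suc (\<nu> i) \<and> p (Suc i) \<le> \<mu> i)" (is "_ \<longleftrightarrow> ?R") for p
  proof
    assume "p \<in> uppers True False \<mu> \<nu>"
    then show ?R by (auto simp: uppers_def strip_def)
  next
    assume R: ?R
    have "is_partition p"
    proof (rule partitionI[of _ "Suc n"])
      show "p (Suc i) \<le> p i" for i using R by (meson order.trans)
      show "p i = 0" if "i \<ge> Suc n" for i
        using R that n(1)[of "i - 1"] by (cases i) (auto, metis le_zero_eq)
    qed
    then show "p \<in> uppers True False \<mu> \<nu>"
      using R by (auto simp: uppers_def strip_def)
  qed
  have L: "p \<in> lowers True False \<mu> \<nu> \<longleftrightarrow>
      (\<forall>i. p i \<le> \<mu> i \<and> \<mu> i \<le> Suc (p i) \<and> p i \<le> \<nu> i \<and> \<nu> (Suc i) \<le> p i)" (is "_ \<longleftrightarrow> ?R") for p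
  proof
    assume "p \<in> lowers True False \<mu> \<nu>"
    then show ?R by (auto simp: lowers_def strip_def)
  next
    assume R: ?R
    have "is_partition p"
    proof (rule partitionI[of _ n])
      show "p (Suc i) \<le> p i" for i using R by (meson order.trans)
      show "p i = 0" if "i \<ge> n" for i using R that n(1)[of i] by (metis le_zero_eq)
    qed
    then show "p \<in> lowers True False \<mu> \<nu>"
      using R by (auto simp: lowers_def strip_def)
  qed
  have k1: "carry p i \<le> 1" if "p \<in> uppers True False \<mu> \<nu>" for p i
    using that unfolding U carry_def by (metis One_nat_def diff_is_0_eq le_diff_conv plus_1_eq_Suc diff_le_mono diff_add_inverse2)
  have nA_up: "\<mu> i = Suc (\<nu> i) \<and> p i = \<mu> i" if "p \<in> uppers True False \<mu> \<nu>" "\<not> A i" for p i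
    using that unfolding U A_def by (metis le_antisym not_less_eq_eq order.trans)
  have carry_le: "\<nu> i + carry p i \<le> p i" if "p \<in> uppers True False \<mu> \<nu>" for p i
    using that k1[OF that, of i] nA_up[OF that, of i] carry[of p i] by (auto simp: U)
  have carry_le': "\<nu> (Suc i) + carry p (Suc i) \<le> \<mu> i" if "p \<in> uppers True False \<mu> \<nu>" for p i
    using that carry_le[OF that, of "Suc i"] unfolding U by (meson order.trans)
  have \<nu>_dec: "\<nu> (Suc i) \<le> \<nu> i" and \<mu>_dec: "\<mu> (Suc i) \<le> \<mu> i" for i
    using \<mu> \<nu> by (auto intro: partition_decseq)
  have c1: "c x i \<le> 1" if "x \<in> lowers True False \<mu> \<nu> \<times> {0, 1 :: nat}" for x i
    using that by (induction i) (auto simp: cSuc L le_diff_conv)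
  have nA_low: "\<mu> i = Suc (\<nu> i) \<and> p i = \<nu> i" if "p \<in> lowers True False \<mu> \<nu>" "\<not> A i" for p i
    using that unfolding L A_def by (metis le_antisym not_less_eq_eq order.trans Suc_le_mono)
  have cgf: "c (f p) i = carry p i" if p: "p \<in> uppers True False \<mu> \<nu>" for p i
  proof (induction i)
    case 0
    then show ?case by (simp add: f_def)
  next
    case (Suc i)
    show ?case
      using Suc carry[of p i] carry_le'[OF p, of i] by (auto simp: cSuc) (auto simp: f_def)
  qed
  have fgc: "carry (g x) i = c x i" for x i
  proof -
    \<comment> \<open>The recursion for \<open>carry\<close> refers to the next row, so the
      induction descends from row \<open>n\<close>, from which on all rows lie in
      \<open>A\<close>.\<close>
    have "carry (g x) i = c x i" if "i \<le> m" "m = n" for m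
      using that
    proof (induction i rule: inc_induct)
      case base
      then show ?case using carry[of "g x" n] n[of n] by (simp add: g_def)
    next
      case (step i)
      then show ?case using carry[of "g x" i] by (auto simp: g_def cSuc)
    qed
    moreover have "carry (g x) i = c x i" if "i \<ge> n"
      using carry[of "g x" i] n[OF that] by (simp add: g_def)
    ultimately show ?thesis by (metis nat_le_linear)
  qed
  have "bij_betw f (uppers True False \<mu> \<nu>) (lowers True False \<mu> \<nu> \<times> {0, 1 :: nat})"
  proof (rule bij_betw_byWitness[of _ g])
    show "\<forall>p\<in>uppers True False \<mu> \<nu>. g (f p) = p"
    proof
      fix p assume p: "p \<in> uppers True False \<mu> \<nu>"
      show "g (f p) = p"
        using nA_up[OF p] carry[of p] p[unfolded U] by (auto simp: g_def cgf[OF p] fun_eq_iff)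
    qed
    show "\<forall>x\<in>lowers True False \<mu> \<nu> \<times> {0, 1 :: nat}. f (g x) = x"
    proof
      fix x assume x: "x \<in> lowers True False \<mu> \<nu> \<times> {0, 1 :: nat}"
      then have x1: "fst x \<in> lowers True False \<mu> \<nu>" by auto
      show "f (g x) = x"
        using nA_low[OF x1] x1[unfolded L] by (auto simp: f_def fgc prod_eq_iff cSuc fun_eq_iff)
    qed
    show "f ` uppers True False \<mu> \<nu> \<subseteq> lowers True False \<mu> \<nu> \<times> {0, 1 :: nat}"
    proof
      fix y assume "y \<in> f ` uppers True False \<mu> \<nu>"
      then obtain p where p: "p \<in> uppers True False \<mu> \<nu>" and y: "y = f p" by blast
      have "fst y i \<le> \<mu> i \<and> \<mu> i \<le> Suc (fst y i) \<and> fst y i \<le> \<nu> i \<and> \<nu> (Suc i) \<le> fst y i" for i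
        using nA_up[OF p, of i] carry_le'[OF p, of i] k1[OF p, of "Suc i"] \<nu>_dec[of i]
        by (auto simp: y f_def A_def)
      then show "y \<in> lowers True False \<mu> \<nu> \<times> {0, 1 :: nat}"
        using k1[OF p, of 0] by (auto simp: y L f_def mem_Times_iff)
    qed
    show "g ` (lowers True False \<mu> \<nu> \<times> {0, 1 :: nat}) \<subseteq> uppers True False \<mu> \<nu>"
    proof
      fix p assume "p \<in> g ` (lowers True False \<mu> \<nu> \<times> {0, 1 :: nat})"
      then obtain x where x: "x \<in> lowers True False \<mu> \<nu> \<times> {0, 1 :: nat}" and p: "p = g x" by blast
      then have x1: "fst x \<in> lowers True False \<mu> \<nu>" by auto
      have "\<mu> i \<le> p i \<and> \<nu> i \<le> p i \<and> p i \<le> Suc (\<nu> i) \<and> p (Suc i) \<le> \<mu> i" for i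
        using nA_low[OF x1, of i] nA_low[OF x1, of "Suc i"] c1[OF x, of i]  c1[OF x, of "Suc i"]
          \<nu>_dec[of i] \<mu>_dec[of i] spec[OF x1[unfolded L], of i]
        by (auto simp: p g_def A_def cSuc)
      then show "p \<in> uppers True False \<mu> \<nu>" by (simp add: U)
    qed
  qed
  moreover have "psize p + psize (fst (f p)) = psize \<mu> + psize \<nu> + snd (f p)"
    if p: "p \<in> uppers True False \<mu> \<nu>" for p
  proof -
    \<comment> \<open>Row by row the sizes balance up to a difference of successive carries. The sum
      telescopes, and beyond row \<open>n\<close> the carry is 0, so only \<open>carry p 0\<close>
      survives.\<close>
    have eq: "(\<Sum>i<m. p i) + (\<Sum>i<m. fst (f p) i) + carry p m = (\<Sum>i<m. \<mu> i) + (\<Sum>i<m. \<nu> i) + carry p 0" for m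
    proof (induction m)
      case (Suc m)
      have "p m + fst (f p) m + carry p (Suc m) = \<mu> m + \<nu> m + carry p m"
        using carry[of p m] carry_le'[OF p, of m] nA_up[OF p, of m] p[unfolded U]
        by (auto simp: f_def)
      then show ?case using Suc by simp
    qed simp
    have pz: "p i = 0" if "i \<ge> Suc n" for i
      using p that n(1)[of "i - 1"] unfolding U by (cases i) (auto, metis le_zero_eq)
    have fz: "fst (f p) i = 0" if "i \<ge> Suc n" for i
      using that n[of i] by (auto simp: f_def)
    have "carry p (Suc n) = 0" using carry[of p "Suc n"] pz n[of "Suc n"] by simp
    then show ?thesis
      using eq[of "Suc n"] psize_eq_sum[of "Suc n" p, OF pz] psize_eq_sum[of "Suc n" "fst (f p)", OF fz]
        psize_eq_sum[of "Suc n" \<mu>] psize_eq_sum[of "Suc n" \<nu>] n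
      by (simp add: f_def del: sum.lessThan_Suc)
  qed
  ultimately show ?thesis by (auto simp: toggle_def multiplicities_def)
qed

lemma ex_toggle:
  assumes "is_partition \<mu>" "is_partition \<nu>"
  shows "\<exists>f. toggle g h \<mu> \<nu> f"
proof -
  \<comment> \<open>The remaining pair of kinds is the mixed one read from right to left, which
    exchanges \<open>\<mu>\<close> and \<open>\<nu>\<close>.\<close>
  have "toggle False True \<mu> \<nu> = toggle True False \<nu> \<mu>"
    unfolding toggle_def uppers_def lowers_def multiplicities_def
    by (auto simp: fun_eq_iff conj_commute add.commute)
  then show ?thesis
    using toggle_horizontal toggle_vertical toggle_mixed assms
    by (cases g; cases h) auto
qed

section \<open>Weighted cyclic sequences of partitions\<close>

definition gf :: "'a set \<Rightarrow> ('a \<Rightarrow> int) \<Rightarrow> rat fps" where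
  "gf X e = Abs_fps (\<lambda>n. of_nat (card {x \<in> X. e x = int n}))"

text \<open>Makes \<open>gf\<close> faithful: a negative exponent would not be counted, and an
  infinite level would be counted as 0.\<close>

definition graded :: "'a set \<Rightarrow> ('a \<Rightarrow> int) \<Rightarrow> bool" where
  "graded X e \<longleftrightarrow> (\<forall>x\<in>X. 0 \<le> e x) \<and> (\<forall>n. finite {x \<in> X. e x = n})"

definition phi_factor :: "bool \<Rightarrow> bool \<Rightarrow> rat fps \<Rightarrow> rat fps" where
  "phi_factor g h x = (if g = h then 1 / (1 - x) else 1 + x)"

lemma bij_betw_level:
  assumes "bij_betw f X Y" "\<And>x. x \<in> X \<Longrightarrow> e' (f x) = e x"
  shows "bij_betw f {x \<in> X. e x = n} {y \<in> Y. e' y = n}"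
  using assms unfolding bij_betw_def inj_on_def by auto

lemma gf_bij:
  assumes "bij_betw f X Y" "\<And>x. x \<in> X \<Longrightarrow> e' (f x) = e x"
  shows "gf X e = gf Y e'" "graded X e \<longleftrightarrow> graded Y e'"
proof -
  note level = bij_betw_level[of f X Y e' e, OF assms]
  show "gf X e = gf Y e'"
    unfolding gf_def using bij_betw_same_card[OF level] by simp
  show "graded X e \<longleftrightarrow> graded Y e'"
  proof -
    have "Y = f ` X" using assms(1) by (simp add: bij_betw_def)
    then have "(\<forall>y\<in>Y. 0 \<le> e' y) \<longleftrightarrow> (\<forall>x\<in>X. 0 \<le> e x)" using assms(2) by simp
    then show ?thesis unfolding graded_def using bij_betw_finite[OF level] by simp
  qed
qed

text \<open>A free multiplicity of cost \<open>d\<close> per unit contributes a geometric series or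
  \<open>1 + x\<close>. Gradedness goes from the product to its factor, embedded with multiplicity
  0; this is the direction in which words are rewritten.\<close>

lemma gf_times_multiplicities:
  fixes Y :: "'a set" and e :: "'a \<Rightarrow> int" and d :: nat
  defines "e' \<equiv> \<lambda>(y, k). e y + int d * int k"
  assumes d: "d > 0" and good: "graded (Y \<times> multiplicities g h) e'"
  shows "graded Y e" "gf (Y \<times> multiplicities g h) e' = phi_factor g h (fps_X ^ d) * gf Y e"
proof -
  let ?M = "multiplicities g h"
  have 0: "0 \<in> ?M" by (simp add: multiplicities_def)
  have fin0: "finite {y \<in> Y. e y = n}" for n
  proof -
    have "(\<lambda>y. (y, 0)) ` {y \<in> Y. e y = n} \<subseteq> {x \<in> Y \<times> ?M. e' x = n}"
      using 0 by (auto simp: e'_def)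
    then have "finite ((\<lambda>y. (y, 0 :: nat)) ` {y \<in> Y. e y = n})"
      by (rule finite_subset) (simp add: good[unfolded graded_def])
    then show ?thesis by (rule finite_imageD) (auto simp: inj_on_def)
  qed
  have pos: "e y \<ge> 0" if "y \<in> Y" for y
  proof -
    have "(y, 0) \<in> Y \<times> ?M" using 0 that by simp
    then have "e' (y, 0) \<ge> 0" using good unfolding graded_def by blast
    then show ?thesis by (simp add: e'_def)
  qed
  show "graded Y e" using fin0 pos by (simp add: graded_def)
  have fin: "finite {x \<in> Y \<times> ?M. e' x = n}" for n
    using good by (simp add: graded_def)
  show "gf (Y \<times> ?M) e' = phi_factor g h (fps_X ^ d) * gf Y e"
  proof (cases "g = h")
    case True
    then have M: "?M = UNIV" by (simp add: multiplicities_def)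
    let ?Z = "Y \<times> (UNIV :: nat set)"
    define S where "S n = {x \<in> ?Z. e' x = n}" for n
    have finS: "finite (S n)" for n using fin[of n] by (simp add: S_def M)
    have memS: "(y, k) \<in> S n \<longleftrightarrow> y \<in> Y \<and> e y + int d * int k = n" for y k n
      by (simp add: S_def e'_def)
    have Spos: "S n = {}" if "n < 0" for n
    proof -
      have "(y, k) \<notin> S n" for y k
        using pos[of y] that zero_le_mult_iff[of "int d" "int k"] unfolding memS by fastforce
      then show ?thesis by auto
    qed
    \<comment> \<open>Either the multiplicity is 0, or lowering it by one gives an element of level
      \<open>n - d\<close>. This yields the functional equation of the geometric series, solved
      below by dividing by \<open>1 - fps_X ^ d\<close>.\<close>
    have S_split: "S n = (\<lambda>y. (y, 0)) ` {y \<in> Y. e y = n} \<union> apsnd Suc ` S (n - int d)" for n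
    proof (intro equalityI subsetI)
      fix x assume x: "x \<in> S n"
      obtain y k where yk: "x = (y, k)" by (cases x)
      show "x \<in> (\<lambda>y. (y, 0)) ` {y \<in> Y. e y = n} \<union> apsnd Suc ` S (n - int d)"
      proof (cases k)
        case 0
        then show ?thesis using x yk by (auto simp: memS)
      next
        case (Suc k')
        then have "(y, k') \<in> S (n - int d)"
          using x yk by (auto simp: memS algebra_simps)
        then show ?thesis using yk Suc by (intro UnI2 image_eqI[of _ _ "(y, k')"]) auto
      qed
    qed (auto simp: memS algebra_simps)
    have card_S: "card (S n) = card {y \<in> Y. e y = n} + card (S (n - int d))" for n
    proof -
      have "card (S n) = card ((\<lambda>y. (y, 0 :: nat)) ` {y \<in> Y. e y = n}) + card (apsnd Suc ` S (n - int d))"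
        by (subst S_split, rule card_Un_disjoint) (use fin0 finS in auto)
      moreover have "inj_on (apsnd Suc) (S m)" for m by (auto simp: inj_on_def)
      ultimately show ?thesis by (simp add: card_image inj_on_def[of "\<lambda>y. (y, _)"])
    qed
    have gfS: "gf ?Z e' = Abs_fps (\<lambda>n. of_nat (card (S (int n))))"
      by (simp only: gf_def S_def)
    have step: "of_nat (card (S (int n))) = (of_nat (card {y \<in> Y. e y = int n}) :: rat) +
        (if n < d then 0 else of_nat (card (S (int (n - d)))))" for n
      using card_S[of "int n"] Spos[of "int n - int d"] by (auto simp: of_nat_diff)
    have "gf ?Z e' = gf Y e + fps_X ^ d * gf ?Z e'"
    proof (rule fps_ext)
      fix n
      show "fps_nth (gf ?Z e') n = fps_nth (gf Y e + fps_X ^ d * gf ?Z e') n"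
        using step[of n] by (simp only: fps_add_nth fps_X_power_mult_nth gfS gf_def[of Y] fps_nth_Abs_fps)
    qed
    then have eq: "(1 - fps_X ^ d) * gf ?Z e' = gf Y e" by (simp add: algebra_simps)
    have nz: "fps_nth (1 - fps_X ^ d :: rat fps) 0 \<noteq> 0" using d by simp
    then have nz': "(1 - fps_X ^ d :: rat fps) \<noteq> 0" by (metis fps_zero_nth)
    have "gf ?Z e' = gf Y e / (1 - fps_X ^ d)"
      unfolding eq[symmetric] by (rule nonzero_mult_div_cancel_left[OF nz', symmetric])
    also have "\<dots> = 1 / (1 - fps_X ^ d) * gf Y e"
      using nz by (simp add: fps_divide_unit mult.commute)
    finally show ?thesis using True M by (simp add: phi_factor_def)
  next
    case False
    then have M: "?M = {0, 1}" by (simp add: multiplicities_def)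
    define S where "S n = {x \<in> Y \<times> ?M. e' x = n}" for n
    have S_split: "S n = (\<lambda>y. (y, 0)) ` {y \<in> Y. e y = n} \<union>
        (\<lambda>y. (y, 1)) ` {y \<in> Y. e y = n - int d}" for n
      by (auto simp: e'_def M S_def)
    have card_S: "card (S n) = card {y \<in> Y. e y = n} + card {y \<in> Y. e y = n - int d}" for n
    proof -
      have "card (S n) = card ((\<lambda>y. (y, 0 :: nat)) ` {y \<in> Y. e y = n}) +
          card ((\<lambda>y. (y, 1 :: nat)) ` {y \<in> Y. e y = n - int d})"
        by (subst S_split, rule card_Un_disjoint) (use fin0 in auto)
      then show ?thesis by (simp add: card_image inj_on_def)
    qed
    have neg: "{y \<in> Y. e y = n} = {}" if "n < 0" for n
      using pos that by fastforce
    have gfS: "gf (Y \<times> ?M) e' = Abs_fps (\<lambda>n. of_nat (card (S (int n))))"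
      by (simp only: gf_def S_def)
    have "of_nat (card (S (int n))) = (of_nat (card {y \<in> Y. e y = int n}) :: rat) +
        (if n < d then 0 else of_nat (card {y \<in> Y. e y = int (n - d)}))" for n
    proof (cases "n < d")
      case True
      then have "{y \<in> Y. e y = int n - int d} = {}" by (intro neg) simp
      then show ?thesis unfolding card_S using True by (simp only: card.empty) simp
    qed (simp add: card_S of_nat_diff)
    then have "gf (Y \<times> ?M) e' = gf Y e + fps_X ^ d * gf Y e"
      by (intro fps_ext) (simp only: fps_add_nth fps_X_power_mult_nth gfS gf_def[of Y] fps_nth_Abs_fps)
    then show ?thesis using False by (simp add: phi_factor_def distrib_right)
  qed
qed

lemma gf_extract:
  assumes "bij_betw f X (Y \<times> multiplicities g h)"
    and "\<And>x. x \<in> X \<Longrightarrow> e x = e' (fst (f x)) + int d * int (snd (f x))"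
    and "d > 0" "graded X e"
  shows "graded Y e'" "gf X e = phi_factor g h (fps_X ^ d) * gf Y e'"
proof -
  let ?e = "\<lambda>(y, k). e' y + int d * int k"
  have *: "?e (f x) = e x" if "x \<in> X" for x
    using assms(2)[OF that] by (simp add: case_prod_beta)
  have "graded (Y \<times> multiplicities g h) ?e"
    using gf_bij(2)[OF assms(1), of ?e e] * assms(4) by blast
  from gf_times_multiplicities[OF assms(3) this] show
    "graded Y e'" "gf X e = phi_factor g h (fps_X ^ d) * gf Y e'"
    using gf_bij(1)[OF assms(1), of ?e e] * by auto
qed


section \<open>Cyclic sequences and elementary changes of the word\<close>

type_synonym step = "bool \<times> bool \<times> int"

abbreviation up :: "step \<Rightarrow> bool" where "up \<equiv> fst"
abbreviation horizontal :: "step \<Rightarrow> bool" where "horizontal x \<equiv> fst (snd x)"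
abbreviation label :: "step \<Rightarrow> int" where "label x \<equiv> snd (snd x)"

definition link :: "step \<Rightarrow> (nat \<Rightarrow> nat) \<Rightarrow> (nat \<Rightarrow> nat) \<Rightarrow> bool" where
  "link x p q \<longleftrightarrow> (if up x then strip (horizontal x) p q else strip (horizontal x) q p)"

definition cyclic_paths :: "step list \<Rightarrow> (nat \<Rightarrow> nat) list set" where
  "cyclic_paths L = {ps. length ps = length L \<and> (\<forall>p\<in>set ps. is_partition p) \<and>
     (\<forall>m<length L. link (L ! m) (ps ! m) (ps ! (Suc m mod length L)))}"

text \<open>
  A step with label \<open>t\<close> that changes the size by \<open>\<Delta>\<close> contributes \<open>- t \<Delta>\<close>. Labels instead of weights
  on the vertices keep the energy stable under the exchange of steps, and moving the last step
  to the front just lowers its label by \<open>N\<close>.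
\<close>

definition energy :: "int \<Rightarrow> step list \<Rightarrow> (nat \<Rightarrow> nat) list \<Rightarrow> int" where
  "energy N L ps = N * int (psize (ps ! 0)) - (\<Sum>m<length L. label (L ! m) *
     (int (psize (ps ! (Suc m mod length L))) - int (psize (ps ! m))))"

lemma cyclic_pathsD:
  assumes "ps \<in> cyclic_paths L" "m < length L"
  shows "is_partition (ps ! m)" "link (L ! m) (ps ! m) (ps ! (Suc m mod length L))"
  using assms by (auto simp: cyclic_paths_def)

text \<open>Only the partition between the two steps changes, by a toggle. The terms of the two
  steps give an energy difference of \<open>t - s\<close> times (old size + new size - sizes of the
  two neighbours), which is \<open>t - s\<close> times the multiplicity.\<close>

lemma swap_steps:
  fixes g h :: bool and s t :: int and A B :: "step list"
  defines "L \<equiv> A @ [(True, g, s), (False, h, t)] @ B"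
  defines "L' \<equiv> A @ [(False, h, t), (True, g, s)] @ B"
  assumes st: "s < t" and good: "graded (cyclic_paths L) (energy N L)"
  shows "graded (cyclic_paths L') (energy N L')"
    "gf (cyclic_paths L) (energy N L) =
     phi_factor g h (fps_X ^ nat (t - s)) * gf (cyclic_paths L') (energy N L')"
proof -
  define i where "i = length A"
  define n where "n = length L"
  have n: "n = Suc (Suc (i + length B))" and lens: "length L' = n" "length L = n"
    by (simp_all add: n_def L_def L'_def i_def)
  have nth: "L ! i = (True, g, s)" "L ! Suc i = (False, h, t)"
    "L' ! i = (False, h, t)" "L' ! Suc i = (True, g, s)"
    by (simp_all add: L_def L'_def i_def nth_append)
  have nth_other: "L ! m = L' ! m" if "m \<noteq> i" "m \<noteq> Suc i" for m
    using that by (auto simp: L_def L'_def i_def nth_append nth_Cons')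
  \<comment> \<open>The partition behind the pair. It is entry \<open>i\<close> again if there are
    only two steps. The toggled index \<open>Suc i\<close> is never 0, so the first summand of the
    energy stays the same.\<close>
  define k where "k = Suc (Suc i) mod n"
  have k: "k < n" "k \<noteq> Suc i" unfolding k_def using n by (auto simp: mod_Suc)
  have Suci: "Suc i mod n = Suc i" "Suc i < n" "i < n" using n by auto
  have other: "Suc m mod n \<noteq> Suc i" if "m \<noteq> i" "m < n" for m
    using that n by (auto simp: mod_Suc)
  \<comment> \<open>The conditions that do not mention entry \<open>Suc i\<close>; they are common
    to both words and survive the toggle.\<close>
  define R where "R K ps \<longleftrightarrow> length ps = n \<and> (\<forall>m<n. m \<noteq> Suc i \<longrightarrow> is_partition (ps ! m)) \<and>
      (\<forall>m<n. m \<noteq> i \<and> m \<noteq> Suc i \<longrightarrow> link (K ! m) (ps ! m) (ps ! (Suc m mod n)))" for K ps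
  have RL: "R L' = R L" by (auto simp: R_def fun_eq_iff nth_other)
  have all_n: "(\<forall>m<n. P m) \<longleftrightarrow> (\<forall>m<n. m \<noteq> i \<and> m \<noteq> Suc i \<longrightarrow> P m) \<and> P i \<and> P (Suc i)" for P
    using Suci by blast
  have all_n': "(\<forall>m<n. P m) \<longleftrightarrow> (\<forall>m<n. m \<noteq> Suc i \<longrightarrow> P m) \<and> P (Suc i)" for P
    using Suci by blast
  have linkL: "(\<forall>m<n. link (L ! m) (ps ! m) (ps ! (Suc m mod n))) \<longleftrightarrow>
      (\<forall>m<n. m \<noteq> i \<and> m \<noteq> Suc i \<longrightarrow> link (L ! m) (ps ! m) (ps ! (Suc m mod n))) \<and>
      strip g (ps ! i) (ps ! Suc i) \<and> strip h (ps ! k) (ps ! Suc i)"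
    and linkL': "(\<forall>m<n. link (L' ! m) (ps ! m) (ps ! (Suc m mod n))) \<longleftrightarrow>
      (\<forall>m<n. m \<noteq> i \<and> m \<noteq> Suc i \<longrightarrow> link (L' ! m) (ps ! m) (ps ! (Suc m mod n))) \<and>
      strip h (ps ! Suc i) (ps ! i) \<and> strip g (ps ! Suc i) (ps ! k)" for ps
    by (subst all_n, simp only: nth Suci k_def[symmetric], simp add: link_def)+
  have parts: "(\<forall>p\<in>set ps. is_partition p) \<longleftrightarrow>
      (\<forall>m<n. m \<noteq> Suc i \<longrightarrow> is_partition (ps ! m)) \<and> is_partition (ps ! Suc i)"
    if "length ps = n" for ps
    unfolding all_set_conv_all_nth that by (rule all_n')
  have memL: "ps \<in> cyclic_paths L \<longleftrightarrow> R L ps \<and> ps ! Suc i \<in> uppers g h (ps ! i) (ps ! k)" for ps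
    unfolding cyclic_paths_def R_def mem_Collect_eq lens linkL uppers_def using parts[of ps] by blast
  have memL': "ps \<in> cyclic_paths L' \<longleftrightarrow> R L ps \<and> ps ! Suc i \<in> lowers g h (ps ! i) (ps ! k)" for ps
    unfolding RL[symmetric] unfolding cyclic_paths_def R_def mem_Collect_eq lens linkL' lowers_def
    using parts[of ps] by blast
  have R_upd: "R K (ps[Suc i := p]) \<longleftrightarrow> R K ps" for K ps p
  proof -
    have "ps[Suc i := p] ! m = ps ! m" if "m \<noteq> Suc i" for m
      using that by simp
    moreover have "ps[Suc i := p] ! (Suc m mod n) = ps ! (Suc m mod n)" if "m \<noteq> i" "m < n" for m
      using other[OF that] by (intro nth_list_update_neq) simp
    ultimately show ?thesis unfolding R_def length_list_update by (simp cong: conj_cong)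
  qed
  have nth_upd: "length ps = n \<Longrightarrow> ps[Suc i := p] ! Suc i = p" "ps[Suc i := p] ! i = ps ! i"
    "ps[Suc i := p] ! k = ps ! k" for ps and p :: "nat \<Rightarrow> nat"
    using Suci k by auto
  \<comment> \<open>The bijection is chosen from the two neighbours alone. They are left in place,
    so the image still tells which bijection was applied.\<close>
  define T where "T \<mu> \<nu> = (SOME f. toggle g h \<mu> \<nu> f)" for \<mu> \<nu>
  have T: "toggle g h (ps ! i) (ps ! k) (T (ps ! i) (ps ! k))" if "R L ps" for ps
    unfolding T_def by (rule someI_ex[OF ex_toggle]) (use that k Suci in \<open>auto simp: R_def\<close>)
  have T_bij: "bij_betw (T (ps ! i) (ps ! k)) (uppers g h (ps ! i) (ps ! k))
      (lowers g h (ps ! i) (ps ! k) \<times> multiplicities g h)" if "R L ps" for ps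
    using T[OF that] by (simp add: toggle_def)
  define F where "F ps = (let x = T (ps ! i) (ps ! k) (ps ! Suc i) in (ps[Suc i := fst x], snd x))" for ps
  have len: "R L ps \<Longrightarrow> length ps = n" for ps by (simp add: R_def)
  have "bij_betw F (cyclic_paths L) (cyclic_paths L' \<times> multiplicities g h)"
    unfolding bij_betw_def
  proof
    show "inj_on F (cyclic_paths L)"
    proof (rule inj_onI)
      fix ps qs assume ps: "ps \<in> cyclic_paths L" and qs: "qs \<in> cyclic_paths L" and eq: "F ps = F qs"
      from eq have *: "ps[Suc i := fst (T (ps ! i) (ps ! k) (ps ! Suc i))] =
          qs[Suc i := fst (T (qs ! i) (qs ! k) (qs ! Suc i))]"
        "snd (T (ps ! i) (ps ! k) (ps ! Suc i)) = snd (T (qs ! i) (qs ! k) (qs ! Suc i))"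
        by (auto simp: F_def Let_def)
      have same: "ps ! i = qs ! i" "ps ! k = qs ! k"
        using arg_cong[OF *(1), of "\<lambda>xs. xs ! i"] arg_cong[OF *(1), of "\<lambda>xs. xs ! k"] by (simp_all add: nth_upd)
      have "T (ps ! i) (ps ! k) (ps ! Suc i) = T (ps ! i) (ps ! k) (qs ! Suc i)"
        using arg_cong[OF *(1), of "\<lambda>xs. xs ! Suc i"] *(2) same len ps qs
        by (simp add: nth_upd memL prod_eq_iff)
      then have "ps ! Suc i = qs ! Suc i"
        using T_bij[of ps] ps qs same unfolding memL bij_betw_def by (auto dest: inj_onD)
      then show "ps = qs"
        using *(1) by (metis list_update_id list_update_overwrite)
    qed
    show "F ` cyclic_paths L = cyclic_paths L' \<times> multiplicities g h"
    proof (intro equalityI subsetI)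
      fix x assume "x \<in> F ` cyclic_paths L"
      then obtain ps where ps: "ps \<in> cyclic_paths L" and x: "x = F ps" by blast
      have "T (ps ! i) (ps ! k) (ps ! Suc i) \<in> lowers g h (ps ! i) (ps ! k) \<times> multiplicities g h"
        using bij_betwE[OF T_bij] ps by (simp add: memL)
      then show "x \<in> cyclic_paths L' \<times> multiplicities g h"
        using ps len unfolding x F_def Let_def mem_Times_iff memL' memL fst_conv snd_conv
        by (simp add: R_upd nth_upd)
    next
      fix x assume x: "x \<in> cyclic_paths L' \<times> multiplicities g h"
      obtain qs m where qs: "x = (qs, m)" by (cases x)
      have q: "R L qs" "qs ! Suc i \<in> lowers g h (qs ! i) (qs ! k)" "m \<in> multiplicities g h"
        using x unfolding qs by (auto simp: memL')
      then obtain p where p: "p \<in> uppers g h (qs ! i) (qs ! k)"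
        "T (qs ! i) (qs ! k) p = (qs ! Suc i, m)"
        using T_bij[OF q(1)] unfolding bij_betw_def by (metis (no_types, lifting) SigmaI imageE)
      have "qs[Suc i := p] \<in> cyclic_paths L"
        using p q len by (simp add: memL R_upd nth_upd)
      moreover have "F (qs[Suc i := p]) = x"
        using p q len by (simp add: F_def nth_upd qs)
      ultimately show "x \<in> F ` cyclic_paths L" by (metis imageI)
    qed
  qed
  moreover have "energy N L ps = energy N L' (fst (F ps)) + int (nat (t - s)) * int (snd (F ps))"
    if ps: "ps \<in> cyclic_paths L" for ps
  proof -
    define qs where "qs = fst (F ps)"
    define x where "x = T (ps ! i) (ps ! k) (ps ! Suc i)"
    have q: "qs ! m = ps ! m" if "m \<noteq> Suc i" for m
      using that by (simp add: qs_def F_def Let_def)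
    have qi: "qs ! Suc i = fst x" using ps len by (simp add: qs_def F_def Let_def nth_upd memL x_def)
    have split: "(\<Sum>m<n. f m) = (\<Sum>m\<in>{..<n} - {i, Suc i}. f m) + f i + f (Suc i)" for f :: "nat \<Rightarrow> int"
      using Suci by (subst sum.subset_diff[of "{i, Suc i}"]) auto
    have eq: "(\<Sum>m\<in>{..<n} - {i, Suc i}. label (L ! m) *
         (int (psize (ps ! (Suc m mod n))) - int (psize (ps ! m)))) =
       (\<Sum>m\<in>{..<n} - {i, Suc i}. label (L' ! m) *
         (int (psize (qs ! (Suc m mod n))) - int (psize (qs ! m))))"
      using other q nth_other by (intro sum.cong) auto
    have "psize (ps ! Suc i) + psize (fst x) = psize (ps ! i) + psize (ps ! k) + snd x"
      using T[of ps] ps unfolding toggle_def memL x_def by blast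
    then have sz: "int (psize (ps ! Suc i)) =
        int (psize (ps ! i)) + int (psize (ps ! k)) + int (snd x) - int (psize (fst x))" by linarith
    have Fx: "snd (F ps) = snd x" by (simp add: F_def x_def Let_def)
    have Sn: "Suc (Suc i) mod n = k" by (simp add: k_def)
    show ?thesis
      unfolding energy_def lens split eq nth Suci(1) Sn qs_def[symmetric] Fx sz
      using q[of 0] q[of i] q[OF k(2)] qi st by (simp add: algebra_simps)
  qed
  ultimately show "graded (cyclic_paths L') (energy N L')"
    "gf (cyclic_paths L) (energy N L) =
     phi_factor g h (fps_X ^ nat (t - s)) * gf (cyclic_paths L') (energy N L')"
    using gf_extract[of F "cyclic_paths L" "cyclic_paths L'" g h "energy N L" "energy N L'" "nat (t - s)"]
      st good by auto
qed

lemma sum_mod_Suc: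
  fixes f :: "nat \<Rightarrow> 'a::comm_monoid_add"
  shows "(\<Sum>m<n. f (Suc m mod n)) = (\<Sum>m<n. f m)"
proof (cases n)
  case (Suc k)
  have "(\<Sum>m<k. f (Suc m mod n)) = (\<Sum>m<k. f (Suc m))"
    by (rule sum.cong) (auto simp: Suc)
  then show ?thesis
    unfolding Suc by (subst (2) sum.lessThan_Suc_shift) (simp add: Suc add.commute)
qed simp

text \<open>The base point of the energy moves across the rotated step. This changes the first
  summand by \<open>N\<close> times the size change along that step, which is what lowering its
  label by \<open>N\<close> compensates.\<close>

lemma rotate_step:
  fixes A :: "step list" and u h :: bool and t N :: int
  defines "L \<equiv> A @ [(u, h, t)]" and "L' \<equiv> (u, h, t - N) # A"
  shows "gf (cyclic_paths L) (energy N L) = gf (cyclic_paths L') (energy N L')"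
    "graded (cyclic_paths L) (energy N L) \<longleftrightarrow> graded (cyclic_paths L') (energy N L')"
proof -
  define n where "n = length L"
  have n: "length L' = n" "n > 0" "n = Suc (length A)" "length L = n"
    by (simp_all add: n_def L_def L'_def)
  have L: "link (L' ! (Suc m mod n)) = link (L ! m)"
    "label (L ! m) = label (L' ! (Suc m mod n)) + (if Suc m mod n = 0 then N else 0)"
    if "m < n" for m
    using that n by (auto simp: L_def L'_def mod_Suc nth_append link_def fun_eq_iff)
  have SS: "Suc (Suc m mod n) mod n = Suc (Suc m) mod n" for m
    by (simp add: mod_Suc_eq)
  have nth: "rotate1 qs ! m = qs ! (Suc m mod n)" if "length qs = n" "m < n" for qs :: "(nat \<Rightarrow> nat) list" and m
    using that nth_rotate1 by metis
  have all: "(\<forall>m<n. P (Suc m mod n)) \<longleftrightarrow> (\<forall>m<n. P m)" for P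
  proof
    assume *: "\<forall>m<n. P (Suc m mod n)"
    show "\<forall>m<n. P m"
    proof (intro allI impI)
      fix m assume "m < n"
      then show "P m"
        using *[rule_format, of "n - 1"] *[rule_format, of "m - 1"] n(2) by (cases m) auto
    qed
  qed (use n in auto)
  have mem: "rotate1 qs \<in> cyclic_paths L \<longleftrightarrow> qs \<in> cyclic_paths L'" for qs
  proof (cases "length qs = n")
    case True
    have "(\<forall>m<n. link (L ! m) (rotate1 qs ! m) (rotate1 qs ! (Suc m mod n))) \<longleftrightarrow>
        (\<forall>m<n. link (L' ! (Suc m mod n)) (qs ! (Suc m mod n)) (qs ! (Suc (Suc m mod n) mod n)))"
      using nth[OF True] L n by auto
    also have "\<dots> \<longleftrightarrow> (\<forall>m<n. link (L' ! m) (qs ! m) (qs ! (Suc m mod n)))"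
      by (rule all)
    finally show ?thesis using True by (simp add: cyclic_paths_def n)
  qed (simp add: cyclic_paths_def n)
  have bij: "bij_betw rotate1 (cyclic_paths L') (cyclic_paths L)"
    unfolding bij_betw_def
  proof
    show "inj_on rotate1 (cyclic_paths L')"
      by (metis inj_on_subset inj_rotate1 subset_UNIV)
    show "rotate1 ` cyclic_paths L' = cyclic_paths L"
    proof
      show "rotate1 ` cyclic_paths L' \<subseteq> cyclic_paths L" using mem by auto
      show "cyclic_paths L \<subseteq> rotate1 ` cyclic_paths L'"
        using mem surj_rotate1 by (metis imageI subsetI surjD)
    qed
  qed
  have e: "energy N L (rotate1 qs) = energy N L' qs" if "qs \<in> cyclic_paths L'" for qs
  proof -
    have len: "length qs = n" using that by (simp add: cyclic_paths_def n)
    define z where "z m = int (psize (qs ! m))" for m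
    have "(\<Sum>m<n. label (L ! m) * (int (psize (rotate1 qs ! (Suc m mod n))) - int (psize (rotate1 qs ! m)))) =
        (\<Sum>m<n. (label (L' ! (Suc m mod n)) + (if Suc m mod n = 0 then N else 0)) *
           (z (Suc (Suc m mod n) mod n) - z (Suc m mod n)))"
      using nth[OF len] L n by (intro sum.cong) (auto simp: z_def)
    also have "\<dots> = (\<Sum>m<n. (label (L' ! m) + (if m = 0 then N else 0)) * (z (Suc m mod n) - z m))"
      by (rule sum_mod_Suc)
    also have "\<dots> = (\<Sum>m<n. label (L' ! m) * (z (Suc m mod n) - z m)) +
        (\<Sum>m<n. if m = 0 then N * (z (Suc 0 mod n) - z 0) else 0)"
      unfolding sum.distrib[symmetric] by (intro sum.cong) (auto simp: algebra_simps)
    also have "(\<Sum>m<n. if m = 0 then N * (z (Suc 0 mod n) - z 0) else 0) = N * (z (Suc 0 mod n) - z 0)"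
      using n(2) by simp
    finally show ?thesis
      using nth[OF len n(2)] by (simp add: energy_def n z_def algebra_simps)
  qed
  show "gf (cyclic_paths L) (energy N L) = gf (cyclic_paths L') (energy N L')"
    "graded (cyclic_paths L) (energy N L) \<longleftrightarrow> graded (cyclic_paths L') (energy N L')"
    using gf_bij[OF bij, of "energy N L" "energy N L'"] e by auto
qed

section \<open>Sorting the word and going around the cylinder\<close>

text \<open>Gradedness is a premise and is passed on, so the relation composes and finiteness has to
  be known for the initial word only.\<close>

definition evolves :: "int \<Rightarrow> step list \<Rightarrow> rat fps \<Rightarrow> step list \<Rightarrow> bool" where
  "evolves N L c L' \<longleftrightarrow> (graded (cyclic_paths L) (energy N L) \<longrightarrow>
     graded (cyclic_paths L') (energy N L') \<and>
     gf (cyclic_paths L) (energy N L) = c * gf (cyclic_paths L') (energy N L'))"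

lemma evolves_refl: "evolves N L 1 L"
  by (simp add: evolves_def)

lemma evolves_trans: "evolves N L c L' \<Longrightarrow> evolves N L' c' L'' \<Longrightarrow> evolves N L (c * c') L''"
  by (auto simp: evolves_def mult.assoc)

definition pair_factor :: "step \<Rightarrow> step \<Rightarrow> rat fps" where
  "pair_factor u d = phi_factor (horizontal u) (horizontal d) (fps_X ^ nat (label d - label u))"

lemma evolves_bubble:
  assumes "up u" "\<forall>d\<in>set Ds. \<not> up d \<and> label u < label d"
  shows "evolves N (A @ [u] @ Ds @ B) (\<Prod>d\<leftarrow>Ds. pair_factor u d) (A @ Ds @ [u] @ B)"
  using assms(2)
proof (induction Ds arbitrary: A)
  case Nil
  then show ?case by (simp add: evolves_refl)
next
  case (Cons d Ds)
  obtain g s h t where u: "u = (True, g, s)" and d: "d = (False, h, t)"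
    using assms(1) Cons.prems by (cases u; cases d) auto
  have "evolves N (A @ [u, d] @ Ds @ B) (pair_factor u d) (A @ [d, u] @ Ds @ B)"
    using swap_steps[of s t A g h "Ds @ B" N] Cons.prems
    by (auto simp: evolves_def pair_factor_def u d)
  moreover have "evolves N ((A @ [d]) @ [u] @ Ds @ B) (\<Prod>d\<leftarrow>Ds. pair_factor u d) ((A @ [d]) @ Ds @ [u] @ B)"
    by (rule Cons.IH) (use Cons.prems in simp)
  ultimately show ?case using evolves_trans by fastforce
qed

text \<open>One factor for every up step that stands before a down step, that is, for every exchange
  made by sorting.\<close>

primrec inversion_product :: "step list \<Rightarrow> rat fps" where
  "inversion_product [] = 1"
| "inversion_product (x # L) =
     (if up x then \<Prod>d\<leftarrow>filter (\<lambda>x. \<not> up x) L. pair_factor x d else 1) * inversion_product L"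

text \<open>Insertion sort: once the tail is sorted, a leading up step travels through all its down
  steps. The ordering hypothesis ensures that each exchange has a positive exponent.\<close>

lemma evolves_sort:
  assumes "sorted_wrt (\<lambda>x y. up x \<and> \<not> up y \<longrightarrow> label x < label y) L"
  shows "evolves N (A @ L @ B) (inversion_product L) (A @ filter (\<lambda>x. \<not> up x) L @ filter up L @ B)"
  using assms
proof (induction L arbitrary: A)
  case Nil
  then show ?case by (simp add: evolves_refl)
next
  case (Cons x L)
  have IH: "evolves N ((A @ [x]) @ L @ B) (inversion_product L)
      ((A @ [x]) @ filter (\<lambda>x. \<not> up x) L @ filter up L @ B)"
    by (rule Cons.IH) (use Cons.prems in simp)
  show ?case
  proof (cases "up x")
    case True
    have "evolves N (A @ [x] @ filter (\<lambda>x. \<not> up x) L @ filter up L @ B)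
        (\<Prod>d\<leftarrow>filter (\<lambda>x. \<not> up x) L. pair_factor x d)
        (A @ filter (\<lambda>x. \<not> up x) L @ [x] @ filter up L @ B)"
      by (rule evolves_bubble) (use True Cons.prems in auto)
    from evolves_trans[OF IH[simplified] this[simplified]] True show ?thesis
      by (simp add: mult.commute)
  qed (use IH in simp)
qed

definition shift :: "int \<Rightarrow> step \<Rightarrow> step" where
  "shift N x = (up x, horizontal x, label x - N)"

lemma shift_simps [simp]: "up (shift N x) = up x" "horizontal (shift N x) = horizontal x"
  "label (shift N x) = label x - N"
  by (simp_all add: shift_def)

lemma evolves_rotate: "evolves N (A @ B) 1 (map (shift N) B @ A)"
proof (induction B arbitrary: A rule: rev_induct)
  case Nil
  then show ?case by (simp add: evolves_refl)
next
  case (snoc x B)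
  obtain u h t where x: "x = (u, h, t)" by (cases x)
  have "evolves N ((A @ B) @ [x]) 1 (shift N x # A @ B)"
    using rotate_step[of "A @ B" u h t N] by (simp add: evolves_def x shift_def)
  from evolves_trans[OF this, of 1] snoc[of "shift N x # A"] show ?case by simp
qed

lemma inversion_product_append:
  assumes "\<forall>u\<in>set Us. up u" "\<forall>d\<in>set Ds. \<not> up d"
  shows "inversion_product (Us @ Ds) = (\<Prod>u\<leftarrow>Us. \<Prod>d\<leftarrow>Ds. pair_factor u d)"
proof -
  have "inversion_product Ds = 1" using assms(2) by (induction Ds) auto
  moreover have "filter (\<lambda>x. \<not> up x) Ds = Ds" using assms(2) by simp
  ultimately show ?thesis using assms(1) by (induction Us) auto
qed

text \<open>The up steps at the end are rotated to the front, which lowers their labels by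
  \<open>N\<close>, and are then sorted back behind the down steps; every pair is exchanged
  once.\<close>

lemma evolves_round:
  assumes "\<forall>u\<in>set Us. up u" "\<forall>d\<in>set Ds. \<not> up d"
    and "\<And>u d. u \<in> set Us \<Longrightarrow> d \<in> set Ds \<Longrightarrow> label u - N < label d"
  shows "evolves N (Ds @ Us) (\<Prod>u\<leftarrow>Us. \<Prod>d\<leftarrow>Ds. pair_factor (shift N u) d) (Ds @ map (shift N) Us)"
proof -
  let ?L = "map (shift N) Us @ Ds"
  have Us: "\<forall>u\<in>set (map (shift N) Us). up u" using assms(1) by auto
  have "sorted_wrt (\<lambda>x y. up x \<and> \<not> up y \<longrightarrow> label x < label y) ?L"
    using assms by (auto simp: sorted_wrt_append sorted_wrt_map intro!: sorted_wrt_mono_rel[OF _ sorted_wrt_true])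
  then have "evolves N ([] @ ?L @ []) (inversion_product ?L)
      ([] @ filter (\<lambda>x. \<not> up x) ?L @ filter up ?L @ [])"
    by (rule evolves_sort)
  moreover have "filter (\<lambda>x. \<not> up x) ?L = Ds" "filter up ?L = map (shift N) Us"
    using assms(1,2) Us by (auto simp: filter_empty_conv filter_id_conv)
  moreover have "inversion_product ?L = (\<Prod>u\<leftarrow>Us. \<Prod>d\<leftarrow>Ds. pair_factor (shift N u) d)"
    using inversion_product_append[OF Us assms(2)] by (simp add: comp_def)
  ultimately have "evolves N ?L (\<Prod>u\<leftarrow>Us. \<Prod>d\<leftarrow>Ds. pair_factor (shift N u) d) (Ds @ map (shift N) Us)"
    by (simp only: append_Nil append_Nil2)
  from evolves_trans[OF evolves_rotate this] show ?thesis by simp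
qed

text \<open>As the labels of the up steps only sink, the condition for a further round
  persists.\<close>

lemma evolves_rounds:
  assumes "\<forall>u\<in>set Us. up u" "\<forall>d\<in>set Ds. \<not> up d"
    and "\<And>u d. u \<in> set Us \<Longrightarrow> d \<in> set Ds \<Longrightarrow> label u - N < label d" and "N \<ge> 0"
  shows "evolves N (Ds @ Us) (\<Prod>k<K. \<Prod>u\<leftarrow>Us. \<Prod>d\<leftarrow>Ds. pair_factor (shift (int (Suc k) * N) u) d)
    (Ds @ map (shift (int K * N)) Us)"
proof (induction K)
  case 0
  have "map (shift 0) Us = Us" by (rule map_idI) (simp add: shift_def)
  then show ?case by (simp add: evolves_refl)
next
  case (Suc K)
  have sh: "shift N (shift (int K * N) u) = shift (int (Suc K) * N) u" for u
    by (simp add: shift_def algebra_simps)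
  have "evolves N (Ds @ map (shift (int K * N)) Us)
      (\<Prod>u\<leftarrow>map (shift (int K * N)) Us. \<Prod>d\<leftarrow>Ds. pair_factor (shift N u) d)
      (Ds @ map (shift N) (map (shift (int K * N)) Us))"
  proof (rule evolves_round)
    fix u d assume "u \<in> set (map (shift (int K * N)) Us)" "d \<in> set Ds"
    then obtain v where "v \<in> set Us" "u = shift (int K * N) v" by auto
    moreover have "int K * N \<ge> 0" using assms(4) by simp
    ultimately show "label u - N < label d" using assms(3)[of v d] \<open>d \<in> set Ds\<close> by simp
  qed (use assms in auto)
  from evolves_trans[OF Suc this] show ?case by (simp add: sh comp_def del: of_nat_Suc)
qed

section \<open>Low coefficients after many rounds\<close>

text \<open>Sizes weakly grow along up steps, whose labels are now at most \<open>- (K * N)\<close>,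
  and weakly fall along down steps, whose labels are nonnegative. So every term of the energy is
  nonnegative, and a single proper growth already costs \<open>K * N > n\<close>. Hence no step
  grows; as the changes around the cycle add up to 0, none falls either.\<close>

lemma stable_paths:
  fixes N :: nat
  assumes "\<forall>d\<in>set Ds. \<not> up d \<and> label d \<ge> 0" and "\<forall>u\<in>set Us. up u \<and> label u \<le> int N"
    and L: "L = Ds @ map (shift (int (Suc K) * int N)) Us"
    and N: "length L = N" and "n < K * N"
  shows "ps \<in> cyclic_paths L \<and> energy (int N) L ps = int n \<longleftrightarrow>
    (\<exists>p. is_partition p \<and> int N * int (psize p) = int n \<and> ps = replicate N p)"
proof
  assume *: "ps \<in> cyclic_paths L \<and> energy (int N) L ps = int n"
  then have len: "length ps = N" and N0: "N > 0"
    using N assms(5) by (auto simp: cyclic_paths_def)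
  define \<Delta> where "\<Delta> m = int (psize (ps ! (Suc m mod N))) - int (psize (ps ! m))" for m
  have part: "is_partition (ps ! m)" and link: "link (L ! m) (ps ! m) (ps ! (Suc m mod N))" if "m < N" for m
    using * that N by (auto dest: cyclic_pathsD)
  have L_cases: "(\<not> up (L ! m) \<and> label (L ! m) \<ge> 0) \<or> (up (L ! m) \<and> label (L ! m) \<le> - int (K * N))"
    if "m < N" for m
  proof -
    have "L ! m \<in> set L" using that N by simp
    then show ?thesis
      using assms(1,2) by (fastforce simp: L algebra_simps)
  qed
  have signs: "up (L ! m) \<Longrightarrow> \<Delta> m \<ge> 0" "\<not> up (L ! m) \<Longrightarrow> \<Delta> m \<le> 0" if "m < N" for m
    using link[OF that] strip_size part[OF that] part[of "Suc m mod N"] N0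
    by (auto simp: link_def \<Delta>_def)
  have nonpos: "label (L ! m) * \<Delta> m \<le> 0" if "m < N" for m
  proof -
    have "label (L ! m) \<le> 0" if "label (L ! m) \<le> - int (K * N)"
      using that by (rule order.trans) simp
    then show ?thesis
      using L_cases[OF that] signs[OF that] unfolding mult_le_0_iff by blast
  qed
  have up0: "\<Delta> m \<le> 0" if m: "m < N" for m
  proof (rule ccontr)
    assume "\<not> \<Delta> m \<le> 0"
    then have "up (L ! m)" "\<Delta> m \<ge> 1" using signs[OF m] by auto
    moreover from this have lab: "label (L ! m) \<le> - int (K * N)" using L_cases[OF m] by blast
    moreover from this have "label (L ! m) \<le> 0" by (rule order.trans) simp
    ultimately have "label (L ! m) * \<Delta> m \<le> label (L ! m) * 1"
      by (intro mult_left_mono_neg)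
    then have "label (L ! m) * \<Delta> m \<le> - int (K * N)" using lab by linarith
    moreover have "(\<Sum>m<N. label (L ! m) * \<Delta> m) \<le> label (L ! m) * \<Delta> m"
      using m nonpos by (subst sum.remove[of _ m]) (auto intro!: sum_nonpos)
    moreover have "int N * int (psize (ps ! 0)) \<ge> 0" by simp
    ultimately have "energy (int N) L ps \<ge> int (K * N)"
      unfolding energy_def N \<Delta>_def[symmetric] by linarith
    then show False using * assms(5) by (metis not_less of_nat_less_iff)
  qed
  have "(\<Sum>m<N. \<Delta> m) = 0"
    unfolding \<Delta>_def sum_subtractf using sum_mod_Suc[of "\<lambda>m. int (psize (ps ! m))" N] by simp
  then have \<Delta>0: "\<Delta> m = 0" if "m < N" for m
    using sum_nonneg_eq_0_iff[of "{..<N}" "\<lambda>m. - \<Delta> m"] up0 that by (auto simp: sum_negf)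
  have step: "ps ! (Suc m mod N) = ps ! m" if "m < N" for m
  proof -
    have "Suc m mod N < N" using N0 by simp
    note parts = part[OF that] part[OF this]
    have "psize (ps ! (Suc m mod N)) = psize (ps ! m)"
      using \<Delta>0[OF that] by (simp add: \<Delta>_def)
    note size = this
    show ?thesis
    proof (cases "up (L ! m)")
      case True
      then have "strip (horizontal (L ! m)) (ps ! m) (ps ! (Suc m mod N))"
        using link[OF that] by (simp add: link_def)
      from strip_size_eq[OF this parts(2) size[symmetric]] show ?thesis by simp
    next
      case False
      then have "strip (horizontal (L ! m)) (ps ! (Suc m mod N)) (ps ! m)"
        using link[OF that] by (simp add: link_def)
      from strip_size_eq[OF this parts(1) size] show ?thesis .
    qed
  qed
  define p where "p = ps ! 0"
  have ps_nth: "ps ! m = p" if "m < N" for m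
    using that
  proof (induction m)
    case (Suc m)
    then show ?case using step[of m] by simp
  qed (simp add: p_def)
  have rep: "ps = replicate N p"
  proof (rule nth_equalityI)
    show "length ps = length (replicate N p)" by (simp add: len)
    show "ps ! i = replicate N p ! i" if "i < length ps" for i
      using that ps_nth by (simp add: len)
  qed
  have "(\<Sum>m<N. label (L ! m) * \<Delta> m) = 0" using \<Delta>0 by (intro sum.neutral) simp
  then have en: "energy (int N) L ps = int N * int (psize p)"
    unfolding energy_def N by (simp add: \<Delta>_def p_def)
  show "\<exists>p. is_partition p \<and> int N * int (psize p) = int n \<and> ps = replicate N p"
  proof (intro exI conjI)
    show "is_partition p" using part[OF N0] by (simp add: p_def)
    show "int N * int (psize p) = int n" using * en by simp
  qed (rule rep)
next
  assume "\<exists>p. is_partition p \<and> int N * int (psize p) = int n \<and> ps = replicate N p"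
  then obtain p where p: "is_partition p" "int N * int (psize p) = int n" "ps = replicate N p" by blast
  have N0: "N > 0" using assms(5) by (cases N) auto
  have "ps \<in> cyclic_paths L"
    using p N N0 by (auto simp: cyclic_paths_def link_def strip_refl)
  moreover have "(\<Sum>m<N. label (L ! m) * (int (psize (ps ! (Suc m mod N))) - int (psize (ps ! m)))) = 0"
    using p N0 by (intro sum.neutral) auto
  ultimately show "ps \<in> cyclic_paths L \<and> energy (int N) L ps = int n"
    using p N N0 by (simp add: energy_def)
qed

lemma gf_stable_paths:
  fixes N :: nat
  assumes "\<forall>d\<in>set Ds. \<not> up d \<and> label d \<ge> 0" and "\<forall>u\<in>set Us. up u \<and> label u \<le> int N"
    and "length Ds + length Us = N" and "n < K * N"
  defines "L \<equiv> Ds @ map (shift (int (Suc K) * int N)) Us"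
  shows "fps_nth (gf (cyclic_paths L) (energy (int N) L)) n =
    fps_nth (gf {p. is_partition p} (\<lambda>p. int N * int (psize p))) n"
proof -
  have "N > 0" using assms(4) by (cases N) auto
  have "{ps \<in> cyclic_paths L. energy (int N) L ps = int n} =
      replicate N ` {p \<in> {p. is_partition p}. int N * int (psize p) = int n}"
    using stable_paths[OF assms(1,2) L_def[THEN meta_eq_to_obj_eq] _ assms(4)] assms(3)
    by (auto simp: L_def)
  moreover have "inj_on (replicate N) A" for A :: "(nat \<Rightarrow> nat) set"
    using \<open>N > 0\<close> by (auto simp: inj_on_def)
  ultimately show ?thesis by (simp add: gf_def card_image)
qed


section \<open>The generating function of partitions\<close>

lemma graded_partitions: "N > 0 \<Longrightarrow> graded {p. is_partition p \<and> P p} (\<lambda>p. int N * int (psize p))"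
  unfolding graded_def
proof (intro conjI allI)
  fix n :: int assume N: "N > 0"
  show "finite {p \<in> {p. is_partition p \<and> P p}. int N * int (psize p) = n}"
  proof (rule finite_subset[OF _ finite_partitions[of "nat n"]], clarsimp)
    fix p
    have "1 * int (psize p) \<le> int N * int (psize p)" using N by (intro mult_right_mono) auto
    then show "psize p \<le> nat (int N * int (psize p))" by linarith
  qed
qed simp

text \<open>Subtracting the last of \<open>Suc K\<close> parts from all of them removes the full
  columns, each of \<open>Suc K\<close> boxes, and leaves at most \<open>K\<close> parts. The kinds
  \<open>True True\<close> select the multiplicity set \<open>UNIV\<close> and the factor
  \<open>1 / (1 - x)\<close>.\<close>

lemma gf_bounded_partitions:
  assumes N: "N > 0"
  shows "gf {p. is_partition p \<and> (\<forall>i\<ge>K. p i = 0)} (\<lambda>p. int N * int (psize p)) =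
    (\<Prod>k<K. 1 / (1 - fps_X ^ (N * Suc k)))"
proof (induction K)
  case 0
  have "{p. is_partition p \<and> (\<forall>i\<ge>0. p i = 0)} = {\<lambda>_. 0}"
    using partition_zero by auto
  moreover have "{p \<in> {\<lambda>_. 0}. int N * int (psize p) = int n} = (if n = 0 then {\<lambda>_. 0} else {})" for n
    using psize_eq_sum[of 0 "\<lambda>_. 0"] by auto
  ultimately show ?case by (intro fps_ext) (simp add: gf_def)
next
  case (Suc K)
  let ?X = "\<lambda>K. {p. is_partition p \<and> (\<forall>i\<ge>K. p i = 0)}"
  define f where "f p = ((\<lambda>i. p i - p K), p K)" for p :: "nat \<Rightarrow> nat"
  define g where "g x = (\<lambda>i. if i \<le> K then fst x i + snd x else 0)" for x :: "(nat \<Rightarrow> nat) \<times> nat"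
  have dec: "p K \<le> p i" if "p \<in> ?X (Suc K)" "i \<le> K" for p i
    using that partition_decseq by auto
  have "bij_betw f (?X (Suc K)) (?X K \<times> multiplicities True True)"
  proof (rule bij_betw_byWitness[of _ g])
    show "\<forall>p\<in>?X (Suc K). g (f p) = p"
      using dec by (auto simp: f_def g_def fun_eq_iff not_le Suc_le_eq)
    show "\<forall>x\<in>?X K \<times> multiplicities True True. f (g x) = x"
      by (auto simp: f_def g_def fun_eq_iff)
    show "f ` ?X (Suc K) \<subseteq> ?X K \<times> multiplicities True True"
    proof
      fix y assume "y \<in> f ` ?X (Suc K)"
      then obtain p where p: "is_partition p" "y = f p" by auto
      have "is_partition (\<lambda>i. p i - p K)"
        by (rule partitionI[of _ K]) (use partition_decseq[OF p(1)] in \<open>auto intro: diff_le_mono\<close>)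
      then show "y \<in> ?X K \<times> multiplicities True True"
        using p partition_decseq[OF p(1)] by (auto simp: f_def multiplicities_def)
    qed
    show "g ` (?X K \<times> multiplicities True True) \<subseteq> ?X (Suc K)"
    proof
      fix p assume "p \<in> g ` (?X K \<times> multiplicities True True)"
      then obtain x where x: "is_partition (fst x)" "p = g x" by auto
      have "is_partition p"
        by (rule partitionI[of _ "Suc K"]) (use partition_decseq[OF x(1)] in \<open>auto simp: x(2) g_def\<close>)
      then show "p \<in> ?X (Suc K)" by (auto simp: x(2) g_def)
    qed
  qed
  moreover have "int N * int (psize p) =
      int N * int (psize (fst (f p))) + int (N * Suc K) * int (snd (f p))" if p: "p \<in> ?X (Suc K)" for p
  proof -
    have "psize p = (\<Sum>i<Suc K. p i)" by (rule psize_eq_sum) (use p in auto)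
    also have "\<dots> = (\<Sum>i<Suc K. (p i - p K) + p K)" using dec[OF p] by (intro sum.cong) auto
    also have "\<dots> = (\<Sum>i<Suc K. p i - p K) + Suc K * p K" by (simp only: sum.distrib) simp
    also have "(\<Sum>i<Suc K. p i - p K) = psize (fst (f p))"
      using p by (subst psize_eq_sum[of "Suc K"]) (auto simp: f_def)
    finally have "psize p = psize (fst (f p)) + Suc K * snd (f p)" by (simp add: f_def)
    then show ?thesis by (simp add: algebra_simps del: mult_Suc)
  qed
  ultimately have "gf (?X (Suc K)) (\<lambda>p. int N * int (psize p)) =
      phi_factor True True (fps_X ^ (N * Suc K)) * gf (?X K) (\<lambda>p. int N * int (psize p))"
    by (rule gf_extract(2)) (use N in \<open>simp_all add: graded_partitions\<close>)
  then show ?case using Suc by (simp add: phi_factor_def mult.commute del: mult_Suc_right)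
qed

text \<open>A partition counted in degree \<open>n\<close> has size at most \<open>n\<close>, hence
  at most \<open>K\<close> parts, so the finite product is already exact there.\<close>

lemma fps_nth_gf_partitions:
  assumes "N > 0" "n \<le> K"
  shows "fps_nth (gf {p. is_partition p} (\<lambda>p. int N * int (psize p))) n =
    fps_nth (\<Prod>k<K. 1 / (1 - fps_X ^ (N * Suc k))) n"
proof -
  have "{p \<in> {p. is_partition p}. int N * int (psize p) = int n} =
      {p \<in> {p. is_partition p \<and> (\<forall>i\<ge>K. p i = 0)}. int N * int (psize p) = int n}"
  proof -
    have "p i = 0" if "is_partition p" "int N * int (psize p) = int n" "i \<ge> K" for p i
    proof (rule part_zero_beyond_psize[OF that(1)])
      have "1 * psize p \<le> N * psize p" using assms(1) by (intro mult_right_mono) auto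
      also have "N * psize p = n" using that(2) by (metis of_nat_eq_iff of_nat_mult)
      finally show "psize p \<le> i" using assms(2) that(3) by simp
    qed
    then show ?thesis by blast
  qed
  then show ?thesis
    unfolding gf_bounded_partitions[OF assms(1), symmetric] by (simp add: gf_def)
qed

section \<open>The product formula for cyclic sequences\<close>

text \<open>Step \<open>i\<close> leads from diagonal \<open>i - 1\<close> to diagonal
  \<open>i\<close>. For odd \<open>i\<close> it moves holes, hence columns, by at most one, which
  makes the strip horizontal. The label is the position, so exchanging \<open>i\<close> and
  \<open>j\<close> produces the exponent \<open>j - i\<close>.\<close>

definition word_step :: "sign list \<Rightarrow> nat \<Rightarrow> step" where
  "word_step w i = (letter w i = Plus, odd i, int i)"

lemma word_step_simps [simp]: "up (word_step w i) \<longleftrightarrow> letter w i = Plus"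
  "horizontal (word_step w i) \<longleftrightarrow> odd i" "label (word_step w i) = int i"
  by (simp_all add: word_step_def)

definition word_steps :: "nat \<Rightarrow> sign list \<Rightarrow> step list" where
  "word_steps l w = map (word_step w) [1..<Suc (2 * l)]"

lemma length_word_steps [simp]: "length (word_steps l w) = 2 * l"
  by (simp add: word_steps_def)

lemma nth_word_steps: "m < 2 * l \<Longrightarrow> word_steps l w ! m = word_step w (Suc m)"
  by (simp add: word_steps_def del: upt_Suc)

text \<open>Summation by parts: successive labels differ by 1, so each partition is counted once,
  and the first summand of the energy makes up for the jump of the labels at the end of the
  period.\<close>

lemma energy_word_steps:
  "energy (int (2 * l)) (word_steps l w) ps = (\<Sum>m<2 * l. int (psize (ps ! m)))"
proof -
  define n where "n = 2 * l"
  define z where "z m = int (psize (ps ! m))" for m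
  \<comment> \<open>Entry 0 is also the target of the last step, whose label is \<open>n\<close>;
    there it takes the coefficient \<open>n\<close> instead of 0.\<close>
  define f where "f k = (if k = 0 then int n else int k) * z k" for k
  have "(\<Sum>m<n. int (Suc m) * (z (Suc m mod n) - z m)) =
      (\<Sum>m<n. f (Suc m mod n)) - (\<Sum>m<n. int (Suc m) * z m)"
    unfolding sum_subtractf[symmetric]
    by (rule sum.cong) (auto simp: f_def mod_Suc algebra_simps)
  also have "\<dots> = (\<Sum>m<n. f m) - (\<Sum>m<n. int (Suc m) * z m)" by (simp only: sum_mod_Suc)
  also have "\<dots> = (\<Sum>m<n. (if m = 0 then int n * z 0 else 0) - z m)"
    unfolding sum_subtractf[symmetric] by (rule sum.cong) (auto simp: f_def algebra_simps)
  also have "\<dots> = (if n = 0 then 0 else int n * z 0) - (\<Sum>m<n. z m)"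
    by (simp add: sum_subtractf)
  finally have "(\<Sum>m<n. int (Suc m) * (z (Suc m mod n) - z m)) = int n * z 0 - (\<Sum>m<n. z m)"
    by (auto split: if_splits)
  moreover have "energy (int n) (word_steps l w) ps =
      int n * z 0 - (\<Sum>m<n. int (Suc m) * (z (Suc m mod n) - z m))"
    unfolding energy_def length_word_steps n_def[symmetric] z_def
    by (intro arg_cong2[of _ _ _ _ "(-)"] sum.cong) (auto simp: nth_word_steps n_def)
  ultimately show ?thesis unfolding n_def z_def by simp
qed

text \<open>The starting point for gradedness: the energy of the original word bounds the size of
  every partition in the list. All rewritten words inherit it through
  \<open>evolves\<close>.\<close>

lemma graded_word_steps:
  "graded (cyclic_paths (word_steps l w)) (energy (int (2 * l)) (word_steps l w))"
  unfolding graded_def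
proof (intro conjI allI ballI)
  show "0 \<le> energy (int (2 * l)) (word_steps l w) ps" for ps
    unfolding energy_word_steps by (simp add: sum_nonneg)
  fix n
  show "finite {ps \<in> cyclic_paths (word_steps l w). energy (int (2 * l)) (word_steps l w) ps = n}"
  proof (rule finite_subset)
    show "{ps \<in> cyclic_paths (word_steps l w). energy (int (2 * l)) (word_steps l w) ps = n} \<subseteq>
        {ps. set ps \<subseteq> {p. is_partition p \<and> psize p \<le> nat n} \<and> length ps = 2 * l}"
    proof
      fix ps assume "ps \<in> {ps \<in> cyclic_paths (word_steps l w).
        energy (int (2 * l)) (word_steps l w) ps = n}"
      then have ps: "length ps = 2 * l" "\<forall>p\<in>set ps. is_partition p"
        "(\<Sum>m<2 * l. int (psize (ps ! m))) = n"
        unfolding energy_word_steps by (auto simp: cyclic_paths_def)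
      have "int (psize (ps ! m)) \<le> n" if "m < 2 * l" for m
        unfolding ps(3)[symmetric] using that by (intro member_le_sum) auto
      then have "psize p \<le> nat n" if "p \<in> set ps" for p
        using that ps(1) by (fastforce simp: in_set_conv_nth)
      then show "ps \<in> {ps. set ps \<subseteq> {p. is_partition p \<and> psize p \<le> nat n} \<and> length ps = 2 * l}"
        using ps by auto
    qed
    show "finite {ps. set ps \<subseteq> {p. is_partition p \<and> psize p \<le> nat n} \<and> length ps = 2 * l}"
      by (intro finite_lists_length_eq finite_partitions)
  qed
qed

lemma phi_eq_phi_factor: "phi i j x = phi_factor (odd i) (odd j) x"
proof -
  have "odd (int j - int i) \<longleftrightarrow> odd i \<noteq> odd j" by auto
  then show ?thesis unfolding phi_def phi_factor_def by (simp only: if_not_P if_P split: if_split) auto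
qed

lemma phi_factor_nth_0: "d > 0 \<Longrightarrow> fps_nth (phi_factor g h (fps_X ^ d)) 0 = 1"
  by (simp add: phi_factor_def fps_divide_unit)

lemma phi_nonzero: "d > 0 \<Longrightarrow> phi i j (fps_X ^ d) \<noteq> 0"
  using phi_factor_nth_0[of d "odd i" "odd j"] unfolding phi_eq_phi_factor by (metis fps_zero_nth zero_neq_one)

lemma pair_factor_word_step:
  "pair_factor (word_step w i) (word_step w j) = phi i j (fps_X ^ (j - i))"
  by (simp add: pair_factor_def phi_eq_phi_factor nat_minus_as_int)

lemma pair_factor_shift_word_step:
  "i \<le> k * N \<Longrightarrow> pair_factor (shift (int k * int N) (word_step w i)) (word_step w j) =
    phi i j (fps_X ^ (k * N + j - i))"
proof -
  assume "i \<le> k * N"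
  then have "int j - (int i - int k * int N) = int (k * N + j - i)"
    by (simp add: of_nat_diff)
  then have "nat (int j - (int i - int k * int N)) = k * N + j - i"
    by (simp only: nat_int)
  then show ?thesis by (simp add: pair_factor_def phi_eq_phi_factor)
qed

lemma inversion_product_word:
  assumes "sorted_wrt (<) xs"
  shows "inversion_product (map (word_step w) xs) =
    (\<Prod>(i, j)\<in>{(i, j). i \<in> set xs \<and> j \<in> set xs \<and> letter w i = Plus \<and> letter w j = Minus \<and> i < j}.
      phi i j (fps_X ^ (j - i)))"
  using assms
proof (induction xs)
  case (Cons x xs)
  define S where "S xs = {(i, j). i \<in> set xs \<and> j \<in> set xs \<and> letter w i = Plus \<and> letter w j = Minus \<and> i < j}" for xs
  define M where "M = {j \<in> set xs. letter w j = Minus}"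
  have d: "distinct xs" and lt: "\<And>y. y \<in> set xs \<Longrightarrow> x < y"
    using Cons.prems by (auto simp: strict_sorted_iff)
  have fin: "finite (S xs)" by (rule finite_subset[of _ "set xs \<times> set xs"]) (auto simp: S_def)
  have mi: "(\<not> letter w i = Plus) \<longleftrightarrow> letter w i = Minus" for i by (cases "letter w i") auto
  have "(\<Prod>d\<leftarrow>filter (\<lambda>x. \<not> up x) (map (word_step w) xs). pair_factor (word_step w x) d) =
      (\<Prod>j\<leftarrow>filter (\<lambda>j. letter w j = Minus) xs. phi x j (fps_X ^ (j - x)))"
    by (simp add: filter_map comp_def mi pair_factor_word_step)
  also have "\<dots> = (\<Prod>j\<in>M. phi x j (fps_X ^ (j - x)))"
    using d by (subst prod.distinct_set_conv_list[symmetric]) (auto simp: M_def)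
  finally have 1: "(\<Prod>d\<leftarrow>filter (\<lambda>x. \<not> up x) (map (word_step w) xs). pair_factor (word_step w x) d) =
      (\<Prod>j\<in>M. phi x j (fps_X ^ (j - x)))" .
  show ?case
  proof (cases "letter w x = Plus")
    case True
    have "S (x # xs) = Pair x ` M \<union> S xs"
      using lt True by (auto simp: S_def M_def)
    then have "(\<Prod>(i, j)\<in>S (x # xs). phi i j (fps_X ^ (j - i))) =
        (\<Prod>(i, j)\<in>Pair x ` M. phi i j (fps_X ^ (j - i))) * (\<Prod>(i, j)\<in>S xs. phi i j (fps_X ^ (j - i)))"
      using fin lt by (simp only:) (subst prod.union_disjoint, auto simp: M_def S_def)
    also have "(\<Prod>(i, j)\<in>Pair x ` M. phi i j (fps_X ^ (j - i))) = (\<Prod>j\<in>M. phi x j (fps_X ^ (j - x)))"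
      by (subst prod.reindex) (auto simp: inj_on_def)
    finally show ?thesis
      using Cons 1 True by (simp add: S_def)
  next
    case False
    then have "S (x # xs) = S xs" using lt by (auto simp: S_def dest: less_asym)
    then show ?thesis using Cons False by (simp add: S_def)
  qed
qed simp

lemma inversion_product_word_steps: "inversion_product (word_steps l w) = T_gf l w"
proof -
  have "inversion_product (word_steps l w) =
    (\<Prod>(i, j)\<in>{(i, j). i \<in> set [1..<Suc (2 * l)] \<and> j \<in> set [1..<Suc (2 * l)] \<and>
       letter w i = Plus \<and> letter w j = Minus \<and> i < j}. phi i j (fps_X ^ (j - i)))"
    unfolding word_steps_def by (rule inversion_product_word) (rule sorted_wrt_upt)
  also have "\<dots> = T_gf l w"
    unfolding T_gf_def by (rule prod.cong) (auto simp: pm_pairs_def)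
  finally show ?thesis .
qed

lemma finite_pm_pairs [simp]: "finite (pm_pairs l w)"
  by (rule finite_subset[of _ "{1..2 * l} \<times> {1..2 * l}"]) (auto simp: pm_pairs_def)

text \<open>All factors have constant term 1. This allows \<open>T_gf\<close> to be cancelled when
  different numbers of rounds are compared.\<close>

lemma T_gf_nonzero: "T_gf l w \<noteq> 0"
  unfolding T_gf_def
  by (subst prod_zero_iff) (auto intro: finite_subset[OF _ finite_pm_pairs[of l w]] simp: phi_nonzero)

definition round_product :: "nat \<Rightarrow> sign list \<Rightarrow> nat \<Rightarrow> rat fps" where
  "round_product l w k = (\<Prod>(i, j) \<in> pm_pairs l w. phi i j (fps_X ^ (k * (2 * l) + j - i)))"

lemma round_product_nonzero: "k \<ge> 1 \<Longrightarrow> l \<ge> 1 \<Longrightarrow> round_product l w k \<noteq> 0"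
proof -
  assume "k \<ge> 1" "l \<ge> 1"
  then have "1 * (2 * l) \<le> k * (2 * l)" by (intro mult_right_mono) auto
  then have "k * (2 * l) + j - i > 0" if "(i, j) \<in> pm_pairs l w" for i j
  proof -
    have "i \<le> 2 * l" "1 \<le> j" using that by (auto simp: pm_pairs_def)
    then show ?thesis using \<open>1 * (2 * l) \<le> k * (2 * l)\<close> by linarith
  qed
  then show ?thesis
    unfolding round_product_def prod_zero_iff[OF finite_pm_pairs] using phi_nonzero by fastforce
qed

lemma word_steps_filter:
  "filter up (word_steps l w) = map (word_step w) (filter (\<lambda>i. letter w i = Plus) [1..<Suc (2 * l)])"
  "filter (\<lambda>x. \<not> up x) (word_steps l w) =
     map (word_step w) (filter (\<lambda>i. letter w i = Minus) [1..<Suc (2 * l)])"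
proof -
  have "(\<not> letter w i = Plus) \<longleftrightarrow> letter w i = Minus" for i by (cases "letter w i") auto
  then show "filter up (word_steps l w) = map (word_step w) (filter (\<lambda>i. letter w i = Plus) [1..<Suc (2 * l)])"
  "filter (\<lambda>x. \<not> up x) (word_steps l w) =
     map (word_step w) (filter (\<lambda>i. letter w i = Minus) [1..<Suc (2 * l)])"
    by (simp_all add: word_steps_def filter_map comp_def del: upt_Suc)
qed

lemma round_product_eq:
  assumes "k \<ge> 1"
  shows "(\<Prod>u\<leftarrow>filter up (word_steps l w). \<Prod>d\<leftarrow>filter (\<lambda>x. \<not> up x) (word_steps l w).
      pair_factor (shift (int k * int (2 * l)) u) d) = round_product l w k"
proof -
  let ?P = "{i \<in> {1..2 * l}. letter w i = Plus}" and ?M = "{i \<in> {1..2 * l}. letter w i = Minus}"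
  have "(\<Prod>u\<leftarrow>filter up (word_steps l w). \<Prod>d\<leftarrow>filter (\<lambda>x. \<not> up x) (word_steps l w).
      pair_factor (shift (int k * int (2 * l)) u) d) =
    (\<Prod>i\<leftarrow>filter (\<lambda>i. letter w i = Plus) [1..<Suc (2 * l)].
       \<Prod>j\<leftarrow>filter (\<lambda>i. letter w i = Minus) [1..<Suc (2 * l)].
       pair_factor (shift (int k * int (2 * l)) (word_step w i)) (word_step w j))"
    by (simp only: word_steps_filter map_map comp_def)
  also have "\<dots> = (\<Prod>i\<in>?P. \<Prod>j\<in>?M. pair_factor (shift (int k * int (2 * l)) (word_step w i)) (word_step w j))"
    by (subst (1 2) prod.distinct_set_conv_list[symmetric])
       (auto intro!: prod.cong simp del: upt_Suc)
  also have "\<dots> = (\<Prod>(i, j)\<in>?P \<times> ?M. pair_factor (shift (int k * int (2 * l)) (word_step w i)) (word_step w j))"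
    by (rule prod.cartesian_product)
  also have "?P \<times> ?M = pm_pairs l w" by (auto simp: pm_pairs_def)
  also have "(\<Prod>(i, j)\<in>pm_pairs l w. pair_factor (shift (int k * int (2 * l)) (word_step w i)) (word_step w j)) =
      round_product l w k"
    unfolding round_product_def
  proof (rule prod.cong, simp, clarify)
    fix i j assume "(i, j) \<in> pm_pairs l w"
    then have "i \<le> 1 * (2 * l)" by (auto simp: pm_pairs_def)
    also have "\<dots> \<le> k * (2 * l)" using assms by (intro mult_right_mono) auto
    finally show "pair_factor (shift (int k * int (2 * l)) (word_step w i)) (word_step w j) =
      phi i j (fps_X ^ (k * (2 * l) + j - i))" by (rule pair_factor_shift_word_step)
  qed
  finally show ?thesis .
qed

text \<open>For every number \<open>K\<close> of rounds the series is \<open>T_gf\<close> times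
  \<open>\<Gamma> K * R K\<close>. In low degrees \<open>R K\<close> agrees with the partition
  product \<open>E K\<close>, so the partial products \<open>E K * \<Gamma> K\<close> stabilise
  coefficientwise.\<close>

theorem gf_cyclic_paths:
  assumes l: "l \<ge> 1"
  shows "gf (cyclic_paths (word_steps l w)) (energy (int (2 * l)) (word_steps l w)) = T_gf l w *
      (\<Prod>k. let k' = Suc k in 1 / (1 - fps_X ^ (2 * k' * l)) *
         (\<Prod>(i, j) \<in> pm_pairs l w. phi i j (fps_X ^ (2 * k' * l + j - i))))"
    (is "?C = _ * prodinf ?G")
proof -
  define N where "N = 2 * l"
  define W where "W = word_steps l w"
  define Us Ds where "Us = filter up W" and "Ds = filter (\<lambda>x. \<not> up x) W"
  define R where "R K = gf (cyclic_paths (Ds @ map (shift (int K * int N)) Us))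
      (energy (int N) (Ds @ map (shift (int K * int N)) Us))" for K
  define \<Gamma> where "\<Gamma> K = (\<Prod>k<K. round_product l w (Suc k))" for K
  define E where "E K = (\<Prod>k<K. 1 / (1 - fps_X ^ (N * Suc k)) :: rat fps)" for K
  have labels: "1 \<le> label x \<and> label x \<le> int N" if "x \<in> set W" for x
    using that by (auto simp: W_def word_steps_def N_def)
  have "sorted_wrt (\<lambda>x y. up x \<and> \<not> up y \<longrightarrow> label x < label y) W"
    unfolding W_def word_steps_def sorted_wrt_map
    by (rule sorted_wrt_mono_rel[OF _ sorted_wrt_upt]) simp
  from evolves_sort[OF this, of "int N" "[]" "[]"]
  have sort: "evolves (int N) W (T_gf l w) (Ds @ Us)"
    by (simp add: W_def inversion_product_word_steps Us_def Ds_def)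
  have "evolves (int N) (Ds @ Us)
      (\<Prod>k<K. \<Prod>u\<leftarrow>Us. \<Prod>d\<leftarrow>Ds. pair_factor (shift (int (Suc k) * int N) u) d)
      (Ds @ map (shift (int K * int N)) Us)" for K
  proof (rule evolves_rounds)
    fix u d assume "u \<in> set Us" "d \<in> set Ds"
    then show "label u - int N < label d"
      using labels[of u] labels[of d] by (simp add: Us_def Ds_def)
  qed (auto simp: Us_def Ds_def)
  also have "(\<Prod>k<K. \<Prod>u\<leftarrow>Us. \<Prod>d\<leftarrow>Ds. pair_factor (shift (int (Suc k) * int N) u) d) = \<Gamma> K" for K
    unfolding \<Gamma>_def Us_def Ds_def W_def N_def by (intro prod.cong refl round_product_eq) simp
  finally have rounds: "evolves (int N) (Ds @ Us) (\<Gamma> K) (Ds @ map (shift (int K * int N)) Us)" for K .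
  have C: "?C = T_gf l w * (\<Gamma> K * R K)" for K
    using evolves_trans[OF sort rounds] graded_word_steps
    by (simp add: evolves_def R_def N_def W_def mult.assoc)
  have len: "length Ds + length Us = N"
    using sum_length_filter_compl[of up W] by (simp add: Us_def Ds_def W_def N_def)
  have R: "fps_nth (R (Suc K)) n = fps_nth (E K') n" if "n < K * N" "n \<le> K'" for K K' n
  proof -
    have "fps_nth (R (Suc K)) n = fps_nth (gf {p. is_partition p} (\<lambda>p. int N * int (psize p))) n"
      unfolding R_def
      by (rule gf_stable_paths) (use labels len that in \<open>force simp: Us_def Ds_def\<close>)+
    also have "\<dots> = fps_nth (E K') n"
      unfolding E_def by (rule fps_nth_gf_partitions) (use l that in \<open>auto simp: N_def\<close>)
    finally show ?thesis .
  qed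
  \<comment> \<open>The value is the same for every number of rounds. The number 2 is the least for
    which the fact \<open>R\<close> above determines the constant coefficient of the
    remainder.\<close>
  define X where "X = \<Gamma> 2 * R 2"
  have X: "X = \<Gamma> K * R K" for K
    using C[of 2] C[of K] T_gf_nonzero[of l w] by (simp add: X_def)
  have "fps_nth (R 2) 0 = fps_nth (E 0) 0"
    using R[of 0 1 0] l by (simp add: N_def numeral_2_eq_2)
  then have "R 2 \<noteq> 0" by (auto simp: E_def)
  moreover have "\<Gamma> 2 \<noteq> 0"
    unfolding \<Gamma>_def by (subst prod_zero_iff) (use l in \<open>auto simp: round_product_nonzero\<close>)
  \<comment> \<open>The notion \<open>has_prod\<close> requires a nonzero limit.\<close>
  ultimately have "X \<noteq> 0" by (simp add: X_def)
  have G: "?G k = 1 / (1 - fps_X ^ (N * Suc k)) * round_product l w (Suc k)" for k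
    by (simp add: round_product_def N_def Let_def mult.commute mult.left_commute)
  have prodG: "(\<Prod>k<K. ?G k) = E K * \<Gamma> K" for K
    unfolding G E_def \<Gamma>_def by (rule prod.distrib)
  have "(\<lambda>n. \<Prod>k\<le>n. ?G k) \<longlonglongrightarrow> X"
  proof (rule tendsto_fpsI)
    fix n
    show "eventually (\<lambda>m. fps_nth (\<Prod>k\<le>m. ?G k) n = fps_nth X n) sequentially"
      using eventually_ge_at_top[of "Suc n"]
    proof eventually_elim
      case (elim m)
      have "fps_nth (E (Suc m)) i = fps_nth (R (Suc m)) i" if "i \<le> n" for i
      proof (rule R[symmetric])
        have "i < m * 1" using elim that by simp
        also have "\<dots> \<le> m * N" using l by (intro mult_left_mono) (auto simp: N_def)
        finally show "i < m * N" .
      qed (use elim that in simp)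
      then have "fps_nth (E (Suc m) * \<Gamma> (Suc m)) n = fps_nth (R (Suc m) * \<Gamma> (Suc m)) n"
        unfolding fps_mult_nth by (intro sum.cong) auto
      then show ?case
        unfolding lessThan_Suc_atMost[symmetric] prodG X[of "Suc m"] by (simp add: mult.commute)
    qed
  qed
  then have "?G has_prod X"
    using \<open>X \<noteq> 0\<close> by (simp add: has_prod_def raw_has_prod_def)
  then have "prodinf ?G = X" by (rule has_prod_unique[symmetric])
  then show ?thesis using C[of 2] by (simp add: X_def)
qed

section \<open>Tilings as matchings of cells\<close>

fun cells :: "domino \<Rightarrow> (int \<times> int) set" where
  "cells (Hor x y) = {(x, y - 1), (x + 1, y - 1)}"
| "cells (Ver x y) = {(x, y - 1), (x, y - 2)}"

text \<open>A cell is named by the bottom left corner of its unit square. Its centre lies on no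
  domino boundary, so closed rectangles and their interiors contain the same centres.\<close>

lemma centre_in_rect:
  "(of_int a + 1 / 2, of_int b + 1 / 2) \<in> rect d \<longleftrightarrow> (a, b) \<in> cells d"
  "(of_int a + 1 / 2, of_int b + 1 / 2) \<in> interior (rect d) \<longleftrightarrow> (a, b) \<in> cells d"
proof -
  have le: "real_of_int u \<le> of_int v + 1 / 2 \<longleftrightarrow> u \<le> v" "real_of_int u + 1 / 2 \<le> of_int v \<longleftrightarrow> u < v"
    "real_of_int u < of_int v + 1 / 2 \<longleftrightarrow> u \<le> v" "real_of_int u + 1 / 2 < of_int v \<longleftrightarrow> u < v" for u v
    by linarith+
  have shift: "real_of_int x + 2 = of_int (x + 2)" "real_of_int x - 2 = of_int (x - 2)"
    "real_of_int x + 1 = of_int (x + 1)" "real_of_int x - 1 = of_int (x - 1)" for x by simp_all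
  show "(of_int a + 1 / 2, of_int b + 1 / 2) \<in> rect d \<longleftrightarrow> (a, b) \<in> cells d"
    by (cases d) (simp_all only: rect.simps shift mem_Times_iff fst_conv snd_conv atLeastAtMost_iff le cells.simps, auto)
  show "(of_int a + 1 / 2, of_int b + 1 / 2) \<in> interior (rect d) \<longleftrightarrow> (a, b) \<in> cells d"
    by (cases d) (simp_all only: interior_rect shift mem_Times_iff fst_conv snd_conv greaterThanLessThan_iff le cells.simps, auto)
qed

lemma unit_square_subset_rect: "unit_square a b \<subseteq> rect d \<longleftrightarrow> (a, b) \<in> cells d"
proof
  assume "unit_square a b \<subseteq> rect d"
  moreover have "(of_int a + 1 / 2, of_int b + 1 / 2) \<in> unit_square a b"
    by (simp add: unit_square_def)
  ultimately show "(a, b) \<in> cells d" using centre_in_rect by blast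
next
  assume "(a, b) \<in> cells d"
  then show "unit_square a b \<subseteq> rect d"
    by (cases d) (auto simp: unit_square_def)
qed

lemma floor_cell_interior: "(x, y) \<in> interior (rect d) \<Longrightarrow> (\<lfloor>x\<rfloor>, \<lfloor>y\<rfloor>) \<in> cells d"
  by (cases d) (simp_all only: interior_rect mem_Times_iff fst_conv snd_conv greaterThanLessThan_iff cells.simps,
    auto, linarith+)

text \<open>Reduces the topological notion to a combinatorial one: covering is tested at centres of
  cells, and a common interior point of two dominos yields, by rounding down, a common cell.\<close>

lemma plane_tiling_iff: "plane_tiling T \<longleftrightarrow> (\<forall>c. \<exists>!d. d \<in> T \<and> c \<in> cells d)"
proof
  assume T: "plane_tiling T"
  show "\<forall>c. \<exists>!d. d \<in> T \<and> c \<in> cells d"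
  proof (clarify)
    fix a b
    obtain d where d: "d \<in> T" "(real_of_int a + 1 / 2, real_of_int b + 1 / 2) \<in> rect d"
      using T unfolding plane_tiling_def by blast
    show "\<exists>!d. d \<in> T \<and> (a, b) \<in> cells d"
    proof (rule ex1I[of _ d])
      show "e = d" if "e \<in> T \<and> (a, b) \<in> cells e" for e
        using T d that centre_in_rect covering_domino_unique unfolding plane_tiling_def by metis
    qed (use d centre_in_rect in blast)
  qed
next
  assume *: "\<forall>c. \<exists>!d. d \<in> T \<and> c \<in> cells d"
  have "nonoverlapping T"
    unfolding nonoverlapping_def pairwise_def
  proof (intro ballI impI equals0I)
    fix d e p assume "d \<in> T" "e \<in> T" "d \<noteq> e" "p \<in> interior (rect d) \<inter> interior (rect e)"
    then show False
      using * floor_cell_interior[of "fst p" "snd p"] by (metis IntD1 IntD2 prod.collapse)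
  qed
  moreover have "p \<in> (\<Union>d\<in>T. rect d)" for p
  proof -
    obtain x y where p: "p = (x, y)" by (cases p)
    obtain d where d: "d \<in> T" "(\<lfloor>x\<rfloor>, \<lfloor>y\<rfloor>) \<in> cells d" using * by blast
    have "p \<in> unit_square \<lfloor>x\<rfloor> \<lfloor>y\<rfloor>" by (simp add: p unit_square_def)
    then show ?thesis using d unit_square_subset_rect by blast
  qed
  ultimately show "plane_tiling T" unfolding plane_tiling_def by auto
qed


text \<open>
  The domino joining the cell of diagonal \<open>x - y = m\<close> with abscissa \<open>a\<close> to that of diagonal
  \<open>m + 1\<close> with abscissa \<open>a\<close> or \<open>a + 1\<close>.
\<close>

definition domino_at :: "int \<Rightarrow> int \<Rightarrow> bool \<Rightarrow> domino" where
  "domino_at m a s = (if s then Hor else Ver) a (a - m + 1)"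

lemma dom_inject [simp]: "domino_at m a s = domino_at m' a' s' \<longleftrightarrow> m = m' \<and> a = a' \<and> s = s'"
  by (auto simp: domino_at_def)

lemma dom_exhaust: obtains m a s where "d = domino_at m a s"
proof (cases d)
  case (Hor x y)
  then show ?thesis using that[of "x - y + 1" x True] by (simp add: domino_at_def)
next
  case (Ver x y)
  then show ?thesis using that[of "x - y + 1" x False] by (simp add: domino_at_def)
qed

lemma cells_dom: "(a, a - m) \<in> cells (domino_at m' a' s) \<longleftrightarrow>
    m' = m \<and> a' = a \<or> m' = m - 1 \<and> a' + of_bool s = a"
  by (auto simp: domino_at_def)

lemma dom_direction [simp]:
  "north (domino_at m a s) \<longleftrightarrow> s \<and> even m" "east (domino_at m a s) \<longleftrightarrow> \<not> s \<and> even m"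
  "south (domino_at m a s) \<longleftrightarrow> s \<and> odd m" "west (domino_at m a s) \<longleftrightarrow> \<not> s \<and> odd m"
  by (auto simp: domino_at_def)

lemma translate_dom [simp]: "translate t u (domino_at m a s) = domino_at (m + t - u) (a + t) s"
  by (auto simp: domino_at_def)

lemma pair_dom:
  "hor_pair x y = {domino_at (x - y + 1) x True, domino_at (x - y + 2) x True}"
  "ver_pair x y = {domino_at (x - y + 1) x False, domino_at (x - y + 2) (x + 1) False}"
  by (auto simp: hor_pair_def ver_pair_def domino_at_def)

lemma rect_dom_strip: "rect (domino_at m a s) \<subseteq> oblique_strip l (real l + 1) \<longleftrightarrow> 0 \<le> m \<and> m < 2 * int l"
proof
  assume *: "rect (domino_at m a s) \<subseteq> oblique_strip l (real l + 1)"
  \<comment> \<open>The top left and the bottom right corner, where \<open>x - y\<close> is extremal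
    on the domino.\<close>
  have "(of_int a, of_int (a - m + 1)) \<in> rect (domino_at m a s)"
    "(of_int a + 1 + of_bool s, of_int (a - m - 1) + of_bool s) \<in> rect (domino_at m a s)"
    by (auto simp: domino_at_def)
  then have "(of_int a, of_int (a - m + 1)) \<in> oblique_strip l (real l + 1)"
    "(of_int a + 1 + of_bool s, of_int (a - m - 1) + of_bool s) \<in> oblique_strip l (real l + 1)"
    using * by blast+
  then have "real_of_int m - 1 - real l \<ge> - (real l + 1)" "real_of_int m + 2 - real l \<le> real l + 1"
    by (auto simp: oblique_strip_def abs_le_iff)
  then show "0 \<le> m \<and> m < 2 * int l" by linarith
next
  assume "0 \<le> m \<and> m < 2 * int l"
  then have "real_of_int m \<ge> 0" "real_of_int m \<le> 2 * real l - 1" by linarith+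
  then show "rect (domino_at m a s) \<subseteq> oblique_strip l (real l + 1)"
    by (auto simp: domino_at_def oblique_strip_def abs_le_iff)
qed

lemma dom_in_fundamental_domain:
  "domino_at m a s \<in> fundamental_domain l T \<longleftrightarrow> domino_at m a s \<in> T \<and> 0 \<le> m \<and> m < 2 * int l"
  by (simp add: fundamental_domain_def rect_dom_strip)

lemma rect_dom_corners:
  "rect (domino_at m a s) \<subseteq> {(x, y). x + y > B} \<Longrightarrow> 2 * of_int a - of_int m > B"
  "rect (domino_at m a s) \<subseteq> {(x, y). x + y < - B} \<Longrightarrow> 2 * of_int a - of_int m + 2 < - B"
  "2 * of_int a - of_int m - 1 > B \<Longrightarrow> rect (domino_at m a s) \<subseteq> {(x, y). x + y > B}"
  "2 * of_int a - of_int m + 3 < - B \<Longrightarrow> rect (domino_at m a s) \<subseteq> {(x, y). x + y < - B}"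
proof -
  have corners: "(of_int a, of_int a - of_int m) \<in> rect (domino_at m a s)"
    "(of_int a + 1, of_int a - of_int m + 1) \<in> rect (domino_at m a s)"
    by (auto simp: domino_at_def)
  show "rect (domino_at m a s) \<subseteq> {(x, y). x + y > B} \<Longrightarrow> 2 * of_int a - of_int m > B"
    using corners(1) by force
  show "rect (domino_at m a s) \<subseteq> {(x, y). x + y < - B} \<Longrightarrow> 2 * of_int a - of_int m + 2 < - B"
    using corners(2) by force
qed (auto simp: domino_at_def)

text \<open>In the strip \<open>m\<close> is bounded, so bounds on \<open>x + y\<close> and on the
  abscissa \<open>a\<close> amount to the same, and the parity of \<open>m\<close> separates the two
  groups of directions.\<close>

lemma steep_iff: "steep l T \<longleftrightarrow> (\<exists>b. \<forall>m a s. 0 \<le> m \<and> m < 2 * int l \<and> domino_at m a s \<in> T \<longrightarrow>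
    (a \<ge> b \<longrightarrow> even m) \<and> (a \<le> - b \<longrightarrow> odd m))"
proof
  assume "steep l T"
  then obtain B where B: "\<And>d. d \<in> fundamental_domain l T \<Longrightarrow>
     (rect d \<subseteq> {(x, y). x + y > B} \<longrightarrow> north d \<or> east d) \<and>
     (rect d \<subseteq> {(x, y). x + y < - B} \<longrightarrow> south d \<or> west d)"
    by (auto simp: steep_def)
  define b where "b = \<lceil>\<bar>B\<bar>\<rceil> + 2 * int l + 5"
  have b: "real_of_int b \<ge> \<bar>B\<bar> + 2 * real l + 5" unfolding b_def by linarith
  show "\<exists>b. \<forall>m a s. 0 \<le> m \<and> m < 2 * int l \<and> domino_at m a s \<in> T \<longrightarrow>
    (a \<ge> b \<longrightarrow> even m) \<and> (a \<le> - b \<longrightarrow> odd m)"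
  proof (intro exI[of _ b] allI impI conjI; elim conjE)
    fix m a s assume m: "0 \<le> m" "m < 2 * int l" "domino_at m a s \<in> T"
    then have fd: "domino_at m a s \<in> fundamental_domain l T" by (simp add: dom_in_fundamental_domain)
    have m': "real_of_int m \<ge> 0" "real_of_int m \<le> 2 * real l" using m by linarith+
    show "even m" if "b \<le> a"
    proof -
      have "real_of_int a \<ge> of_int b" using that by simp
      then have "2 * of_int a - of_int m - 1 > B" using b m' by linarith
      then show ?thesis using B[OF fd] rect_dom_corners(3) by fastforce
    qed
    show "odd m" if "a \<le> - b"
    proof -
      have "real_of_int a \<le> - of_int b" using that by linarith
      then have "2 * of_int a - of_int m + 3 < - B" using b m' by linarith
      then show ?thesis using B[OF fd] rect_dom_corners(4) by fastforce
    qed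
  qed
next
  assume "\<exists>b. \<forall>m a s. 0 \<le> m \<and> m < 2 * int l \<and> domino_at m a s \<in> T \<longrightarrow>
    (a \<ge> b \<longrightarrow> even m) \<and> (a \<le> - b \<longrightarrow> odd m)"
  then obtain b where b: "\<And>m a s. 0 \<le> m \<Longrightarrow> m < 2 * int l \<Longrightarrow> domino_at m a s \<in> T \<Longrightarrow>
    (a \<ge> b \<longrightarrow> even m) \<and> (a \<le> - b \<longrightarrow> odd m)" by blast
  define B :: real where "B = 2 * \<bar>of_int b\<bar> + 2 * real l + 5"
  show "steep l T"
    unfolding steep_def
  proof (intro exI[of _ B] ballI)
    fix d assume d: "d \<in> fundamental_domain l T"
    obtain m a s where domino_at: "d = domino_at m a s" by (rule dom_exhaust)
    have m: "0 \<le> m" "m < 2 * int l" "domino_at m a s \<in> T"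
      using d by (auto simp: domino_at dom_in_fundamental_domain)
    have "a \<ge> b" if "2 * of_int a - of_int m > B" using that m unfolding B_def by linarith
    moreover have "a \<le> - b" if "2 * of_int a - of_int m + 2 < - B" using that m unfolding B_def by linarith
    ultimately show "(rect d \<subseteq> {(x, y). x + y > B} \<longrightarrow> north d \<or> east d) \<and>
       (rect d \<subseteq> {(x, y). x + y < - B} \<longrightarrow> south d \<or> west d)"
      using b[OF m] rect_dom_corners(1,2)[of m a s B] unfolding domino_at dom_direction by blast
  qed
qed

lemma invariant_iff: "invariant l c T \<longleftrightarrow>
    (\<forall>m a s. domino_at (m + 2 * int l) (a + c) s \<in> T \<longleftrightarrow> domino_at m a s \<in> T)"
proof
  assume inv: "invariant l c T"
  show "\<forall>m a s. domino_at (m + 2 * int l) (a + c) s \<in> T \<longleftrightarrow> domino_at m a s \<in> T"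
  proof (intro allI iffI)
    fix m a s assume "domino_at m a s \<in> T"
    then have "translate c (c - 2 * int l) (domino_at m a s) \<in> T"
      using inv unfolding invariant_def by blast
    then show "domino_at (m + 2 * int l) (a + c) s \<in> T" by (simp add: algebra_simps)
  next
    fix m a s assume "domino_at (m + 2 * int l) (a + c) s \<in> T"
    then obtain d where d: "d \<in> T" "translate c (c - 2 * int l) d = domino_at (m + 2 * int l) (a + c) s"
      using inv unfolding invariant_def by (metis imageE)
    then show "domino_at m a s \<in> T" by (cases d rule: dom_exhaust) (auto simp: algebra_simps)
  qed
next
  assume *: "\<forall>m a s. domino_at (m + 2 * int l) (a + c) s \<in> T \<longleftrightarrow> domino_at m a s \<in> T"
  show "invariant l c T"
    unfolding invariant_def
  proof (intro equalityI subsetI)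
    fix d assume "d \<in> translate c (c - 2 * int l) ` T"
    then obtain e where e: "e \<in> T" "d = translate c (c - 2 * int l) e" by blast
    then show "d \<in> T" using * by (cases e rule: dom_exhaust) (auto simp: algebra_simps)
  next
    fix d assume d: "d \<in> T"
    obtain m a s where domino_at: "d = domino_at m a s" by (rule dom_exhaust)
    have "domino_at (m - 2 * int l) (a - c) s \<in> T" using *[rule_format, of "m - 2 * int l" "a - c" s] d domino_at by simp
    then show "d \<in> translate c (c - 2 * int l) ` T"
      by (rule rev_image_eqI) (simp add: domino_at)
  qed
qed

lemma invariant_multiple:
  assumes "invariant l c T"
  shows "domino_at (m + q * (2 * int l)) (a + q * c) s \<in> T \<longleftrightarrow> domino_at m a s \<in> T"
proof (induction q arbitrary: m a rule: int_induct[of _ 0])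
  case (step1 q)
  have "domino_at (m + (q + 1) * (2 * int l)) (a + (q + 1) * c) s =
      domino_at ((m + q * (2 * int l)) + 2 * int l) ((a + q * c) + c) s"
    by (simp add: algebra_simps)
  then show ?case using step1 assms[unfolded invariant_iff] by metis
next
  case (step2 q)
  have "domino_at ((m + (q - 1) * (2 * int l)) + 2 * int l) ((a + (q - 1) * c) + c) s =
      domino_at (m + q * (2 * int l)) (a + q * c) s"
    by (simp add: algebra_simps)
  then show ?case using step2 assms[unfolded invariant_iff] by metis
qed simp


section \<open>Particle configurations of a tiling\<close>

definition particles :: "domino set \<Rightarrow> int \<Rightarrow> int set" where
  "particles T m = {a. \<exists>d\<in>T. (south d \<or> west d) \<and> (a, a - m) \<in> cells d}"

lemma plane_tiling_covering:
  assumes "plane_tiling T"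
  shows "\<exists>!d. d \<in> T \<and> (a, a - m) \<in> cells d"
  using assms plane_tiling_iff by blast

lemma plane_tiling_dom_iff:
  "plane_tiling T \<longleftrightarrow> (\<forall>m a. \<exists>!d. d \<in> T \<and> (a, a - m) \<in> cells d)"
  unfolding plane_tiling_iff
proof
  assume *: "\<forall>m a. \<exists>!d. d \<in> T \<and> (a, a - m) \<in> cells d"
  show "\<forall>c. \<exists>!d. d \<in> T \<and> c \<in> cells d"
  proof
    fix c :: "int \<times> int"
    show "\<exists>!d. d \<in> T \<and> c \<in> cells d" using *[rule_format, of "fst c" "fst c - snd c"] by simp
  qed
qed blast

lemma particles_iff:
  assumes T: "plane_tiling T" and d: "domino_at m' a' s \<in> T" "(a, a - m) \<in> cells (domino_at m' a' s)"
  shows "a \<in> particles T m \<longleftrightarrow> odd m'"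
proof
  assume "a \<in> particles T m"
  then obtain e where e: "e \<in> T" "south e \<or> west e" "(a, a - m) \<in> cells e"
    by (auto simp: particles_def)
  then have "e = domino_at m' a' s" using plane_tiling_covering[OF T, of a m] d by blast
  then show "odd m'" using e(2) by auto
next
  assume "odd m'"
  then have "south (domino_at m' a' s) \<or> west (domino_at m' a' s)" by auto
  then show "a \<in> particles T m" using d unfolding particles_def by blast
qed

text \<open>The convention for uncovered sites restores what the cut hides: an uncovered cell on
  \<open>y = x\<close> belongs to a domino with \<open>m' = - 1\<close>, which is odd, and one on
  \<open>y = x - 2l\<close> to a domino with \<open>m' = 2 * l\<close>, which is even.\<close>

lemma occupied_iff:
  assumes T: "plane_tiling T" and m: "m \<le> 2 * l" and l: "l \<ge> 1"
  shows "occupied (fundamental_domain l T) (of_int a + 1 / 2, of_int a + 1 / 2 - real m) \<longleftrightarrow>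
    a \<in> particles T (int m)"
proof -
  have p: "(real_of_int a + 1 / 2, of_int a + 1 / 2 - real m) =
      (of_int a + 1 / 2, of_int (a - int m) + 1 / 2)" by simp
  obtain d where d: "d \<in> T" "(a, a - int m) \<in> cells d"
    and uniq: "\<And>e. e \<in> T \<Longrightarrow> (a, a - int m) \<in> cells e \<Longrightarrow> e = d"
    using plane_tiling_covering[OF T, of a "int m"] by blast
  obtain m' a' s where domino_at: "d = domino_at m' a' s" by (rule dom_exhaust)
  have cov: "covered_by (fundamental_domain l T) P (of_int a + 1 / 2, of_int a + 1 / 2 - real m) \<longleftrightarrow>
      P d \<and> d \<in> fundamental_domain l T" for P
  proof -
    have "e \<in> T" if "e \<in> fundamental_domain l T" for e
      using that by (simp add: fundamental_domain_def)
    then show ?thesis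
      unfolding covered_by_def p centre_in_rect(1) using d uniq by blast
  qed
  have m': "m' = int m \<or> m' = int m - 1" using d(2) by (auto simp: domino_at cells_dom)
  have fd: "d \<in> fundamental_domain l T \<longleftrightarrow> 0 \<le> m' \<and> m' < 2 * int l"
    using d(1) by (simp add: domino_at dom_in_fundamental_domain)
  have "a \<in> particles T (int m) \<longleftrightarrow> odd m'" using particles_iff[OF T] d by (simp add: domino_at)
  moreover have "occupied (fundamental_domain l T) (of_int a + 1 / 2, of_int a + 1 / 2 - real m) \<longleftrightarrow>
      odd m' \<and> 0 \<le> m' \<and> m' < 2 * int l \<or> \<not> (0 \<le> m' \<and> m' < 2 * int l) \<and> m = 0"
    unfolding occupied_def cov fd by (auto simp: domino_at)
  moreover have "m' < 2 * int l" if "odd m'"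
  proof -
    have "m' \<noteq> 2 * int l" using that by auto
    then show ?thesis using m' m by auto
  qed
  ultimately show ?thesis using m' l by (cases "m = 0") auto
qed

section \<open>Particles and holes\<close>

text \<open>The Maya diagram of charge \<open>c\<close>, with sites given by cell abscissae, that
  is, lowered by one half. Particles are listed from the right and, in \<open>hole_pos\<close>,
  holes from the left; for the empty partition the particles are the integers below
  \<open>c\<close>.\<close>

definition particle_pos :: "int \<Rightarrow> (nat \<Rightarrow> nat) \<Rightarrow> nat \<Rightarrow> int" where
  "particle_pos c p i = c - int i - 1 + int (p i)"

definition hole_pos :: "int \<Rightarrow> (nat \<Rightarrow> nat) \<Rightarrow> nat \<Rightarrow> int" where
  "hole_pos c p j = c + int j - int (conj_part p j)"

lemma particle_pos_less: "is_partition p \<Longrightarrow> i < j \<Longrightarrow> particle_pos c p j < particle_pos c p i"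
  using partition_decseq[of p i j] by (simp add: particle_pos_def)

lemma hole_pos_less: "is_partition p \<Longrightarrow> i < j \<Longrightarrow> hole_pos c p i < hole_pos c p j"
  using partition_decseq[OF partition_conj, of p i j] by (simp add: hole_pos_def)

lemma particle_pos_eq_iff: "is_partition p \<Longrightarrow> particle_pos c p i = particle_pos c p j \<longleftrightarrow> i = j"
  using particle_pos_less[of p] by (metis less_irrefl linorder_neqE_nat)

lemma hole_pos_eq_iff: "is_partition p \<Longrightarrow> hole_pos c p i = hole_pos c p j \<longleftrightarrow> i = j"
  using hole_pos_less[of p] by (metis less_irrefl linorder_neqE_nat)

lemma particle_pos_eventually: "is_partition p \<Longrightarrow> \<exists>n. \<forall>i\<ge>n. particle_pos c p i = c - int i - 1"
  unfolding is_partition_def particle_pos_def by force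

lemma hole_pos_eventually: "is_partition p \<Longrightarrow> \<exists>n. \<forall>i\<ge>n. hole_pos c p i = c + int i"
  using partition_conj[of p] unfolding is_partition_def hole_pos_def by force

text \<open>A particle \<open>i\<close> and a hole \<open>j\<close> never coincide, as either both
  \<open>j < p i\<close> and \<open>i < conj_part p j\<close> hold or neither does. Conversely, for
  a site \<open>x\<close> without particle let \<open>i\<close> be the number of particles to its
  right; then \<open>x\<close> is the hole of index \<open>x - c + i\<close>.\<close>

lemma range_hole_pos:
  assumes p: "is_partition p"
  shows "range (hole_pos c p) = - range (particle_pos c p)"
proof -
  have "particle_pos c p i \<noteq> hole_pos c p j" for i j
    using less_conj_part_iff[OF p, of i j]
    by (cases "j < p i") (auto simp: particle_pos_def hole_pos_def)
  moreover have "x \<in> range (hole_pos c p)" if x: "x \<notin> range (particle_pos c p)" for x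
  proof -
    obtain n where n: "\<forall>i\<ge>n. particle_pos c p i = c - int i - 1"
      using particle_pos_eventually[OF p] by blast
    have "particle_pos c p (max n (nat (c - x))) < x" using n by auto
    then have ex: "\<exists>i. particle_pos c p i < x" by blast
    define i where "i = (LEAST i. particle_pos c p i < x)"
    have i: "particle_pos c p i < x" unfolding i_def using ex by (rule LeastI_ex)
    define j where "j = nat (x - c + int i)"
    have j: "int j = x - c + int i" "p i \<le> j"
      using i by (auto simp: particle_pos_def j_def)
    have "conj_part p j = i"
    proof (rule antisym)
      show "conj_part p j \<le> i" using j(2) less_conj_part_iff[OF p, of i j] by auto
      show "i \<le> conj_part p j"
      proof (cases i)
        case (Suc i')
        have "\<not> particle_pos c p i' < x"
          unfolding Suc[symmetric] using not_less_Least[of i' "\<lambda>i. particle_pos c p i < x"] Suc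
          by (simp add: i_def)
        moreover have "particle_pos c p i' \<noteq> x" using x by auto
        ultimately have "j < p i'" using j(1) Suc by (auto simp: particle_pos_def)
        then show ?thesis using less_conj_part_iff[OF p, of i' j] Suc by auto
      qed simp
    qed
    then have "hole_pos c p j = x" using j(1) by (simp add: hole_pos_def)
    then show ?thesis by blast
  qed
  ultimately show ?thesis by blast
qed

lemma strict_mono_range_unique:
  fixes f g :: "nat \<Rightarrow> int"
  assumes "\<And>i j. i < j \<Longrightarrow> f i < f j" "\<And>i j. i < j \<Longrightarrow> g i < g j" "range f = range g"
  shows "f = g"
proof
  fix n
  show "f n = g n"
  proof (induction n rule: less_induct)
    case (less n)
    have *: "g' n \<le> f' n" if f': "\<And>i j. i < j \<Longrightarrow> f' i < f' j" and g': "\<And>i j. i < j \<Longrightarrow> g' i < g' j"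
      and r: "range f' = range g'" and IH: "\<And>m. m < n \<Longrightarrow> f' m = g' m" for f' g' :: "nat \<Rightarrow> int"
    proof -
      obtain j where j: "f' n = g' j" using r by (metis rangeE rangeI)
      have "\<not> j < n" using IH[of j] f'[of j n] j by auto
      then show ?thesis using g'[of n j] j by (cases "j = n") auto
    qed
    show ?case
      using *[of f g] *[of g f] assms less by (metis antisym)
  qed
qed

lemma strict_antimono_range_unique:
  fixes f g :: "nat \<Rightarrow> int"
  assumes "\<And>i j. i < j \<Longrightarrow> f j < f i" "\<And>i j. i < j \<Longrightarrow> g j < g i" "range f = range g"
  shows "f = g"
proof -
  have "(\<lambda>i. - f i) = (\<lambda>i. - g i)"
  proof (rule strict_mono_range_unique)
    have "range (\<lambda>i. - f i) = uminus ` range f" "range (\<lambda>i. - g i) = uminus ` range g" by auto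
    then show "range (\<lambda>i. - f i) = range (\<lambda>i. - g i)" using assms(3) by simp
  qed (use assms in auto)
  then show ?thesis by (simp add: fun_eq_iff)
qed

text \<open>The enumerations coincide, and far out they are \<open>c - i - 1\<close> and
  \<open>d - i - 1\<close>; this gives the charge first and then the parts.\<close>

lemma particle_range_inject:
  assumes p: "is_partition p" and q: "is_partition q"
    and "range (particle_pos c p) = range (particle_pos d q)"
  shows "c = d" "p = q"
proof -
  have eq: "particle_pos c p = particle_pos d q"
    by (rule strict_antimono_range_unique) (use assms particle_pos_less in auto)
  obtain n k where "\<forall>i\<ge>n. particle_pos c p i = c - int i - 1" "\<forall>i\<ge>k. particle_pos d q i = d - int i - 1"
    using particle_pos_eventually p q by meson
  then have "c - int (max n k) - 1 = d - int (max n k) - 1" using eq by (metis max.cobounded1 max.cobounded2)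
  then show "c = d" by simp
  then show "p = q" using eq by (auto simp: particle_pos_def fun_eq_iff)
qed

text \<open>Induction on the width of the undetermined window. A particle at its right end
  \<open>b - 1\<close> becomes the largest part, put in front of the partition of the other
  particles, and raises the charge by one.\<close>

lemma ex_partition_of_particles:
  assumes "{..<a} \<subseteq> S" "S \<subseteq> {..<b}"
  shows "\<exists>c p. is_partition p \<and> S = range (particle_pos c p)"
  using assms
proof (induction "nat (b - a)" arbitrary: b S)
  case 0
  then have "S = {..<a}" by auto
  also have "\<dots> = range (particle_pos a (\<lambda>_. 0))"
  proof (intro equalityI subsetI)
    fix x assume "x \<in> {..<a}"
    then have "x = particle_pos a (\<lambda>_. 0) (nat (a - x - 1))" by (simp add: particle_pos_def)
    then show "x \<in> range (particle_pos a (\<lambda>_. 0))" by blast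
  qed (auto simp: particle_pos_def)
  finally show ?case using partition_zero by blast
next
  case (Suc n)
  show ?case
  proof (cases "b - 1 \<in> S")
    case True
    have "\<exists>c p. is_partition p \<and> S - {b - 1} = range (particle_pos c p)"
    proof (rule Suc.hyps(1)[of "b - 1"])
      show "S - {b - 1} \<subseteq> {..<b - 1}"
      proof
        fix x assume "x \<in> S - {b - 1}"
        then have "x < b" "x \<noteq> b - 1" using Suc.prems by auto
        then show "x \<in> {..<b - 1}" by simp
      qed
    qed (use Suc in auto)
    then obtain c p where p: "is_partition p" "S - {b - 1} = range (particle_pos c p)" by blast
    define q where "q = (\<lambda>i. case i of 0 \<Rightarrow> nat (b - 1 - c) | Suc i \<Rightarrow> p i)"
    have "particle_pos c p 0 \<in> S - {b - 1}" using p by blast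
    then have "particle_pos c p 0 < b" "particle_pos c p 0 \<noteq> b - 1" using Suc.prems by auto
    then have b: "int (p 0) \<le> b - 1 - c" by (simp add: particle_pos_def)
    have pos0: "particle_pos (c + 1) q 0 = b - 1" using b by (simp add: particle_pos_def q_def)
    have posS: "particle_pos (c + 1) q (Suc i) = particle_pos c p i" for i
      by (simp add: particle_pos_def q_def)
    obtain k where k: "\<forall>i\<ge>k. p i = 0" using p(1) by (auto simp: is_partition_def)
    have "is_partition q"
    proof (rule partitionI[of _ "Suc k"])
      show "q (Suc i) \<le> q i" for i
        using partition_decseq[OF p(1), of "i - 1" i] b by (auto simp: q_def split: nat.split)
      show "q i = 0" if "i \<ge> Suc k" for i using k that by (auto simp: q_def split: nat.split)
    qed
    moreover have "S = range (particle_pos (c + 1) q)"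
    proof -
      have "range (particle_pos (c + 1) q) = insert (b - 1) (range (particle_pos c p))"
        using pos0 posS by (auto simp: image_iff) (metis not0_implies_Suc, metis+)
      then show ?thesis using p(2) True by auto
    qed
    ultimately show ?thesis by blast
  next
    case False
    have "S \<subseteq> {..<b - 1}"
    proof
      fix x assume "x \<in> S"
      then have "x < b" "x \<noteq> b - 1" using Suc.prems False by auto
      then show "x \<in> {..<b - 1}" by simp
    qed
    then show ?thesis using Suc by (intro Suc.hyps(1)[of "b - 1"]) auto
  qed
qed


text \<open>
  Between the diagonals \<open>m\<close> and \<open>m + 1\<close>, the dominos of a tiling match the particles if \<open>m\<close> is
  odd and the holes if \<open>m\<close> is even; \<open>site C L m m'\<close> enumerates these on the diagonal \<open>m'\<close>.
\<close>

definition site :: "(int \<Rightarrow> int) \<Rightarrow> (int \<Rightarrow> nat \<Rightarrow> nat) \<Rightarrow> int \<Rightarrow> int \<Rightarrow> nat \<Rightarrow> int" where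
  "site C L m m' = (if odd m then particle_pos else hole_pos) (C m') (L m')"

text \<open>The \<open>i\<close>-th particle or hole is matched with the \<open>i\<close>-th one on
  the next diagonal; by \<open>matching_unique\<close> a tiling leaves no other choice.\<close>

definition admissible :: "(int \<Rightarrow> int) \<Rightarrow> (int \<Rightarrow> nat \<Rightarrow> nat) \<Rightarrow> bool" where
  "admissible C L \<longleftrightarrow> (\<forall>m. is_partition (L m)) \<and>
     (\<forall>m i. site C L m (m + 1) i - site C L m m i \<in> {0, 1})"

definition link_domino :: "(int \<Rightarrow> int) \<Rightarrow> (int \<Rightarrow> nat \<Rightarrow> nat) \<Rightarrow> int \<Rightarrow> nat \<Rightarrow> domino" where
  "link_domino C L m i = domino_at m (site C L m m i) (site C L m (m + 1) i \<noteq> site C L m m i)"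

definition tiling_of :: "(int \<Rightarrow> int) \<Rightarrow> (int \<Rightarrow> nat \<Rightarrow> nat) \<Rightarrow> domino set" where
  "tiling_of C L = {link_domino C L m i | m i. True}"

lemma site_eq_iff: "is_partition (L m') \<Longrightarrow> site C L m m' i = site C L m m' j \<longleftrightarrow> i = j"
  by (simp add: site_def particle_pos_eq_iff hole_pos_eq_iff)

lemma range_site:
  "is_partition (L m') \<Longrightarrow> a \<in> range (site C L m m') \<longleftrightarrow> (a \<in> range (particle_pos (C m') (L m')) \<longleftrightarrow> odd m)"
  by (auto simp: site_def range_hole_pos)

lemma dom_in_tiling_of:
  assumes "admissible C L"
  shows "domino_at m a s \<in> tiling_of C L \<longleftrightarrow>
    (\<exists>i. a = site C L m m i \<and> a + of_bool s = site C L m (m + 1) i)"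
proof -
  have "site C L m (m + 1) i - site C L m m i \<in> {0, 1}" for i
    using assms by (simp add: admissible_def)
  then have "s = (site C L m (m + 1) i \<noteq> site C L m m i) \<longleftrightarrow>
      site C L m m i + of_bool s = site C L m (m + 1) i" for i
    by (cases s) (auto dest: spec[of _ i], smt)
  then show ?thesis by (auto simp: tiling_of_def link_domino_def)
qed

lemma dom_covers_tiling_of:
  assumes adm: "admissible C L"
  shows "domino_at m' a' s \<in> tiling_of C L \<and> (a, a - m) \<in> cells (domino_at m' a' s) \<longleftrightarrow>
    (m' = m \<or> m' = m - 1) \<and>
    (\<exists>i. a = site C L m' m i \<and> a' = site C L m' m' i \<and> a' + of_bool s = site C L m' (m' + 1) i)"
  unfolding dom_in_tiling_of[OF adm] cells_dom by auto

text \<open>A cell of diagonal \<open>m\<close> is a particle or a hole, and exactly one of the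
  indices \<open>m\<close> and \<open>m - 1\<close> has the parity for which dominos match cells of
  this kind. It is covered from that side, and from that side once.\<close>

lemma plane_tiling_tiling_of:
  assumes adm: "admissible C L"
  shows "plane_tiling (tiling_of C L)"
  unfolding plane_tiling_dom_iff
proof (intro allI)
  fix m a
  have part: "is_partition (L m)" for m using adm by (simp add: admissible_def)
  define m' where "m' = (if odd m \<longleftrightarrow> a \<in> range (particle_pos (C m) (L m)) then m else m - 1)"
  have m': "m' = m \<or> m' = m - 1" "odd m' \<longleftrightarrow> a \<in> range (particle_pos (C m) (L m))"
    by (auto simp: m'_def)
  then have "a \<in> range (site C L m' m)" using range_site[where C = C and L = L and m' = m and m = m', OF part] by simp
  then obtain i where i: "a = site C L m' m i" by blast
  define s where "s \<longleftrightarrow> site C L m' (m' + 1) i \<noteq> site C L m' m' i"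
  have "site C L m' (m' + 1) i - site C L m' m' i \<in> {0, 1}"
    using adm by (simp add: admissible_def)
  then have s: "site C L m' m' i + of_bool s = site C L m' (m' + 1) i"
    by (auto simp: s_def)
  show "\<exists>!d. d \<in> tiling_of C L \<and> (a, a - m) \<in> cells d"
  proof (rule ex1I[of _ "domino_at m' (site C L m' m' i) s"])
    show "domino_at m' (site C L m' m' i) s \<in> tiling_of C L \<and> (a, a - m) \<in> cells (domino_at m' (site C L m' m' i) s)"
      unfolding dom_covers_tiling_of[OF adm] using m' i s by blast
    fix e assume e: "e \<in> tiling_of C L \<and> (a, a - m) \<in> cells e"
    obtain n b t where domino_at: "e = domino_at n b t" by (rule dom_exhaust)
    obtain k where k: "n = m \<or> n = m - 1" "a = site C L n m k" "b = site C L n n k"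
      "b + of_bool t = site C L n (n + 1) k"
      using e unfolding domino_at dom_covers_tiling_of[OF adm] by blast
    have "odd n \<longleftrightarrow> a \<in> range (particle_pos (C m) (L m))"
      using k(2) range_site[where C = C and L = L and m' = m and m = n and a = a, OF part] by blast
    then have n: "n = m'" using m' k(1) by auto
    have "site C L m' m k = site C L m' m i" using k(2) i n by simp
    then have ki: "k = i" by (simp add: site_eq_iff part)
    have "of_bool t = (of_bool s :: int)" using k(3,4) n s ki by simp
    then have "t = s" by (simp add: of_bool_eq_iff)
    then show "e = domino_at m' (site C L m' m' i) s" using k(3) n ki by (simp add: domino_at)
  qed
qed

lemma particles_tiling_of:
  assumes adm: "admissible C L"
  shows "particles (tiling_of C L) m = range (particle_pos (C m) (L m))"
proof -
  note T = plane_tiling_tiling_of[OF adm]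
  have part: "is_partition (L m)" for m using adm by (simp add: admissible_def)
  have "a \<in> particles (tiling_of C L) m \<longleftrightarrow> a \<in> range (particle_pos (C m) (L m))" for a
  proof -
    obtain d where d: "d \<in> tiling_of C L" "(a, a - m) \<in> cells d"
      using plane_tiling_covering[OF T, of a m] by blast
    obtain n b t where domino_at: "d = domino_at n b t" by (rule dom_exhaust)
    have "a \<in> range (site C L n m)"
      using d dom_covers_tiling_of[OF adm, of n b t a m] unfolding domino_at by blast
    then show ?thesis
      using particles_iff[OF T d[unfolded domino_at]]
        range_site[where C = C and L = L and m' = m and m = n and a = a, OF part] by blast
  qed
  then show ?thesis by blast
qed

lemma plane_tiling_eqI:
  "plane_tiling T \<Longrightarrow> d \<in> T \<Longrightarrow> e \<in> T \<Longrightarrow> c \<in> cells d \<Longrightarrow> c \<in> cells e \<Longrightarrow> d = e"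
  unfolding plane_tiling_iff by blast

text \<open>Strictly ordered integers that each move by 0 or 1 remain weakly ordered, and
  injectivity makes the order strict. So \<open>f\<close> lists its range in the same order as
  \<open>P'\<close>.\<close>

lemma matching_unique:
  fixes P P' f :: "nat \<Rightarrow> int"
  assumes "\<And>i. f i = P i \<or> f i = P i + 1" "inj f" "range f = range P'"
    and "(\<forall>i j. i < j \<longrightarrow> P j < P i) \<and> (\<forall>i j. i < j \<longrightarrow> P' j < P' i) \<or>
         (\<forall>i j. i < j \<longrightarrow> P i < P j) \<and> (\<forall>i j. i < j \<longrightarrow> P' i < P' j)"
  shows "f = P'"
  using assms(4)
proof
  assume *: "(\<forall>i j. i < j \<longrightarrow> P j < P i) \<and> (\<forall>i j. i < j \<longrightarrow> P' j < P' i)"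
  show ?thesis
  proof (rule strict_antimono_range_unique)
    show "f j < f i" if "i < j" for i j
    proof -
      have "f j \<noteq> f i" using assms(2) that by (metis injD less_irrefl)
      moreover have "P j < P i" using * that by blast
      ultimately show ?thesis using assms(1)[of i] assms(1)[of j] by linarith
    qed
  qed (use * assms(3) in auto)
next
  assume *: "(\<forall>i j. i < j \<longrightarrow> P i < P j) \<and> (\<forall>i j. i < j \<longrightarrow> P' i < P' j)"
  show ?thesis
  proof (rule strict_mono_range_unique)
    show "f i < f j" if "i < j" for i j
    proof -
      have "f j \<noteq> f i" using assms(2) that by (metis injD less_irrefl)
      moreover have "P i < P j" using * that by blast
      ultimately show ?thesis using assms(1)[of i] assms(1)[of j] by linarith
    qed
  qed (use * assms(3) in auto)
qed

text \<open>The dominos between two adjacent diagonals define an injective map from the particles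
  (or holes) of one onto those of the other, with moves by 0 or 1. Such a map has to preserve the
  ranks.\<close>

lemma tiling_determined_by_particles:
  assumes T: "plane_tiling T" and part: "\<And>m. is_partition (L m)"
    and occ: "\<And>m. particles T m = range (particle_pos (C m) (L m))"
  shows "admissible C L" "T = tiling_of C L"
proof -
  have sites: "a \<in> range (site C L n m) \<longleftrightarrow> odd m' = odd n"
    if "domino_at m' a' s \<in> T" "(a, a - m) \<in> cells (domino_at m' a' s)" for m m' n a a' s
    using particles_iff[OF T that] range_site[where C = C and L = L and m' = m and m = n and a = a, OF part]
    unfolding occ by blast
  have ex: "\<exists>s. domino_at m a s \<in> T" if "a \<in> range (site C L m m)" for m a
  proof -
    obtain d where d: "d \<in> T" "(a, a - m) \<in> cells d"
      using plane_tiling_covering[OF T, of a m] by blast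
    obtain n b t where domino_at: "d = domino_at n b t" by (rule dom_exhaust)
    have "odd n = odd m" using sites[OF d[unfolded domino_at], of m] that by simp
    moreover have "n = m \<and> b = a \<or> n = m - 1" using d(2) unfolding domino_at cells_dom by blast
    ultimately have "n = m \<and> b = a" by auto
    then show ?thesis using d(1) domino_at by blast
  qed
  have ex': "\<exists>b s. domino_at m b s \<in> T \<and> a = b + of_bool s" if "a \<in> range (site C L m (m + 1))" for m a
  proof -
    obtain d where d: "d \<in> T" "(a, a - (m + 1)) \<in> cells d"
      using plane_tiling_covering[OF T, of a "m + 1"] by blast
    obtain n b t where domino_at: "d = domino_at n b t" by (rule dom_exhaust)
    have "odd n = odd m" using sites[OF d[unfolded domino_at], of m] that by simp
    moreover have "n = m + 1 \<or> n = m \<and> b + of_bool t = a"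
      using d(2) unfolding domino_at cells_dom by (simp only: add_diff_cancel_right') blast
    ultimately have "n = m \<and> a = b + of_bool t" by auto
    then show ?thesis using d(1) domino_at by blast
  qed
  have dom_sites: "a \<in> range (site C L m m)" "a + of_bool s \<in> range (site C L m (m + 1))"
    if "domino_at m a s \<in> T" for m a s
    using sites[of m a s a m m] sites[of m a s "a + of_bool s" "m + 1" m] that
    by (auto simp: cells_dom)
  have uniq: "a = a' \<and> s = s'" if "domino_at m a s \<in> T" "domino_at m a' s' \<in> T" "a = a' \<or> a + of_bool s = a' + of_bool s'"
    for m a s a' s'
  proof -
    have "domino_at m a s = domino_at m a' s'"
      using that(3)
    proof
      assume "a = a'"
      then have "(a, a - m) \<in> cells (domino_at m a s)" "(a, a - m) \<in> cells (domino_at m a' s')"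
        unfolding cells_dom by simp_all
      then show ?thesis by (rule plane_tiling_eqI[OF T that(1,2)])
    next
      assume *: "a + of_bool s = a' + of_bool s'"
      have "(a + of_bool s, a + of_bool s - (m + 1)) \<in> cells (domino_at m a s)"
        "(a + of_bool s, a + of_bool s - (m + 1)) \<in> cells (domino_at m a' s')"
        unfolding cells_dom using * by simp_all
      then show ?thesis by (rule plane_tiling_eqI[OF T that(1,2)])
    qed
    then show ?thesis by simp
  qed
  have key: "domino_at m (site C L m m i) s \<in> T \<longleftrightarrow> site C L m m i + of_bool s = site C L m (m + 1) i"
    and step: "site C L m (m + 1) i - site C L m m i \<in> {0, 1}" for m i s
  proof -
    \<comment> \<open>Whether the domino at the site of rank \<open>i\<close> is horizontal, that
      is, whether the particle or hole moves.\<close>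
    define g where "g i = (SOME s. domino_at m (site C L m m i) s \<in> T)" for i
    have g: "domino_at m (site C L m m i) (g i) \<in> T" for i
      unfolding g_def using ex by (rule someI_ex) blast
    define f where "f i = site C L m m i + of_bool (g i)" for i
    have fP: "f = site C L m (m + 1)"
    proof (rule matching_unique[of _ "site C L m m"])
      show "f i = site C L m m i \<or> f i = site C L m m i + 1" for i by (simp add: f_def)
      show "inj f"
      proof (rule injI)
        fix i j assume "f i = f j"
        then have "site C L m m i = site C L m m j" using uniq[OF g g] unfolding f_def by blast
        then show "i = j" by (simp add: site_eq_iff part)
      qed
      show "range f = range (site C L m (m + 1))"
      proof (intro equalityI subsetI)
        fix x assume "x \<in> range f"
        then show "x \<in> range (site C L m (m + 1))" using dom_sites(2)[OF g] by (auto simp: f_def)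
      next
        fix x assume "x \<in> range (site C L m (m + 1))"
        then obtain b s where b: "domino_at m b s \<in> T" "x = b + of_bool s" using ex' by blast
        then obtain i where i: "b = site C L m m i" using dom_sites(1) by blast
        then have "g i = s" using uniq[OF g[of i] b(1)] by blast
        then have "x = f i" using b(2) i by (simp add: f_def)
        then show "x \<in> range f" by blast
      qed
      show "(\<forall>i j. i < j \<longrightarrow> site C L m m j < site C L m m i) \<and>
          (\<forall>i j. i < j \<longrightarrow> site C L m (m + 1) j < site C L m (m + 1) i) \<or>
         (\<forall>i j. i < j \<longrightarrow> site C L m m i < site C L m m j) \<and>
          (\<forall>i j. i < j \<longrightarrow> site C L m (m + 1) i < site C L m (m + 1) j)"
        by (simp add: site_def particle_pos_less hole_pos_less part)
    qed
    have f: "site C L m m i + of_bool (g i) = site C L m (m + 1) i" for i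
      unfolding fP[symmetric] by (simp add: f_def)
    show "site C L m (m + 1) i - site C L m m i \<in> {0, 1}" unfolding f[symmetric] by simp
    show "domino_at m (site C L m m i) s \<in> T \<longleftrightarrow> site C L m m i + of_bool s = site C L m (m + 1) i"
    proof
      assume "domino_at m (site C L m m i) s \<in> T"
      then have "g i = s" using uniq[OF g[of i]] by blast
      then show "site C L m m i + of_bool s = site C L m (m + 1) i" using f[of i] by simp
    next
      assume "site C L m m i + of_bool s = site C L m (m + 1) i"
      then have "of_bool s = (of_bool (g i) :: int)" using f[of i] by simp
      then have "s = g i" by (simp add: of_bool_eq_iff)
      then show "domino_at m (site C L m m i) s \<in> T" using g[of i] by simp
    qed
  qed
  show adm: "admissible C L" unfolding admissible_def using part step by blast
  have "domino_at m a s \<in> T \<longleftrightarrow> domino_at m a s \<in> tiling_of C L" for m a s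
    unfolding dom_in_tiling_of[OF adm] using key dom_sites(1) by blast
  then show "T = tiling_of C L" by (metis dom_exhaust subsetI subset_antisym)
qed

section \<open>Cylindric steep tilings as periodic sequences of partitions\<close>

definition step_charge :: "sign list \<Rightarrow> nat \<Rightarrow> int" where
  "step_charge w i = of_bool (letter w i = (if odd i then Plus else Minus))"

lemma charge_Suc: "charge w (Suc m) = charge w m + step_charge w (Suc m)"
  unfolding charge.simps step_charge_def ..

declare charge.simps(2) [simp del]

text \<open>Continues \<open>charge\<close> from one period to all diagonals in the way forced by
  invariance under the translation with first coordinate \<open>charge w (2 * l)\<close>.\<close>

definition periodic_charge :: "nat \<Rightarrow> sign list \<Rightarrow> int \<Rightarrow> int" where
  "periodic_charge l w m = charge w (nat (m mod (2 * int l))) + m div (2 * int l) * charge w (2 * l)"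

text \<open>Letters are numbered from 1, so the step from diagonal \<open>m\<close> to
  \<open>m + 1\<close> is governed by letter \<open>m + 1\<close>, taken modulo the period.\<close>

definition letter_at :: "nat \<Rightarrow> int \<Rightarrow> nat" where
  "letter_at l m = Suc (nat (m mod (2 * int l)))"

lemma periodic_charge_period:
  "l \<ge> 1 \<Longrightarrow> periodic_charge l w (m + 2 * int l) = periodic_charge l w m + charge w (2 * l)"
  by (simp add: periodic_charge_def distrib_right)

lemma periodic_charge_step:
  assumes l: "l \<ge> 1"
  shows "periodic_charge l w (m + 1) - periodic_charge l w m = step_charge w (letter_at l m)"
proof -
  define N r q where "N = 2 * int l" and "r = m mod N" and "q = m div N"
  have N: "N > 0" using l by (simp add: N_def)
  have m: "m = q * N + r" by (simp add: q_def r_def)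
  have r: "0 \<le> r" "r < N" using N by (simp_all add: r_def)
  have pc: "periodic_charge l w k = charge w (nat (k mod N)) + k div N * charge w (2 * l)" for k
    by (simp add: periodic_charge_def N_def)
  have la: "letter_at l m = Suc (nat r)" by (simp add: letter_at_def N_def r_def)
  show ?thesis
  proof (cases "r + 1 < N")
    case True
    then have "(m + 1) mod N = r + 1" "(m + 1) div N = q"
      using r N by (simp_all add: m add.assoc)
    moreover have "nat (r + 1) = Suc (nat r)" using r by simp
    ultimately show ?thesis
      unfolding pc la r_def[symmetric] q_def[symmetric] by (simp add: charge_Suc)
  next
    case False
    then have r': "r = N - 1" using r by simp
    then have "m + 1 = (q + 1) * N" by (simp add: m algebra_simps)
    then have "(m + 1) mod N = 0" "(m + 1) div N = q + 1" using N by simp_all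
    moreover have "2 * l = Suc (nat r)" using r' l by (simp add: N_def)
    ultimately show ?thesis
      unfolding pc la r_def[symmetric] q_def[symmetric] by (simp add: charge_Suc algebra_simps)
  qed
qed

lemma letter_at_nat: "m < 2 * l \<Longrightarrow> letter_at l (int m) = Suc m"
  by (simp add: letter_at_def)

lemma periodic_charge_nat:
  assumes "l \<ge> 1"
  shows "m \<le> 2 * l \<Longrightarrow> periodic_charge l w (int m) = charge w m"
proof (induction m)
  case 0
  then show ?case by (simp add: periodic_charge_def)
next
  case (Suc m)
  then show ?case
    using periodic_charge_step[OF assms, of w "int m"] by (simp add: letter_at_nat charge_Suc add.commute)
qed

lemma period_multiple:
  fixes f :: "int \<Rightarrow> 'a"
  assumes "\<And>m. f (m + N) = f m"
  shows "f (m + q * N) = f m"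
proof (induction q rule: int_induct[of _ 0])
  case (step1 q)
  then show ?case using assms[of "m + q * N"] by (simp add: algebra_simps)
next
  case (step2 q)
  then show ?case using assms[of "m + (q - 1) * N"] by (simp add: algebra_simps)
qed simp

lemma period_cong:
  fixes f :: "int \<Rightarrow> 'a"
  assumes "\<And>m. f (m + N) = f m" "m mod N = m' mod N"
  shows "f m = f m'"
proof -
  obtain q where "m = m' + N * q" using assms(2) by (metis mod_eqE)
  then show ?thesis using period_multiple[of f N m' q, OF assms(1)] by (simp add: mult.commute)
qed

lemma periodic_int_induct:
  assumes l: "l \<ge> 1" and base: "\<And>r. r < 2 * l \<Longrightarrow> P (int r)"
    and period: "\<And>m. P (m + 2 * int l) \<longleftrightarrow> P m"
  shows "P m"
proof -
  have "P m \<longleftrightarrow> P (m mod (2 * int l))" by (rule period_cong[of P "2 * int l", OF period]) simp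
  moreover have "P (int (nat (m mod (2 * int l))))"
    by (rule base) (use l in \<open>simp add: nat_less_iff\<close>)
  ultimately show ?thesis using l by simp
qed


lemma site_shift: "site (\<lambda>m. C m + t) L m m' i = site C L m m' i + t"
  by (simp add: site_def particle_pos_def hole_pos_def)

lemma admissible_shift: "admissible (\<lambda>m. C m + t) L \<longleftrightarrow> admissible C L"
  by (simp add: admissible_def site_shift)

lemma translate_tiling_of: "translate t t ` tiling_of C L = tiling_of (\<lambda>m. C m + t) L"
proof -
  have "link_domino (\<lambda>m. C m + t) L m i = translate t t (link_domino C L m i)" for m i
    by (simp add: link_domino_def site_shift)
  then show ?thesis by (auto simp: tiling_of_def)
qed

lemma link_domino_period:
  assumes "\<And>m. C (m + 2 * int l) = C m + c" "\<And>m. L (m + 2 * int l) = L m"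
  shows "link_domino C L (m + 2 * int l) i = translate c (c - 2 * int l) (link_domino C L m i)"
proof -
  have "site C L (m + 2 * int l) (m' + 2 * int l) i = site C L m m' i + c" for m'
    by (simp add: site_def particle_pos_def hole_pos_def assms)
  from this[of m] this[of "m + 1"] show ?thesis
    by (simp add: link_domino_def algebra_simps)
qed

lemma invariant_tiling_of:
  assumes "\<And>m. C (m + 2 * int l) = C m + c" "\<And>m. L (m + 2 * int l) = L m"
  shows "invariant l c (tiling_of C L)"
  unfolding invariant_def
proof (intro equalityI subsetI)
  fix d assume "d \<in> translate c (c - 2 * int l) ` tiling_of C L"
  then obtain m i where "d = translate c (c - 2 * int l) (link_domino C L m i)" by (auto simp: tiling_of_def)
  then have "d = link_domino C L (m + 2 * int l) i" using link_domino_period assms by metis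
  then show "d \<in> tiling_of C L" by (auto simp: tiling_of_def)
next
  fix d assume "d \<in> tiling_of C L"
  then obtain m i where d: "d = link_domino C L m i" by (auto simp: tiling_of_def)
  then have "d = translate c (c - 2 * int l) (link_domino C L (m - 2 * int l) i)"
    using link_domino_period[of C l c L "m - 2 * int l" i, OF assms] by simp
  then show "d \<in> translate c (c - 2 * int l) ` tiling_of C L" by (auto simp: tiling_of_def)
qed

lemma Bex_domino: "(\<exists>d\<in>T. Q d) \<longleftrightarrow> (\<exists>m a s. domino_at m a s \<in> T \<and> Q (domino_at m a s))"
proof
  assume "\<exists>d\<in>T. Q d"
  then obtain d where "d \<in> T" "Q d" by blast
  then show "\<exists>m a s. domino_at m a s \<in> T \<and> Q (domino_at m a s)" by (cases d rule: dom_exhaust) blast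
qed blast

lemma particles_period:
  assumes "invariant l c T"
  shows "particles T (m + 2 * int l) = (\<lambda>a. a + c) ` particles T m"
proof -
  have "a \<in> particles T (m + 2 * int l) \<longleftrightarrow> a - c \<in> particles T m" for a
  proof -
    have "a \<in> particles T m \<longleftrightarrow> (\<exists>m' a' s. domino_at m' a' s \<in> T \<and> odd m' \<and> (a, a - m) \<in> cells (domino_at m' a' s))" for a m
      unfolding particles_def mem_Collect_eq Bex_domino dom_direction by blast
    note 1 = this
    have "domino_at m' a' s \<in> T \<and> odd m' \<and> (a, a - (m + 2 * int l)) \<in> cells (domino_at m' a' s) \<longleftrightarrow>
        domino_at (m' - 2 * int l) (a' - c) s \<in> T \<and> odd (m' - 2 * int l) \<and>
        (a - c, a - c - m) \<in> cells (domino_at (m' - 2 * int l) (a' - c) s)" for m' a' s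
      using assms[unfolded invariant_iff, rule_format, of "m' - 2 * int l" "a' - c" s]
      unfolding cells_dom by auto
    then show ?thesis unfolding 1 by (metis add_diff_cancel_right')
  qed
  note shift = this
  show ?thesis
  proof (intro equalityI subsetI)
    fix a assume "a \<in> particles T (m + 2 * int l)"
    then have "a - c \<in> particles T m" using shift by blast
    then show "a \<in> (\<lambda>a. a + c) ` particles T m" by (rule rev_image_eqI) simp
  qed (auto simp: shift)
qed

text \<open>The translation moves the particles of one diagonal rigidly by \<open>c\<close>, which
  changes the charge and keeps the partition.\<close>

lemma invariant_tiling_ofD:
  assumes adm: "admissible C L" and inv: "invariant l c (tiling_of C L)"
  shows "C (m + 2 * int l) = C m + c" "L (m + 2 * int l) = L m"
proof -
  have "range (particle_pos (C (m + 2 * int l)) (L (m + 2 * int l))) = (\<lambda>a. a + c) ` range (particle_pos (C m) (L m))"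
    using particles_period[OF inv, of m] by (simp only: particles_tiling_of[OF adm])
  also have "\<dots> = range (particle_pos (C m + c) (L m))"
    by (auto simp: particle_pos_def image_iff algebra_simps)
  finally show "C (m + 2 * int l) = C m + c" "L (m + 2 * int l) = L m"
    using particle_range_inject[of "L (m + 2 * int l)" "L m"] adm unfolding admissible_def by blast+
qed

text \<open>The left cell of a domino with odd \<open>m\<close> is a particle and thus bounded on
  the right, with even \<open>m\<close> it is a hole and bounded on the left. The strip contains
  finitely many values of \<open>m\<close>.\<close>

lemma steep_tiling_of:
  assumes adm: "admissible C L"
  shows "steep l (tiling_of C L)"
proof -
  have "\<exists>b. \<forall>a s. domino_at (int m) a s \<in> tiling_of C L \<longrightarrow> (a \<ge> b \<longrightarrow> even m) \<and> (a \<le> - b \<longrightarrow> odd m)" for m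
  proof -
    have part: "is_partition (L (int m))" using adm by (simp add: admissible_def)
    define p where "p = L (int m)"
    define b where "b = \<bar>particle_pos (C (int m)) p 0\<bar> + \<bar>hole_pos (C (int m)) p 0\<bar> + 1"
    have "particle_pos (C (int m)) p i \<le> particle_pos (C (int m)) p 0" for i
      using particle_pos_less[OF part, of 0 i] by (cases "i = 0") (auto simp: p_def less_imp_le)
    moreover have "hole_pos (C (int m)) p i \<ge> hole_pos (C (int m)) p 0" for i
      using hole_pos_less[OF part, of 0 i] by (cases "i = 0") (auto simp: p_def less_imp_le)
    ultimately have bounds: "particle_pos (C (int m)) p i < b" "hole_pos (C (int m)) p i > - b" for i
      unfolding b_def by (smt (verit))+
    show ?thesis
    proof (intro exI[of _ b] allI impI)
      fix a s assume "domino_at (int m) a s \<in> tiling_of C L"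
      then obtain i where "a = site C L (int m) (int m) i" unfolding dom_in_tiling_of[OF adm] by blast
      then show "(a \<ge> b \<longrightarrow> even m) \<and> (a \<le> - b \<longrightarrow> odd m)"
        using bounds[of i] by (cases "odd m") (simp_all add: site_def p_def)
    qed
  qed
  then obtain b where b: "\<And>m a s. domino_at (int m) a s \<in> tiling_of C L \<Longrightarrow> (a \<ge> b m \<longrightarrow> even m) \<and> (a \<le> - b m \<longrightarrow> odd m)"
    by metis
  define B where "B = (\<Sum>m<2 * l. \<bar>b m\<bar>)"
  have B: "\<bar>b m\<bar> \<le> B" if "m < 2 * l" for m
    unfolding B_def using that by (intro member_le_sum) auto
  show ?thesis
    unfolding steep_iff
  proof (intro exI[of _ B] allI impI)
    fix m a s assume *: "0 \<le> m \<and> m < 2 * int l \<and> domino_at m a s \<in> tiling_of C L"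
    then have m: "m = int (nat m)" "nat m < 2 * l" by auto
    have "(a \<ge> b (nat m) \<longrightarrow> even (nat m)) \<and> (a \<le> - b (nat m) \<longrightarrow> odd (nat m))"
      by (rule b) (use * m in auto)
    then show "(a \<ge> B \<longrightarrow> even m) \<and> (a \<le> - B \<longrightarrow> odd m)"
      using B[OF m(2)] m(1) by (smt (verit) even_of_nat)
  qed
qed

text \<open>Steepness speaks of one period; invariance carries it to every \<open>m\<close>, with a
  bound depending on \<open>m\<close>. A cell of diagonal \<open>m\<close> lies in a domino with
  index \<open>m\<close> or \<open>m - 1\<close>, hence the two bounds in \<open>B\<close>.\<close>

lemma particles_bounded:
  assumes T: "plane_tiling T" and inv: "invariant l c T" and st: "steep l T" and l: "l \<ge> 1"
  shows "\<exists>a b. {..<a} \<subseteq> particles T m \<and> particles T m \<subseteq> {..<b}"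
proof -
  obtain b where b: "\<And>m a s. 0 \<le> m \<Longrightarrow> m < 2 * int l \<Longrightarrow> domino_at m a s \<in> T \<Longrightarrow>
      (a \<ge> b \<longrightarrow> even m) \<and> (a \<le> - b \<longrightarrow> odd m)"
    using st unfolding steep_iff by blast
  have "\<exists>b. \<forall>a s. domino_at m a s \<in> T \<longrightarrow> (a \<ge> b \<longrightarrow> even m) \<and> (a \<le> - b \<longrightarrow> odd m)" for m
  proof -
    define r q where "r = m mod (2 * int l)" and "q = m div (2 * int l)"
    have m: "m = r + q * (2 * int l)" by (simp only: r_def q_def mod_div_mult_eq)
    have r: "0 \<le> r" "r < 2 * int l" using l by (simp_all add: r_def)
    have parity: "even m \<longleftrightarrow> even r" unfolding m by simp
    show ?thesis
    proof (intro exI[of _ "\<bar>b\<bar> + \<bar>q * c\<bar>"] allI impI)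
      fix a s assume "domino_at m a s \<in> T"
      then have "domino_at r (a - q * c) s \<in> T"
        using invariant_multiple[OF inv, of r q "a - q * c" s] by (simp add: m)
      from b[OF r this] have "(a - q * c \<ge> b \<longrightarrow> even r) \<and> (a - q * c \<le> - b \<longrightarrow> odd r)" .
      then show "(a \<ge> \<bar>b\<bar> + \<bar>q * c\<bar> \<longrightarrow> even m) \<and> (a \<le> - (\<bar>b\<bar> + \<bar>q * c\<bar>) \<longrightarrow> odd m)"
        unfolding parity by linarith
    qed
  qed
  then obtain b where b: "\<And>m a s. domino_at m a s \<in> T \<Longrightarrow> (a \<ge> b m \<longrightarrow> even m) \<and> (a \<le> - b m \<longrightarrow> odd m)"
    by metis
  define B where "B = \<bar>b m\<bar> + \<bar>b (m - 1)\<bar> + 2"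
  have *: "(a \<in> particles T m \<longrightarrow> a < B) \<and> (a \<notin> particles T m \<longrightarrow> a \<ge> - B)" for a
  proof -
    obtain d where d: "d \<in> T" "(a, a - m) \<in> cells d"
      using plane_tiling_covering[OF T, of a m] by blast
    obtain n e s where domino_at: "d = domino_at n e s" by (rule dom_exhaust)
    have "n = m \<or> n = m - 1" "e \<le> a" "a \<le> e + 1" using d(2) unfolding domino_at cells_dom by auto
    moreover have "(e \<ge> b n \<longrightarrow> even n) \<and> (e \<le> - b n \<longrightarrow> odd n)" using b d(1) domino_at by blast
    ultimately show ?thesis
      unfolding particles_iff[OF T d[unfolded domino_at]] B_def by (cases "odd n") auto
  qed
  have "{..<- B} \<subseteq> particles T m" "particles T m \<subseteq> {..<B}" using * by (force simp: not_le)+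
  then show ?thesis by blast
qed

lemma steep_tilingE:
  assumes "cylindric_steep_tiling l T" and l: "l \<ge> 1"
  obtains C L c where "admissible C L" "T = tiling_of C L" "invariant l c T"
    "\<And>m. C (m + 2 * int l) = C m + c" "\<And>m. L (m + 2 * int l) = L m"
proof -
  obtain c where T: "plane_tiling T" and c: "invariant l c T" and st: "steep l T"
    using assms(1) by (auto simp: cylindric_steep_tiling_def)
  have "\<exists>C p. is_partition p \<and> particles T m = range (particle_pos C p)" for m
    using particles_bounded[OF T c st l, of m] ex_partition_of_particles by blast
  then obtain C L where CL: "\<And>m. is_partition (L m)" "\<And>m. particles T m = range (particle_pos (C m) (L m))"
    by metis
  note adm = tiling_determined_by_particles[OF T CL]
  show ?thesis
    using that[OF adm c] invariant_tiling_ofD[OF adm(1)] c adm(2) by blast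
qed


section \<open>Asymptotic data as charge increments\<close>

lemma square_covered_iff:
  "square_covered T P a (a - m) \<longleftrightarrow> (\<exists>s. P (domino_at m a s) \<and> domino_at m a s \<in> T \<or>
     P (domino_at (m - 1) (a - of_bool s) s) \<and> domino_at (m - 1) (a - of_bool s) s \<in> T)"
proof -
  have "a' + of_bool s = a \<longleftrightarrow> a' = a - of_bool s" for a' s by auto
  then show ?thesis
    unfolding square_covered_def unit_square_subset_rect Bex_domino cells_dom by metis
qed

text \<open>Both squares lie on diagonal \<open>2 * k - 1\<close>. North- and east-going dominos
  have even index and can cover it only from \<open>2 * k - 2\<close>; west- and south-going ones
  have odd index, which leaves \<open>2 * k - 1\<close>.\<close>

lemma square_covered_iff_dom:
  "square_covered T (case z of Plus \<Rightarrow> north | Minus \<Rightarrow> east) (x - 1) (x - 2 * int k) \<longleftrightarrow>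
     domino_at (2 * int k - 2) (x - 1 - of_bool (z = Plus)) (z = Plus) \<in> T"
  "square_covered T (case z of Plus \<Rightarrow> west | Minus \<Rightarrow> south) x (x - 2 * int k + 1) \<longleftrightarrow>
     domino_at (2 * int k - 1) x (z = Minus) \<in> T"
proof -
  have "square_covered T P (x - 1) (x - 2 * int k) \<longleftrightarrow> square_covered T P (x - 1) (x - 1 - (2 * int k - 1))"
    "square_covered T P x (x - 2 * int k + 1) \<longleftrightarrow> square_covered T P x (x - (2 * int k - 1))" for P
    by (simp_all add: diff_diff_eq2 diff_add_eq)
  note 1 = this
  have 2: "2 * int k - 1 - 1 = 2 * int k - 2" by simp
  have parity: "even (2 * int k - 2)" "odd (2 * int k - 1)" by simp_all
  show "square_covered T (case z of Plus \<Rightarrow> north | Minus \<Rightarrow> east) (x - 1) (x - 2 * int k) \<longleftrightarrow>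
     domino_at (2 * int k - 2) (x - 1 - of_bool (z = Plus)) (z = Plus) \<in> T"
    unfolding 1 square_covered_iff 2
    by (cases z) (simp_all only: sign.case dom_direction parity sign.distinct ex_bool_eq simp_thms)
  show "square_covered T (case z of Plus \<Rightarrow> west | Minus \<Rightarrow> south) x (x - 2 * int k + 1) \<longleftrightarrow>
     domino_at (2 * int k - 1) x (z = Minus) \<in> T"
    unfolding 1 square_covered_iff 2
    by (cases z) (simp_all only: sign.case dom_direction parity sign.distinct ex_bool_eq simp_thms)
qed

text \<open>Far to the right the hole of rank \<open>j\<close> sits at charge plus \<open>j\<close>
  on either diagonal, so it moves by the difference of the charges.\<close>

lemma eventually_hole_domino:
  assumes adm: "admissible C L" and m: "even m"
  shows "eventually (\<lambda>a. domino_at m (a - of_bool s) s \<in> tiling_of C L \<longleftrightarrow> of_bool s = C (m + 1) - C m) at_top"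
proof -
  have part: "is_partition (L m)" for m using adm by (simp add: admissible_def)
  obtain n1 n2 where n: "\<forall>i\<ge>n1. hole_pos (C m) (L m) i = C m + int i"
    "\<forall>i\<ge>n2. hole_pos (C (m + 1)) (L (m + 1)) i = C (m + 1) + int i"
    using hole_pos_eventually part by meson
  show ?thesis
    using eventually_ge_at_top[of "C (m + 1) + int (max n1 n2)"]
  proof eventually_elim
    case (elim a)
    define j where "j = nat (a - C (m + 1))"
    have j: "j \<ge> n1" "j \<ge> n2" "int j = a - C (m + 1)" using elim by (auto simp: j_def)
    have "site C L m m j = C m + (a - C (m + 1))" "site C L m (m + 1) j = a"
      using n j m by (simp_all add: site_def)
    moreover have "site C L m (m + 1) i = a \<longleftrightarrow> i = j" for i
      using site_eq_iff[of L "m + 1" C m i j, OF part] calculation(2) by simp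
    ultimately show ?case
      unfolding dom_in_tiling_of[OF adm] by (auto simp: eq_commute[of a])
  qed
qed

lemma eventually_particle_domino:
  assumes adm: "admissible C L" and m: "odd m"
  shows "eventually (\<lambda>a. domino_at m a s \<in> tiling_of C L \<longleftrightarrow> of_bool s = C (m + 1) - C m) at_bot"
proof -
  have part: "is_partition (L m)" for m using adm by (simp add: admissible_def)
  obtain n1 n2 where n: "\<forall>i\<ge>n1. particle_pos (C m) (L m) i = C m - int i - 1"
    "\<forall>i\<ge>n2. particle_pos (C (m + 1)) (L (m + 1)) i = C (m + 1) - int i - 1"
    using particle_pos_eventually part by meson
  show ?thesis
    using eventually_le_at_bot[of "C m - int (max n1 n2) - 1"]
  proof eventually_elim
    case (elim a)
    define j where "j = nat (C m - a - 1)"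
    have j: "j \<ge> n1" "j \<ge> n2" "int j = C m - a - 1" using elim by (auto simp: j_def)
    have "site C L m m j = a" "site C L m (m + 1) j = C (m + 1) - (C m - a - 1) - 1"
      using n j m by (simp_all add: site_def)
    moreover have "site C L m m i = a \<longleftrightarrow> i = j" for i
      using site_eq_iff[of L m C m i j, OF part] calculation(1) by simp
    ultimately show ?case
      unfolding dom_in_tiling_of[OF adm] by (auto simp: eq_commute[of a])
  qed
qed

text \<open>Far particles and holes feel only the charges; the data thus prescribe the charge
  increments over one period and leave the partitions free.\<close>

lemma asymptotic_data_iff:
  assumes adm: "admissible C L"
  shows "asymptotic_data l w (tiling_of C L) \<longleftrightarrow>
    (\<forall>m<2 * l. C (int m + 1) - C (int m) = step_charge w (Suc m))"
proof -
  have top: "eventually (\<lambda>x. square_covered (tiling_of C L)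
        (case z of Plus \<Rightarrow> north | Minus \<Rightarrow> east) (x - 1) (x - 2 * int k)) at_top \<longleftrightarrow>
      of_bool (z = Plus) = C (2 * int k - 1) - C (2 * int k - 2)" (is "?l \<longleftrightarrow> ?r") for z k
  proof -
    have shift: "filterlim (\<lambda>x::int. x - 1) at_top at_top"
      unfolding filterlim_at_top
    proof
      fix Z :: int
      show "eventually (\<lambda>x. Z \<le> x - 1) at_top"
        using eventually_ge_at_top[of "Z + 1"] by eventually_elim simp
    qed
    have "eventually (\<lambda>x. domino_at (2 * int k - 2) (x - 1 - of_bool (z = Plus)) (z = Plus) \<in> tiling_of C L \<longleftrightarrow>
        of_bool (z = Plus) = C (2 * int k - 2 + 1) - C (2 * int k - 2)) at_top"
      by (rule eventually_compose_filterlim[OF eventually_hole_domino[OF adm] shift]) simp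
    then have *: "eventually (\<lambda>x. square_covered (tiling_of C L)
        (case z of Plus \<Rightarrow> north | Minus \<Rightarrow> east) (x - 1) (x - 2 * int k) \<longleftrightarrow> ?r) at_top"
      unfolding square_covered_iff_dom by simp
    \<comment> \<open>The covering condition eventually agrees with a proposition independent of
      \<open>x\<close>.\<close>
    have "?l \<longleftrightarrow> eventually (\<lambda>x::int. ?r) at_top"
      by (rule eventually_subst[OF *])
    also have "\<dots> \<longleftrightarrow> ?r" by (simp only: eventually_const_iff) simp
    finally show ?thesis .
  qed
  have bot: "eventually (\<lambda>x. square_covered (tiling_of C L)
        (case z of Plus \<Rightarrow> west | Minus \<Rightarrow> south) x (x - 2 * int k + 1)) at_bot \<longleftrightarrow>
      of_bool (z = Minus) = C (2 * int k) - C (2 * int k - 1)" (is "?l \<longleftrightarrow> ?r") for z k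
  proof -
    have "eventually (\<lambda>x. domino_at (2 * int k - 1) x (z = Minus) \<in> tiling_of C L \<longleftrightarrow>
        of_bool (z = Minus) = C (2 * int k - 1 + 1) - C (2 * int k - 1)) at_bot"
      by (rule eventually_particle_domino[OF adm]) simp
    then have *: "eventually (\<lambda>x. square_covered (tiling_of C L)
        (case z of Plus \<Rightarrow> west | Minus \<Rightarrow> south) x (x - 2 * int k + 1) \<longleftrightarrow> ?r) at_bot"
      unfolding square_covered_iff_dom by simp
    have "?l \<longleftrightarrow> eventually (\<lambda>x::int. ?r) at_bot"
      by (rule eventually_subst[OF *])
    also have "\<dots> \<longleftrightarrow> ?r" by (simp only: eventually_const_iff) simp
    finally show ?thesis .
  qed
  have "asymptotic_data l w (tiling_of C L) \<longleftrightarrow> (\<forall>k\<in>{1..l}.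
      of_bool (letter w (2 * k - 1) = Plus) = C (2 * int k - 1) - C (2 * int k - 2) \<and>
      of_bool (letter w (2 * k) = Minus) = C (2 * int k) - C (2 * int k - 1))"
    unfolding asymptotic_data_def top bot ..
  also have "\<dots> \<longleftrightarrow> (\<forall>m<2 * l. C (int m + 1) - C (int m) = step_charge w (Suc m))"
  proof
    assume *: "\<forall>k\<in>{1..l}.
      of_bool (letter w (2 * k - 1) = Plus) = C (2 * int k - 1) - C (2 * int k - 2) \<and>
      of_bool (letter w (2 * k) = Minus) = C (2 * int k) - C (2 * int k - 1)"
    show "\<forall>m<2 * l. C (int m + 1) - C (int m) = step_charge w (Suc m)"
    proof (intro allI impI)
      fix m assume m: "m < 2 * l"
      show "C (int m + 1) - C (int m) = step_charge w (Suc m)"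
      proof (cases "even m")
        case True
        then obtain j where j: "m = 2 * j" by blast
        then show ?thesis using *[rule_format, of "Suc j"] m by (simp add: step_charge_def algebra_simps)
      next
        case False
        then obtain j where j: "m = 2 * j + 1" by (rule oddE)
        then show ?thesis using *[rule_format, of "Suc j"] m by (simp add: step_charge_def algebra_simps)
      qed
    qed
  next
    assume *: "\<forall>m<2 * l. C (int m + 1) - C (int m) = step_charge w (Suc m)"
    show "\<forall>k\<in>{1..l}.
      of_bool (letter w (2 * k - 1) = Plus) = C (2 * int k - 1) - C (2 * int k - 2) \<and>
      of_bool (letter w (2 * k) = Minus) = C (2 * int k) - C (2 * int k - 1)"
    proof
      fix k assume k: "k \<in> {1..l}"
      then obtain j where j: "k = Suc j" by (cases k) auto
      show "of_bool (letter w (2 * k - 1) = Plus) = C (2 * int k - 1) - C (2 * int k - 2) \<and>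
        of_bool (letter w (2 * k) = Minus) = C (2 * int k) - C (2 * int k - 1)"
        using *[rule_format, of "2 * j"] *[rule_format, of "2 * j + 1"] k
        by (simp add: j step_charge_def algebra_simps)
    qed
  qed
  finally show ?thesis .
qed


section \<open>Representatives of tilings up to translation\<close>

text \<open>Translation along \<open>y = x\<close> shifts all charges by the same amount, so fixing
  the charges selects one tiling in each class.\<close>

definition profiles :: "nat \<Rightarrow> sign list \<Rightarrow> (int \<Rightarrow> nat \<Rightarrow> nat) set" where
  "profiles l w = {L. admissible (periodic_charge l w) L \<and> (\<forall>m. L (m + 2 * int l) = L m)}"

definition profile_tiling :: "nat \<Rightarrow> sign list \<Rightarrow> (int \<Rightarrow> nat \<Rightarrow> nat) \<Rightarrow> domino set" where
  "profile_tiling l w L = tiling_of (periodic_charge l w) L"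

lemma profile_tiling_properties:
  fixes t :: int
  assumes "L \<in> profiles l w" "l \<ge> 1"
  defines "T \<equiv> translate t t ` profile_tiling l w L"
  shows "cylindric_steep_tiling l T" "asymptotic_data l w T" "invariant l (charge w (2 * l)) T"
    "particles T m = range (particle_pos (periodic_charge l w m + t) (L m))"
proof -
  define C where "C = (\<lambda>m. periodic_charge l w m + t)"
  have T: "T = tiling_of C L"
    unfolding T_def profile_tiling_def translate_tiling_of C_def ..
  have adm: "admissible C L" using assms(1) by (simp add: C_def admissible_shift profiles_def)
  have C: "C (m + 2 * int l) = C m + charge w (2 * l)" for m
    by (simp add: C_def periodic_charge_period[OF assms(2)])
  show inv: "invariant l (charge w (2 * l)) T"
    unfolding T by (rule invariant_tiling_of) (use C assms(1) in \<open>auto simp: profiles_def\<close>)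
  then show "cylindric_steep_tiling l T"
    using plane_tiling_tiling_of[OF adm] steep_tiling_of[OF adm] unfolding cylindric_steep_tiling_def T by blast
  have "C (m + 1) - C m = step_charge w (letter_at l m)" for m
    using periodic_charge_step[OF assms(2), of w m] by (simp add: C_def)
  then show "asymptotic_data l w T"
    unfolding T asymptotic_data_iff[OF adm] by (simp add: letter_at_nat)
  show "particles T m = range (particle_pos (periodic_charge l w m + t) (L m))"
    unfolding T particles_tiling_of[OF adm] by (simp only: C_def)
qed

text \<open>The charge increments over a period are known, which forces the translation vector as
  well; the charges then differ from \<open>periodic_charge\<close> by the constant
  \<open>C 0\<close>, and this is the translation.\<close>

lemma steep_tiling_is_profile_tiling:
  assumes "cylindric_steep_tiling l T" "asymptotic_data l w T" "l \<ge> 1"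
  obtains t L where "L \<in> profiles l w" "T = translate t t ` profile_tiling l w L"
proof -
  obtain C L c where adm: "admissible C L" and T: "T = tiling_of C L"
    and C: "\<And>m. C (m + 2 * int l) = C m + c" and L: "\<And>m. L (m + 2 * int l) = L m"
    using steep_tilingE[OF assms(1,3)] by metis
  have step: "C (int m + 1) - C (int m) = step_charge w (Suc m)" if "m < 2 * l" for m
    using assms(2) that unfolding T asymptotic_data_iff[OF adm] by blast
  have nat: "C (int m) = charge w m + C 0" if "m \<le> 2 * l" for m
    using that
  proof (induction m)
    case (Suc m)
    then show ?case using step[of m] by (simp add: charge_Suc add.commute)
  qed simp
  have c: "c = charge w (2 * l)" using nat[of "2 * l"] C[of 0] by simp
  have "C m = periodic_charge l w m + C 0" for m
  proof (rule periodic_int_induct[OF assms(3), where P = "\<lambda>m. C m = periodic_charge l w m + C 0"])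
    show "C (int r) = periodic_charge l w (int r) + C 0" if "r < 2 * l" for r
      using nat that periodic_charge_nat[OF assms(3)] by simp
  qed (simp add: C c periodic_charge_period[OF assms(3)])
  then have C_eq: "C = (\<lambda>m. periodic_charge l w m + C 0)" by blast
  show ?thesis
  proof (rule that[of L "C 0"])
    show "L \<in> profiles l w"
      using adm L unfolding profiles_def by (subst (asm) C_eq) (simp add: admissible_shift)
    show "T = translate (C 0) (C 0) ` profile_tiling l w L"
      unfolding T profile_tiling_def translate_tiling_of by (subst C_eq) simp
  qed
qed

lemma profile_tiling_inject:
  assumes "L \<in> profiles l w" "L' \<in> profiles l w" "l \<ge> 1"
    and eq: "translate t t ` profile_tiling l w L = translate u u ` profile_tiling l w L'"
  shows "t = u" "L = L'"
proof -
  have "range (particle_pos (periodic_charge l w m + t) (L m)) =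
      range (particle_pos (periodic_charge l w m + u) (L' m))" for m
    using profile_tiling_properties(4)[OF assms(1,3), of t m]
      profile_tiling_properties(4)[OF assms(2,3), of u m] eq by simp
  note ranges = this
  have "is_partition (L m)" "is_partition (L' m)" for m
    using assms(1,2) by (auto simp: profiles_def admissible_def)
  from particle_range_inject[OF this ranges]
  have "periodic_charge l w m + t = periodic_charge l w m + u" "L m = L' m" for m
    by blast+
  then show "t = u" "L = L'" by auto
qed

section \<open>Flips\<close>

definition step_ok :: "nat \<Rightarrow> sign list \<Rightarrow> (int \<Rightarrow> nat \<Rightarrow> nat) \<Rightarrow> int \<Rightarrow> bool" where
  "step_ok l w L m \<longleftrightarrow> (\<forall>k. site (periodic_charge l w) L m (m + 1) k -
     site (periodic_charge l w) L m m k \<in> {0, 1})"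

lemma profiles_iff: "L \<in> profiles l w \<longleftrightarrow>
    (\<forall>m. is_partition (L m)) \<and> (\<forall>m. L (m + 2 * int l) = L m) \<and> (\<forall>m. step_ok l w L m)"
  by (auto simp: profiles_def admissible_def step_ok_def)

lemma diff_01_iff:
  "(1 + int a - int b \<in> {0, 1}) \<longleftrightarrow> a \<le> b \<and> b \<le> Suc a"
  "(0 + int a - int b \<in> {0, 1}) \<longleftrightarrow> b \<le> a \<and> a \<le> Suc b"
  by auto

text \<open>For odd \<open>m\<close> particles move, so rows change by at most one and the strip is
  vertical; for even \<open>m\<close> holes move, so columns do and the strip is horizontal. The
  charge increment \<open>\<delta>\<close> decides which of the two partitions is the larger
  one.\<close>

lemma step_ok_iff_link:
  assumes l: "l \<ge> 1" and part: "is_partition (L m)" "is_partition (L (m + 1))"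
  shows "step_ok l w L m \<longleftrightarrow> link (word_step w (letter_at l m)) (L m) (L (m + 1))"
proof -
  define i where "i = letter_at l m"
  define \<delta> where "\<delta> = step_charge w i"
  define p q where "p = L m" and "q = L (m + 1)"
  have c: "periodic_charge l w (m + 1) = periodic_charge l w m + \<delta>"
    using periodic_charge_step[OF l, of w m] by (simp add: \<delta>_def i_def)
  have "odd i \<longleftrightarrow> even (m mod (2 * int l))"
    using l by (simp add: i_def letter_at_def even_nat_iff)
  also have "\<dots> \<longleftrightarrow> even m" by (simp add: even_even_mod_4_iff dvd_mod_iff)
  finally have odd: "odd i \<longleftrightarrow> even m" .
  have \<delta>: "\<delta> = (if letter w i = (if odd i then Plus else Minus) then 1 else 0)"
    by (simp add: \<delta>_def step_charge_def)
  have pm: "letter w i = Plus \<or> letter w i = Minus" by (cases "letter w i") auto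
  show ?thesis
  proof (cases "odd m")
    case True
    have "step_ok l w L m \<longleftrightarrow> (\<forall>k. \<delta> + int (q k) - int (p k) \<in> {0, 1})"
    proof -
      have "site (periodic_charge l w) L m (m + 1) k - site (periodic_charge l w) L m m k =
          \<delta> + int (q k) - int (p k)" for k
        using True unfolding site_def particle_pos_def c p_def q_def by simp
      then show ?thesis unfolding step_ok_def by simp
    qed
    also have "\<dots> \<longleftrightarrow> link (word_step w i) p q"
    proof (cases "letter w i = Minus")
      case t: True
      have "\<delta> = 1" using t True odd by (simp add: \<delta>)
      then show ?thesis using t True odd by (simp only: diff_01_iff) (auto simp: link_def strip_def)
    next
      case f: False
      then have "\<delta> = 0" "letter w i = Plus" using pm True odd by (simp_all add: \<delta>)
      then show ?thesis using True odd by (simp only: diff_01_iff) (auto simp: link_def strip_def)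
    qed
    finally show ?thesis by (simp add: i_def p_def q_def)
  next
    case False
    let ?p = "conj_part p" and ?q = "conj_part q"
    have "step_ok l w L m \<longleftrightarrow> (\<forall>k. \<delta> + int (?p k) - int (?q k) \<in> {0, 1})"
    proof -
      have "site (periodic_charge l w) L m (m + 1) k - site (periodic_charge l w) L m m k =
          \<delta> + int (?p k) - int (?q k)" for k
        using False unfolding site_def hole_pos_def c p_def q_def by simp
      then show ?thesis unfolding step_ok_def by simp
    qed
    also have "\<dots> \<longleftrightarrow> link (word_step w i) p q"
    proof (cases "letter w i = Plus")
      case True
      then have "\<delta> = 1" using False odd by (simp add: \<delta>)
      then have "(\<forall>k. \<delta> + int (?p k) - int (?q k) \<in> {0, 1}) \<longleftrightarrow> strip False ?p ?q"
        by (simp only: diff_01_iff) (simp add: strip_def)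
      then show ?thesis using True False odd strip_conj[of p q False] part
        by (simp add: link_def p_def q_def)
    next
      case f: False
      then have m: "\<delta> = 0" "letter w i = Minus" using pm False odd by (auto simp: \<delta>)
      then have "(\<forall>k. \<delta> + int (?p k) - int (?q k) \<in> {0, 1}) \<longleftrightarrow> strip False ?q ?p"
        by (simp only: diff_01_iff) (simp add: strip_def)
      then show ?thesis using m(2) False odd strip_conj[of q p False] part
        by (simp add: link_def p_def q_def)
    qed
    finally show ?thesis by (simp add: i_def p_def q_def)
  qed
qed

lemma step_ok_period:
  assumes "l \<ge> 1" "\<And>m. L (m + 2 * int l) = L m"
  shows "step_ok l w L (m + 2 * int l) = step_ok l w L m"
proof -
  have "site (periodic_charge l w) L (m + 2 * int l) (m' + 2 * int l) k =
      site (periodic_charge l w) L m m' k + charge w (2 * l)" for m' k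
    by (simp add: site_def particle_pos_def hole_pos_def periodic_charge_period[OF assms(1)] assms(2))
  from this[of m] this[of "m + 1"] show ?thesis
    by (simp add: step_ok_def algebra_simps)
qed

lemma periodic_index:
  assumes "l \<ge> 1"
  shows "int (nat (m mod (2 * int l))) = m mod (2 * int l)" "nat (m mod (2 * int l)) < 2 * l"
proof -
  have "m mod (2 * int l) \<ge> 0" "m mod (2 * int l) < 2 * int l" using assms by simp_all
  then show "int (nat (m mod (2 * int l))) = m mod (2 * int l)" "nat (m mod (2 * int l)) < 2 * l"
    by linarith+
qed


section \<open>Profiles as cyclic paths\<close>

definition weight :: "nat \<Rightarrow> (int \<Rightarrow> nat \<Rightarrow> nat) \<Rightarrow> nat" where
  "weight l L = (\<Sum>m<2 * l. psize (L (int m)))"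

definition profile_path :: "nat \<Rightarrow> (int \<Rightarrow> nat \<Rightarrow> nat) \<Rightarrow> (nat \<Rightarrow> nat) list" where
  "profile_path l L = map (\<lambda>m. L (int m)) [0..<2 * l]"

lemma profile_path_bij:
  assumes l: "l \<ge> 1"
  shows "bij_betw (profile_path l) (profiles l w) (cyclic_paths (word_steps l w))"
proof (rule bij_betw_byWitness[of _ "\<lambda>ps m. ps ! nat (m mod (2 * int l))"])
  note ix = periodic_index[OF l]
  show "\<forall>L\<in>profiles l w. (\<lambda>m. profile_path l L ! nat (m mod (2 * int l))) = L"
  proof (rule ballI, rule ext)
    fix L m assume "L \<in> profiles l w"
    then have "L (m + 2 * int l) = L m" for m by (simp add: profiles_iff)
    then have "L (m mod (2 * int l)) = L m" by (rule period_cong[where N = "2 * int l"]) simp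
    then show "profile_path l L ! nat (m mod (2 * int l)) = L m"
      using ix[of m] by (simp add: profile_path_def)
  qed
  show "\<forall>ps\<in>cyclic_paths (word_steps l w). profile_path l (\<lambda>m. ps ! nat (m mod (2 * int l))) = ps"
    by (auto simp: cyclic_paths_def profile_path_def intro!: nth_equalityI)
  show "profile_path l ` profiles l w \<subseteq> cyclic_paths (word_steps l w)"
  proof
    fix ps assume "ps \<in> profile_path l ` profiles l w"
    then obtain L where L: "L \<in> profiles l w" and ps: "ps = profile_path l L" by blast
    have part: "is_partition (L m)" and per: "L (m + 2 * int l) = L m" and ok: "step_ok l w L m" for m
      using L by (simp_all add: profiles_iff)
    have "link (word_steps l w ! m) (ps ! m) (ps ! (Suc m mod (2 * l)))" if m: "m < 2 * l" for m
    proof -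
      have "ps ! (Suc m mod (2 * l)) = L (int (Suc m mod (2 * l)))"
        using l by (simp add: ps profile_path_def)
      also have "\<dots> = L (int m + 1)"
        by (rule period_cong[of L "2 * int l", OF per]) (simp add: zmod_int add.commute)
      finally show ?thesis
        using m ok[of "int m"] unfolding step_ok_iff_link[OF l part part] letter_at_nat[OF m]
        by (simp add: nth_word_steps ps profile_path_def)
    qed
    then show "ps \<in> cyclic_paths (word_steps l w)"
      using part by (auto simp: cyclic_paths_def ps profile_path_def)
  qed
  show "(\<lambda>ps m. ps ! nat (m mod (2 * int l))) ` cyclic_paths (word_steps l w) \<subseteq> profiles l w"
  proof
    fix L assume "L \<in> (\<lambda>ps m. ps ! nat (m mod (2 * int l))) ` cyclic_paths (word_steps l w)"
    then obtain ps where ps: "ps \<in> cyclic_paths (word_steps l w)"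
      and L: "L = (\<lambda>m. ps ! nat (m mod (2 * int l)))" by blast
    have part: "is_partition (L m)" for m
      using cyclic_pathsD(1)[OF ps, of "nat (m mod (2 * int l))"] ix[of m] by (simp add: L)
    have per: "L (m + 2 * int l) = L m" for m by (simp add: L)
    have "step_ok l w L (int r)" if r: "r < 2 * l" for r
    proof -
      have "L (int r + 1) = ps ! (Suc r mod (2 * l))"
      proof -
        have "(int r + 1) mod (2 * int l) = int (Suc r mod (2 * l))"
          by (simp add: zmod_int add.commute)
        then show ?thesis by (simp add: L)
      qed
      moreover have "L (int r) = ps ! r" using r by (simp add: L)
      ultimately show ?thesis
        using cyclic_pathsD(2)[OF ps, of r] r
        unfolding step_ok_iff_link[OF l part part] letter_at_nat[OF r]
        by (simp add: nth_word_steps)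
    qed
    then have "step_ok l w L m" for m
      by (rule periodic_int_induct[OF l, where P = "step_ok l w L"]) (use step_ok_period[of l L w, OF l per] in auto)
    then show "L \<in> profiles l w" using part per by (simp add: profiles_iff)
  qed
qed

lemma energy_profile_path:
  "energy (int (2 * l)) (word_steps l w) (profile_path l L) = int (weight l L)"
  unfolding energy_word_steps weight_def by (simp add: profile_path_def)


section \<open>Changing one partition and its periodic copies\<close>

definition modify :: "nat \<Rightarrow> int \<Rightarrow> (nat \<Rightarrow> nat) \<Rightarrow> (int \<Rightarrow> nat \<Rightarrow> nat) \<Rightarrow> int \<Rightarrow> nat \<Rightarrow> nat" where
  "modify l m0 p L m = (if m mod (2 * int l) = m0 mod (2 * int l) then p else L m)"

lemma modify_period: "(\<And>m. L (m + 2 * int l) = L m) \<Longrightarrow> modify l m0 p L (m + 2 * int l) = modify l m0 p L m"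
  by (simp add: modify_def)

text \<open>The period is even, so residues keep the parity. This covers \<open>l = 1\<close>, where
  both neighbours of a diagonal are copies of the same one.\<close>

lemma mod_neq_neighbour:
  assumes "l \<ge> 1" "m mod (2 * int l) = m0 mod (2 * int l)"
  shows "(m + 1) mod (2 * int l) \<noteq> m0 mod (2 * int l)" "(m - 1) mod (2 * int l) \<noteq> m0 mod (2 * int l)"
proof -
  have *: "even (m' mod (2 * int l)) \<longleftrightarrow> even m'" for m' :: int
    by (simp add: dvd_mod_iff)
  have m: "even m \<longleftrightarrow> even m0" using assms(2) *[of m] *[of m0] by simp
  show "(m + 1) mod (2 * int l) \<noteq> m0 mod (2 * int l)"
  proof
    assume "(m + 1) mod (2 * int l) = m0 mod (2 * int l)"
    then have "even (m + 1) \<longleftrightarrow> even m0" using *[of "m + 1"] *[of m0] by simp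
    then show False using m by simp
  qed
  show "(m - 1) mod (2 * int l) \<noteq> m0 mod (2 * int l)"
  proof
    assume "(m - 1) mod (2 * int l) = m0 mod (2 * int l)"
    then have "even (m - 1) \<longleftrightarrow> even m0" using *[of "m - 1"] *[of m0] by simp
    then show False using m by simp
  qed
qed

lemma modify_apply:
  assumes "l \<ge> 1"
  shows "modify l m0 p L m0 = p" "modify l m0 p L (m0 + 1) = L (m0 + 1)"
    "modify l m0 p L (m0 - 1) = L (m0 - 1)"
  using mod_neq_neighbour[OF assms refl, of m0] by (simp_all add: modify_def)

lemma modify_profile:
  assumes l: "l \<ge> 1" and L: "L \<in> profiles l w" and p: "is_partition p"
    and ok: "step_ok l w (modify l m0 p L) (m0 - 1)" "step_ok l w (modify l m0 p L) m0"
  shows "modify l m0 p L \<in> profiles l w"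
proof -
  let ?M = "modify l m0 p L"
  have per: "L (m + 2 * int l) = L m" for m using L by (simp add: profiles_iff)
  note perM = modify_period[of L l m0 p, OF per]
  have step_per: "step_ok l w ?M (m + 2 * int l) = step_ok l w ?M m" for m
    by (rule step_ok_period[OF l]) (rule perM)
  have "step_ok l w ?M m" for m
  proof -
    consider "m mod (2 * int l) = m0 mod (2 * int l)" | "m mod (2 * int l) = (m0 - 1) mod (2 * int l)"
      | "m mod (2 * int l) \<noteq> m0 mod (2 * int l)" "m mod (2 * int l) \<noteq> (m0 - 1) mod (2 * int l)" by blast
    then show ?thesis
    proof cases
      case 1
      then show ?thesis using ok(2) period_cong[of "step_ok l w ?M" "2 * int l" m m0] step_per by blast
    next
      case 2
      then show ?thesis using ok(1) period_cong[of "step_ok l w ?M" "2 * int l" m "m0 - 1"] step_per by blast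
    next
      case 3
      have "(m + 1) mod (2 * int l) \<noteq> m0 mod (2 * int l)"
        using 3(2) by (metis add_diff_cancel_right' mod_diff_left_eq)
      then have "?M m = L m" "?M (m + 1) = L (m + 1)" using 3 by (simp_all add: modify_def)
      then show ?thesis using L by (simp add: profiles_iff step_ok_def site_def)
    qed
  qed
  moreover have "is_partition (?M m)" for m using L p by (simp add: profiles_iff modify_def)
  ultimately show ?thesis using perM by (simp add: profiles_iff)
qed

lemma weight_modify:
  assumes l: "l \<ge> 1" and per: "\<And>m. L (m + 2 * int l) = L m"
  shows "weight l (modify l m0 p L) + psize (L m0) = weight l L + psize p"
proof -
  define r where "r = nat (m0 mod (2 * int l))"
  have r: "r < 2 * l" "int r = m0 mod (2 * int l)" using periodic_index[OF l, of m0] by (simp_all add: r_def)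
  have "L (int r) = L m0" unfolding r(2) by (rule period_cong[of L, OF per]) simp
  moreover have "modify l m0 p L (int m) = (if m = r then p else L (int m))" if "m < 2 * l" for m
    using that r(2) by (simp add: modify_def flip: r(2))
  then have "weight l (modify l m0 p L) = (\<Sum>m<2 * l. if m = r then psize p else psize (L (int m)))"
    unfolding weight_def by (intro sum.cong) auto
  moreover have "\<dots> = psize p + (\<Sum>m\<in>{..<2 * l} - {r}. psize (L (int m)))"
    using r(1) by (subst sum.remove[of _ r]) (auto intro!: sum.cong)
  moreover have "weight l L = psize (L (int r)) + (\<Sum>m\<in>{..<2 * l} - {r}. psize (L (int m)))"
    unfolding weight_def using r(1) by (subst sum.remove[of _ r]) auto
  ultimately show ?thesis by simp
qed


section \<open>Boxes as jumps of particles\<close>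

lemma psize_add_box:
  assumes "is_partition p"
  shows "psize (p(i := Suc (p i))) = Suc (psize p)"
proof -
  have "young (p(i := Suc (p i))) = insert (i, p i) (young p)"
    by (auto simp: young_def split: if_splits)
  then show ?thesis using finite_young[OF assms] by (simp add: psize_def young_def)
qed

text \<open>The new box lies in row \<open>i\<close> and column \<open>p i\<close> and lengthens
  only that row and that column: the particle at \<open>x\<close> and the hole at
  \<open>x + 1\<close> change places.\<close>

lemma add_box_positions:
  fixes c :: int
  assumes p: "is_partition p" and q: "is_partition q" "q = p(i := Suc (p i))"
  defines "x \<equiv> particle_pos c p i"
  shows "hole_pos c p (p i) = x + 1"
    "particle_pos c q = (particle_pos c p)(i := x + 1)"
    "hole_pos c q = (hole_pos c p)(p i := x)"
proof -
  define j where "j = p i"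
  have "conj_part q = (conj_part p)(j := Suc i)"
  proof (rule partition_eqI)
    fix j' i'
    have "j < q i'" if "i' \<le> i" using partition_decseq[OF q(1) that] by (simp add: q(2) j_def)
    moreover have "\<not> j < q i'" if "\<not> i' \<le> i"
      using partition_decseq[OF p, of i i'] that by (simp add: q(2) j_def)
    moreover have "j' < q i' \<longleftrightarrow> j' < p i'" if "j' \<noteq> j"
      using that by (auto simp: q(2) j_def)
    ultimately show "i' < conj_part q j' \<longleftrightarrow> i' < ((conj_part p)(j := Suc i)) j'"
      unfolding less_conj_part_iff[OF q(1)]
      using less_conj_part_iff[OF p, of i' j'] by (cases "j' = j") (auto simp: less_Suc_eq_le)
  qed
  moreover have "conj_part p j = i"
  proof (rule antisym)
    show "conj_part p j \<le> i" using less_conj_part_iff[OF p, of i j] by (auto simp: j_def)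
    show "i \<le> conj_part p j"
    proof (cases i)
      case (Suc i')
      have "j < p i'" using partition_decseq[OF q(1), of i' i] Suc by (simp add: q(2) j_def)
      then show ?thesis using less_conj_part_iff[OF p, of i' j] Suc by simp
    qed simp
  qed
  ultimately show "hole_pos c p (p i) = x + 1"
    "particle_pos c q = (particle_pos c p)(i := x + 1)"
    "hole_pos c q = (hole_pos c p)(p i := x)"
    unfolding x_def j_def[symmetric]
    by (auto simp: hole_pos_def particle_pos_def q(2) j_def fun_eq_iff)
qed

text \<open>Adjacency of particle and hole means \<open>p i + conj_part p j = i + j\<close>. If
  \<open>p i\<close> and \<open>j\<close> differed, \<open>less_conj_part_iff\<close> would push
  both summands in the same direction. So the cell (i, j) is an outer corner of the diagram.\<close>

lemma addable_box:
  assumes p: "is_partition p" and "particle_pos c p i = x" "hole_pos c p j = x + 1"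
  shows "p i = j" "is_partition (p(i := Suc (p i)))"
proof -
  have eq: "p i + conj_part p j = i + j" using assms(2,3) by (simp add: particle_pos_def hole_pos_def)
  have iff: "i < conj_part p j \<longleftrightarrow> j < p i" by (rule less_conj_part_iff[OF p])
  show j: "p i = j" using eq iff by linarith
  then have conj: "conj_part p j = i" using eq by simp
  obtain n where n: "\<forall>i\<ge>n. p i = 0" using p by (auto simp: is_partition_def)
  show "is_partition (p(i := Suc (p i)))"
  proof (rule partitionI[of _ "max n (Suc i)"])
    show "(p(i := Suc (p i))) (Suc k) \<le> (p(i := Suc (p i))) k" for k
      using partition_decseq[OF p, of k "Suc k"] less_conj_part_iff[OF p, of k j] j conj by auto
  qed (use n in auto)
qed

lemma removable_box:
  assumes p: "is_partition p" and "particle_pos c p i = x + 1" "hole_pos c p j = x"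
  shows "p i = Suc j" "is_partition (p(i := j))"
proof -
  have eq: "p i + conj_part p j = i + j + 2" using assms(2,3) by (simp add: particle_pos_def hole_pos_def)
  have iff: "i < conj_part p j \<longleftrightarrow> j < p i" by (rule less_conj_part_iff[OF p])
  show j: "p i = Suc j" using eq iff by linarith
  then have "conj_part p j = Suc i" using eq by simp
  then have "p (Suc i) \<le> j" using less_conj_part_iff[OF p, of "Suc i" j] by auto
  obtain n where n: "\<forall>i\<ge>n. p i = 0" using p by (auto simp: is_partition_def)
  show "is_partition (p(i := j))"
  proof (rule partitionI[of _ "max n (Suc i)"])
    show "(p(i := j)) (Suc k) \<le> (p(i := j)) k" for k
      using partition_decseq[OF p, of k "Suc k"] j \<open>p (Suc i) \<le> j\<close> by auto
  qed (use n in auto)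
qed

text \<open>Meant for dominos indexed by diagonal and rank: by injectivity, removing the dominos
  with index in \<open>J\<close> removes no others.\<close>

lemma range_update:
  assumes "inj F" "\<And>z. z \<notin> J \<Longrightarrow> F z = F' z"
  shows "range F' = (range F - F ` J) \<union> F' ` J"
proof (intro equalityI subsetI)
  fix y assume "y \<in> range F'"
  then obtain z where z: "y = F' z" by blast
  show "y \<in> (range F - F ` J) \<union> F' ` J"
  proof (cases "z \<in> J")
    case False
    then have "y = F z" using z assms(2) by simp
    moreover have "F z \<notin> F ` J" using False assms(1) by (auto dest: injD)
    ultimately show ?thesis by simp
  qed (use z in simp)
next
  fix y assume "y \<in> (range F - F ` J) \<union> F' ` J"
  then show "y \<in> range F'"
  proof
    assume "y \<in> range F - F ` J"
    then obtain z where z: "y = F z" "z \<notin> J" by blast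
    then have "y = F' z" using assms(2)[OF z(2)] by simp
    then show ?thesis by blast
  qed blast
qed

lemma tiling_of_range: "tiling_of C L = range (\<lambda>(m, k). link_domino C L m k)"
  unfolding tiling_of_def by force

lemma inj_link_domino:
  assumes "\<And>m. is_partition (L m)"
  shows "inj (\<lambda>(m, k). link_domino C L m k)"
proof (rule injI, clarify)
  fix m k m' k' assume "link_domino C L m k = link_domino C L m' k'"
  then have "m = m'" "site C L m m k = site C L m m k'" by (auto simp: link_domino_def)
  then show "m = m' \<and> k = k'" using site_eq_iff[of L m C m k k', OF assms] by blast
qed

lemma periodic_charge_multiple:
  "l \<ge> 1 \<Longrightarrow> periodic_charge l w (m + q * (2 * int l)) = periodic_charge l w m + q * charge w (2 * l)"
  by (simp add: periodic_charge_def distrib_right)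

lemma link_domino_multiple:
  fixes w :: "sign list"
  assumes l: "l \<ge> 1" and per: "\<And>m. L (m + 2 * int l) = L m"
  defines "c \<equiv> charge w (2 * l)"
  shows "link_domino (periodic_charge l w) L (m + q * (2 * int l)) k =
    translate (q * c) (q * (c - 2 * int l)) (link_domino (periodic_charge l w) L m k)"
proof -
  have "site (periodic_charge l w) L (m + q * (2 * int l)) (m' + q * (2 * int l)) k =
      site (periodic_charge l w) L m m' k + q * c" for m'
    using periodic_charge_multiple[OF l, of w m' q] period_multiple[of L "2 * int l" m' q, OF per]
    by (simp add: site_def particle_pos_def hole_pos_def c_def)
  from this[of m] this[of "m + 1"] show ?thesis
    by (simp add: link_domino_def algebra_simps)
qed

text \<open>The indices of all translates of one domino, as translations preserve ranks.\<close>

definition residue_indices :: "nat \<Rightarrow> int \<Rightarrow> nat \<Rightarrow> (int \<times> nat) set" where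
  "residue_indices l m k = (\<lambda>q. (m + q * (2 * int l), k)) ` UNIV"

lemma residue_indices_iff: "(m', k') \<in> residue_indices l m k \<longleftrightarrow>
    m' mod (2 * int l) = m mod (2 * int l) \<and> k' = k"
proof
  assume "m' mod (2 * int l) = m mod (2 * int l) \<and> k' = k"
  moreover from this obtain q where "m' = m + 2 * int l * q" by (metis mod_eqE)
  ultimately show "(m', k') \<in> residue_indices l m k"
    by (auto simp: residue_indices_def mult.commute)
qed (auto simp: residue_indices_def)

lemma image_residue_indices:
  assumes "l \<ge> 1" "\<And>m. L (m + 2 * int l) = L m"
  shows "(\<lambda>(m, k). link_domino (periodic_charge l w) L m k) ` (residue_indices l m k \<union> residue_indices l m' k') =
    translates l (charge w (2 * l))
      {link_domino (periodic_charge l w) L m' k', link_domino (periodic_charge l w) L m k}"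
proof -
  let ?F = "\<lambda>(m, k). link_domino (periodic_charge l w) L m k" and ?c = "charge w (2 * l)"
  have "?F ` residue_indices l m k = (\<Union>n. {translate (n * ?c) (n * (?c - 2 * int l)) (?F (m, k))})" for m k
    unfolding residue_indices_def image_image
    using link_domino_multiple[of l L w, OF assms] by (simp add: UNION_singleton_eq_range)
  then show ?thesis unfolding image_Un translates_def by auto
qed

text \<open>
  Moving a particle of the diagonal \<open>m0\<close> from \<open>x\<close> to \<open>x + 1\<close>. Its index and the index of the
  hole that takes its place are those of the dominos on both sides of the diagonal, in an order
  that depends on the parity of \<open>m0\<close>.
\<close>

lemma raise_tiling:
  fixes i :: nat and m0 :: int
  assumes l: "l \<ge> 1" and L: "L \<in> profiles l w"
  defines "M \<equiv> modify l m0 ((L m0)(i := Suc (L m0 i))) L"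
  assumes M: "M \<in> profiles l w"
  defines "x \<equiv> particle_pos (periodic_charge l w m0) (L m0) i"
  defines "y \<equiv> x - m0 + 2"
  defines "A \<equiv> if odd m0 then hor_pair x y else ver_pair x y"
  defines "B \<equiv> if odd m0 then ver_pair x y else hor_pair x y"
  defines "T \<equiv> profile_tiling l w L" and "T' \<equiv> profile_tiling l w M" and "c \<equiv> charge w (2 * l)"
  shows "A \<subseteq> T" "B \<subseteq> T'"
    "T' = (T - translates l c A) \<union> translates l c B" "T = (T' - translates l c B) \<union> translates l c A"
proof -
  define C where "C = periodic_charge l w"
  define p where "p = L m0"
  define j where "j = p i"
  define q where "q = p(i := Suc (p i))"
  define K where "K = modify l m0 q L"
  have K: "K \<in> profiles l w" using M by (simp add: K_def q_def p_def M_def)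
  have Lpart: "is_partition (L m)" and Kpart: "is_partition (K m)"
    and Lper: "L (m + 2 * int l) = L m" and Kper: "K (m + 2 * int l) = K m" for m
    using L K by (simp_all add: profiles_iff)
  have Lstep: "site C L m (m + 1) k - site C L m m k \<in> {0, 1}"
    and Kstep: "site C K m (m + 1) k - site C K m m k \<in> {0, 1}" for m k
    using L K by (simp_all only: profiles_iff step_ok_def C_def)
  have p: "is_partition p" using Lpart by (simp add: p_def)
  have q: "is_partition q" using Kpart[of m0] modify_apply(1)[OF l] by (simp add: K_def)
  note box = add_box_positions[OF p q q_def, folded j_def]
  \<comment> \<open>The ranks of the two dominos to be flipped: \<open>k1\<close> for the one from
    diagonal \<open>m0\<close> to \<open>m0 + 1\<close>, \<open>k2\<close> for the one from
    \<open>m0 - 1\<close> to \<open>m0\<close>.\<close>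
  define k1 k2 where "k1 = (if odd m0 then i else j)" and "k2 = (if odd m0 then j else i)"
  have Lm: "L m = p" and Km: "K m = q" if "m mod (2 * int l) = m0 mod (2 * int l)" for m
  proof -
    show "L m = p" unfolding p_def by (rule period_cong[of L "2 * int l", OF Lper that])
    show "K m = q" using that by (simp add: K_def modify_def)
  qed
  have site_eq: "site C K m m' k = site C L m m' k"
    if "m' mod (2 * int l) = m0 mod (2 * int l) \<Longrightarrow> k \<noteq> (if odd m then i else j)" for m m' k
  proof (cases "m' mod (2 * int l) = m0 mod (2 * int l)")
    case True
    have "k \<noteq> (if odd m then i else j)" by (rule that[OF True])
    then show ?thesis
      by (cases "odd m") (simp_all add: site_def Lm[OF True] Km[OF True] box(2,3))
  qed (simp add: site_def K_def modify_def)
  have parity: "odd m \<longleftrightarrow> odd m'" if "m mod (2 * int l) = m' mod (2 * int l)" for m m' :: int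
  proof -
    have *: "even (m mod (2 * int l)) \<longleftrightarrow> even m" for m :: int by (simp add: dvd_mod_iff)
    show ?thesis using *[of m] *[of m'] that by simp
  qed
  define J where "J = residue_indices l m0 k1 \<union> residue_indices l (m0 - 1) k2"
  have off: "link_domino C L m k = link_domino C K m k" if "(m, k) \<notin> J" for m k
  proof -
    have n1: "m mod (2 * int l) = m0 mod (2 * int l) \<Longrightarrow> k \<noteq> k1"
      and n2: "m mod (2 * int l) = (m0 - 1) mod (2 * int l) \<Longrightarrow> k \<noteq> k2"
      using that by (auto simp: J_def residue_indices_iff)
    have "site C K m m k = site C L m m k"
      by (rule site_eq) (use n1 parity[of m m0] in \<open>auto simp: k1_def\<close>)
    moreover have "site C K m (m + 1) k = site C L m (m + 1) k"
    proof (rule site_eq)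
      assume *: "(m + 1) mod (2 * int l) = m0 mod (2 * int l)"
      then have m: "m mod (2 * int l) = (m0 - 1) mod (2 * int l)"
        by (metis add_diff_cancel_right' mod_diff_left_eq)
      show "k \<noteq> (if odd m then i else j)" using n2[OF m] parity[OF m] by (auto simp: k2_def)
    qed
    ultimately show ?thesis by (simp add: link_domino_def)
  qed
  have x: "particle_pos (C m0) p i = x" by (simp add: x_def C_def p_def)
  have m0: "site C L m0 m0 k1 = x + of_bool (even m0)" "site C K m0 m0 k1 = x + of_bool (odd m0)"
    "site C L (m0 - 1) m0 k2 = x + of_bool (odd m0)" "site C K (m0 - 1) m0 k2 = x + of_bool (even m0)"
    using Lm[OF refl] Km[OF refl] box x by (auto simp: site_def k1_def k2_def)
  have nb: "site C K m0 (m0 + 1) k1 = site C L m0 (m0 + 1) k1"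
    "site C K (m0 - 1) (m0 - 1) k2 = site C L (m0 - 1) (m0 - 1) k2"
    using mod_neq_neighbour[OF l refl, of m0] by (auto intro!: site_eq)
  \<comment> \<open>The site on the right does not move and has to be reachable from both
    \<open>x\<close> and \<open>x + 1\<close> by a move of 0 or 1. In the same way the site on the
    left is \<open>x\<close>, since both positions are reached from it.\<close>
  have right: "site C L m0 (m0 + 1) k1 = x + 1"
    using Lstep[of m0 k1] Kstep[of m0 k1] m0(1,2) nb by (cases "odd m0") auto
  have left: "site C L (m0 - 1) (m0 - 1) k2 = x"
    using Lstep[of "m0 - 1" k2] Kstep[of "m0 - 1" k2] m0(3,4) nb by (cases "odd m0") auto
  \<comment> \<open>The choice of \<open>y\<close> places the square so that its two dominos run
    from \<open>m0 - 1\<close> to \<open>m0\<close> and from \<open>m0\<close> to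
    \<open>m0 + 1\<close>.\<close>
  have y: "x - y + 1 = m0 - 1" "x - y + 2 = m0" by (simp_all add: y_def)
  have A: "{link_domino C L (m0 - 1) k2, link_domino C L m0 k1} = A"
    using m0 right left unfolding A_def pair_dom y by (cases "odd m0") (simp_all add: link_domino_def)
  have B: "{link_domino C K (m0 - 1) k2, link_domino C K m0 k1} = B"
    using m0 right left nb unfolding B_def pair_dom y by (cases "odd m0") (simp_all add: link_domino_def)
  have T: "T = range (\<lambda>(m, k). link_domino C L m k)" "T' = range (\<lambda>(m, k). link_domino C K m k)"
    unfolding T_def T'_def profile_tiling_def tiling_of_range C_def K_def q_def p_def M_def by simp_all
  have J: "(\<lambda>(m, k). link_domino C L m k) ` J = translates l c A"
    "(\<lambda>(m, k). link_domino C K m k) ` J = translates l c B"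
    unfolding J_def A[symmetric] B[symmetric] C_def c_def
    by (rule image_residue_indices[OF l], rule Lper, rule image_residue_indices[OF l], rule Kper)
  show "T' = (T - translates l c A) \<union> translates l c B"
    unfolding T J[symmetric] by (rule range_update) (use inj_link_domino Lpart off in auto)
  show "T = (T' - translates l c B) \<union> translates l c A"
    unfolding T J[symmetric] by (rule range_update) (use inj_link_domino Kpart off in auto)
  show "A \<subseteq> T" unfolding T A[symmetric] by auto
  show "B \<subseteq> T'" unfolding T B[symmetric] by auto
qed

text \<open>On diagonal \<open>m0\<close> only ranks \<open>i\<close> and \<open>j\<close> change,
  and their new positions are in \<open>{x, x + 1}\<close>. The neighbours, at \<open>x\<close> on
  the left and \<open>x + 1\<close> on the right, are compatible with both values.\<close>

lemma modify_profile_sites: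
  assumes l: "l \<ge> 1" and L: "L \<in> profiles l w" and q: "is_partition q"
  defines "C \<equiv> periodic_charge l w"
  assumes P: "particle_pos (C m0) q = (particle_pos (C m0) (L m0))(i := u)"
    and Q: "hole_pos (C m0) q = (hole_pos (C m0) (L m0))(j := v)"
    and uv: "u \<in> {x, x + 1}" "v \<in> {x, x + 1}"
    and right: "site C L m0 (m0 + 1) (if odd m0 then i else j) = x + 1"
    and left: "site C L (m0 - 1) (m0 - 1) (if odd m0 then j else i) = x"
  shows "modify l m0 q L \<in> profiles l w"
proof (rule modify_profile[OF l L q])
  let ?M = "modify l m0 q L"
  note M = modify_apply[OF l, of m0 q L]
  have Lstep: "site C L m (m + 1) k - site C L m m k \<in> {0, 1}" for m k
    using L by (simp only: profiles_iff step_ok_def C_def)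
  show "step_ok l w ?M m0"
    unfolding step_ok_def C_def[symmetric]
  proof
    fix k
    have "site C ?M m0 (m0 + 1) k = site C L m0 (m0 + 1) k" by (simp add: site_def M)
    moreover have "site C ?M m0 m0 k = site C L m0 m0 k" if "k \<noteq> (if odd m0 then i else j)"
      using that by (auto simp: site_def M P Q)
    moreover have "site C ?M m0 m0 (if odd m0 then i else j) \<in> {x, x + 1}"
      using uv by (auto simp: site_def M P Q)
    ultimately show "site C ?M m0 (m0 + 1) k - site C ?M m0 m0 k \<in> {0, 1}"
      using Lstep[of m0 k] right by (cases "k = (if odd m0 then i else j)") auto
  qed
  have m0: "m0 - 1 + 1 = m0" by simp
  show "step_ok l w ?M (m0 - 1)"
    unfolding step_ok_def C_def[symmetric] m0
  proof
    fix k
    have "site C ?M (m0 - 1) (m0 - 1) k = site C L (m0 - 1) (m0 - 1) k" by (simp add: site_def M)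
    moreover have "site C ?M (m0 - 1) m0 k = site C L (m0 - 1) m0 k" if "k \<noteq> (if odd m0 then j else i)"
      using that by (auto simp: site_def M P Q)
    moreover have "site C ?M (m0 - 1) m0 (if odd m0 then j else i) \<in> {x, x + 1}"
      using uv by (auto simp: site_def M P Q)
    ultimately show "site C ?M (m0 - 1) m0 k - site C ?M (m0 - 1) (m0 - 1) k \<in> {0, 1}"
      using Lstep[of "m0 - 1" k, unfolded m0] left by (cases "k = (if odd m0 then j else i)") auto
  qed
qed

lemma modify_modify: "modify l m0 p (modify l m0 q L) = modify l m0 p L"
  by (simp add: modify_def fun_eq_iff)

lemma modify_same:
  assumes "\<And>m. L (m + 2 * int l) = L m"
  shows "modify l m0 (L m0) L = L"
proof
  fix m
  show "modify l m0 (L m0) L m = L m"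
    using period_cong[of L "2 * int l" m m0, OF assms] by (simp add: modify_def)
qed

text \<open>The two parallel dominos show a particle and a hole at \<open>x\<close> and
  \<open>x + 1\<close>, in some order, on the diagonal \<open>m0\<close> through the middle of the
  square. Flipping exchanges them, which adds a box if the particle is on the left and removes one
  otherwise.\<close>

lemma pair_flip_profile:
  assumes l: "l \<ge> 1" and L: "L \<in> profiles l w"
  defines "T \<equiv> profile_tiling l w L" and "c \<equiv> charge w (2 * l)"
  assumes "hor_pair x y \<subseteq> T \<and> P = hor_pair x y \<and> P' = ver_pair x y \<or>
    ver_pair x y \<subseteq> T \<and> P = ver_pair x y \<and> P' = hor_pair x y"
  shows "\<exists>M \<in> profiles l w. profile_tiling l w M = (T - translates l c P) \<union> translates l c P' \<and>
    weight l M \<le> weight l L + 1"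
proof -
  define C where "C = periodic_charge l w"
  define m0 where "m0 = x - y + 2"
  have y: "x - y + 1 = m0 - 1" "x - y + 2 = m0" "y = x - m0 + 2" by (simp_all add: m0_def)
  have adm: "admissible C L" and part: "is_partition (L m)" and per: "L (m + 2 * int l) = L m" for m
    using L by (auto simp: profiles_def admissible_def C_def)
  define h where "h \<longleftrightarrow> P = hor_pair x y"
  have "domino_at (x - y + 1) x True \<in> hor_pair x y" "domino_at (x - y + 1) x True \<notin> ver_pair x y"
    by (simp_all add: pair_dom)
  then have ne: "hor_pair x y \<noteq> ver_pair x y" by blast
  have PP: "P = (if h then hor_pair x y else ver_pair x y)" "P' = (if h then ver_pair x y else hor_pair x y)"
    "P \<subseteq> T" using assms(5) ne by (auto simp: h_def)
  have "domino_at (m0 - 1) x h \<in> T" "domino_at m0 (x + of_bool (\<not> h)) h \<in> T"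
    using PP(1,3) unfolding pair_dom y(1,2) by (auto split: if_splits)
  then obtain k1 k2 where
    k2: "x = site C L (m0 - 1) (m0 - 1) k2" "x + of_bool h = site C L (m0 - 1) (m0 - 1 + 1) k2" and
    k1: "x + of_bool (\<not> h) = site C L m0 m0 k1" "x + of_bool (\<not> h) + of_bool h = site C L m0 (m0 + 1) k1"
    unfolding T_def profile_tiling_def C_def[symmetric] dom_in_tiling_of[OF adm] by blast
  define i j where "i = (if odd m0 then k1 else k2)" and "j = (if odd m0 then k2 else k1)"
  have k: "k1 = (if odd m0 then i else j)" "k2 = (if odd m0 then j else i)" by (auto simp: i_def j_def)
  have right: "site C L m0 (m0 + 1) (if odd m0 then i else j) = x + 1"
    using k1(2) unfolding k by (cases h) auto
  have left: "site C L (m0 - 1) (m0 - 1) (if odd m0 then j else i) = x"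
    using k2(1) unfolding k by simp
  define p where "p = L m0"
  have p: "is_partition p" using part by (simp add: p_def)
  have pos: "particle_pos (C m0) p i = x + of_bool (odd m0 \<noteq> h)" "hole_pos (C m0) p j = x + of_bool (odd m0 = h)"
    using k1(1) k2(2) by (auto simp: site_def p_def i_def j_def split: if_splits)
  show ?thesis
  proof (cases "odd m0 = h")
    case True
    define q where "q = p(i := Suc (p i))"
    have x: "particle_pos (C m0) p i = x" using pos True by simp
    have q: "is_partition q" and j: "p i = j"
      using addable_box[OF p x, of j] pos True unfolding q_def by simp_all
    note box = add_box_positions[OF p q q_def, of "C m0", unfolded x j]
    have M: "modify l m0 q L \<in> profiles l w"
      using l L q _ _ _ _ right[unfolded C_def] left[unfolded C_def]
      by (rule modify_profile_sites) (use box in \<open>auto simp: p_def C_def\<close>)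
    have "profile_tiling l w (modify l m0 q L) = (T - translates l c P) \<union> translates l c P'"
      using raise_tiling(3)[OF l L, of m0 i] M x PP True
      unfolding q_def p_def C_def T_def c_def y(3) by (cases h) simp_all
    moreover have "weight l (modify l m0 q L) = weight l L + 1"
      using weight_modify[of l L m0 q, OF l per] psize_add_box[OF p, of i] by (simp add: p_def q_def)
    ultimately show ?thesis using M by auto
  next
    case False
    define q where "q = p(i := j)"
    have x: "particle_pos (C m0) p i = x + 1" "hole_pos (C m0) p j = x" using pos False by auto
    have q: "is_partition q" and j: "p i = Suc j"
      using removable_box[OF p x] unfolding q_def by simp_all
    \<comment> \<open>Removing a box is treated as adding it to the smaller partition, with the
      result read backwards.\<close>
    have pq: "p = q(i := Suc (q i))" using j by (auto simp: q_def)
    have qi: "q i = j" by (simp add: q_def)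
    note box = add_box_positions[OF q p pq, of "C m0", unfolded qi]
    have xq: "particle_pos (C m0) q i = x" using x(1) j by (simp add: particle_pos_def qi)
    have P: "particle_pos (C m0) q = (particle_pos (C m0) p)(i := x)"
      using xq unfolding box(2) by auto
    have Q: "hole_pos (C m0) q = (hole_pos (C m0) p)(j := x + 1)"
      using xq box(1) unfolding box(3) by auto
    define M where "M = modify l m0 q L"
    have M: "M \<in> profiles l w"
      unfolding M_def using l L q _ _ _ _ right[unfolded C_def] left[unfolded C_def]
      by (rule modify_profile_sites) (use P Q in \<open>auto simp: p_def C_def\<close>)
    have Mm0: "M m0 = q" unfolding M_def by (rule modify_apply(1)[OF l])
    have "modify l m0 p M = L"
      unfolding M_def modify_modify p_def by (rule modify_same[of L l m0, OF per])
    then have LM: "modify l m0 ((M m0)(i := Suc (M m0 i))) M = L" using pq by (simp add: Mm0)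
    have "profile_tiling l w M = (T - translates l c P) \<union> translates l c P'"
      using raise_tiling(4)[OF l M, of m0 i, unfolded LM, OF L] xq PP False
      unfolding Mm0 C_def T_def c_def y(3) by (cases h) simp_all
    moreover have "weight l M + 1 = weight l L"
      using weight_modify[of l L m0 q, OF l per] psize_add_box[OF q, of i] unfolding pq[symmetric]
      by (simp add: p_def M_def)
    ultimately show ?thesis using M by auto
  qed
qed

text \<open>Keeps flips inside the chosen representatives; that the weight grows by at most one is
  the source of the lower bound on the number of flips.\<close>

lemma flip_profile:
  assumes l: "l \<ge> 1" and L: "L \<in> profiles l w" and "flip l (charge w (2 * l)) (profile_tiling l w L) T'"
  shows "\<exists>M \<in> profiles l w. T' = profile_tiling l w M \<and> weight l M \<le> weight l L + 1"
proof -
  obtain x y P P' where "hor_pair x y \<subseteq> profile_tiling l w L \<and> P = hor_pair x y \<and> P' = ver_pair x y \<or>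
      ver_pair x y \<subseteq> profile_tiling l w L \<and> P = ver_pair x y \<and> P' = hor_pair x y"
    and T': "T' = (profile_tiling l w L - translates l (charge w (2 * l)) P) \<union> translates l (charge w (2 * l)) P'"
    using assms(3) unfolding flip_def by blast
  from pair_flip_profile[OF l L this(1)] T' show ?thesis by auto
qed

lemma raise_is_flip:
  assumes "l \<ge> 1" "L \<in> profiles l w" "modify l m0 ((L m0)(i := Suc (L m0 i))) L \<in> profiles l w"
  shows "flip l (charge w (2 * l)) (profile_tiling l w L)
    (profile_tiling l w (modify l m0 ((L m0)(i := Suc (L m0 i))) L))"
proof -
  define x where "x = particle_pos (periodic_charge l w m0) (L m0) i"
  note R = raise_tiling(1,3)[OF assms, folded x_def]
  let ?T = "profile_tiling l w L" and ?T' = "profile_tiling l w (modify l m0 ((L m0)(i := Suc (L m0 i))) L)"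
  let ?h = "hor_pair x (x - m0 + 2)" and ?v = "ver_pair x (x - m0 + 2)"
  let ?tr = "translates l (charge w (2 * l))"
  have "?h \<subseteq> ?T \<and> ?T' = (?T - ?tr ?h) \<union> ?tr ?v \<or> ?v \<subseteq> ?T \<and> ?T' = (?T - ?tr ?v) \<union> ?tr ?h"
  proof (cases "odd m0")
    case True
    then show ?thesis
      using R by (intro disjI1 conjI) (simp_all only: if_True if_False not_False_eq_True)
  next
    case False
    then show ?thesis
      using R by (intro disjI2 conjI) (simp_all only: if_True if_False not_True_eq_False)
  qed
  then show ?thesis unfolding flip_def by blast
qed

section \<open>Removable boxes and the minimal number of flips\<close>

lemma zero_profile:
  assumes "l \<ge> 1"
  shows "(\<lambda>_ _. 0) \<in> profiles l w"
proof -
  have "step_ok l w (\<lambda>_ _. 0) m" for m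
    using step_ok_iff_link[where L = "\<lambda>_ _. 0" and m = m and w = w, OF assms partition_zero partition_zero]
    by (simp add: link_def strip_def)
  then show ?thesis by (simp add: profiles_iff partition_zero)
qed

lemma psize_le_weight:
  assumes "l \<ge> 1" "\<And>m. L (m + 2 * int l) = L m"
  shows "psize (L m) \<le> weight l L"
proof -
  define r where "r = nat (m mod (2 * int l))"
  have r: "int r = m mod (2 * int l)" "r < 2 * l" using periodic_index[OF assms(1), of m] by (simp_all add: r_def)
  have "L m = L (int r)" by (rule period_cong[of L "2 * int l", OF assms(2)]) (simp add: r(1))
  then show ?thesis
    unfolding weight_def using r(2) by (auto intro: member_le_sum[of r])
qed

lemma zero_weight:
  assumes "l \<ge> 1" "L \<in> profiles l w" "weight l L = 0"
  shows "L = (\<lambda>_ _. 0)"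
proof (intro ext)
  fix m i
  have "L m i \<le> psize (L m)" using assms(2) by (intro part_le_psize) (simp add: profiles_iff)
  also have "\<dots> \<le> weight l L" using assms by (intro psize_le_weight) (auto simp: profiles_iff)
  finally show "L m i = 0" using assms(3) by simp
qed

lemma strip_lower_upper:
  assumes "strip h A B" "A i < B i"
  shows "strip h A (B(i := B i - 1))"
  unfolding strip_def
proof
  fix k
  define B' where "B' = B(i := B i - 1)"
  have le: "B' k \<le> B k" for k by (simp add: B'_def)
  have "A k \<le> B k \<and> (if h then B (Suc k) \<le> A k else B k \<le> Suc (A k))"
    using assms(1) by (simp add: strip_def)
  moreover from this have "A k \<le> B' k" using assms(2) by (cases "k = i") (auto simp: B'_def)
  ultimately show "A k \<le> B' k \<and> (if h then B' (Suc k) \<le> A k else B' k \<le> Suc (A k))"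
    using le[of k] le[of "Suc k"] by (cases h) simp_all
qed

text \<open>Here the inner shape shrinks: \<open>A i \<le> B i\<close> keeps a vertical strip within
  its bound, \<open>A (Suc i) < B i\<close> a horizontal one.\<close>

lemma strip_lower_lower:
  assumes "strip h B A" "A i \<le> B i" "A (Suc i) < B i"
  shows "strip h (B(i := B i - 1)) A"
  unfolding strip_def
proof
  fix k
  have "B k \<le> A k \<and> (if h then A (Suc k) \<le> B k else A k \<le> Suc (B k))"
    using assms(1) by (simp add: strip_def)
  then show "(B(i := B i - 1)) k \<le> A k \<and>
      (if h then A (Suc k) \<le> (B(i := B i - 1)) k else A k \<le> Suc ((B(i := B i - 1)) k))"
    using assms(2,3) by (cases h; cases "k = i") auto
qed

lemma ex_letter_at:
  assumes "length w = 2 * l" "z \<in> set w" "l \<ge> 1"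
  obtains k where "letter w (letter_at l (m + int k)) = z"
proof -
  obtain r where r: "r < 2 * l" "w ! r = z" using assms(1,2) by (metis in_set_conv_nth)
  define k where "k = nat ((int r - m) mod (2 * int l))"
  have "int k = (int r - m) mod (2 * int l)" using assms(3) by (simp add: k_def)
  then have "(m + int k) mod (2 * int l) = int r mod (2 * int l)"
    by (simp add: mod_add_right_eq)
  then have "letter_at l (m + int k) = Suc r" using r(1) by (simp add: letter_at_def)
  then show ?thesis using that[of k] r(2) by (simp add: letter_def)
qed

lemma ex_letter_at_left:
  assumes "length w = 2 * l" "z \<in> set w" "l \<ge> 1"
  obtains k where "letter w (letter_at l (m - int k)) = z"
proof -
  obtain r where r: "r < 2 * l" "w ! r = z" using assms(1,2) by (metis in_set_conv_nth)
  define k where "k = nat ((m - int r) mod (2 * int l))"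
  have "int k = (m - int r) mod (2 * int l)" using assms(3) by (simp add: k_def)
  then have "(m - int k) mod (2 * int l) = int r mod (2 * int l)"
    by (simp add: mod_diff_right_eq)
  then have "letter_at l (m - int k) = Suc r" using r(1) by (simp add: letter_at_def)
  then show ?thesis using that[of k] r(2) by (simp add: letter_def)
qed

text \<open>
  Among the nonzero parts choose one with maximal hook \<open>L m i + i\<close>. It can only be blocked by
  an equal part of the same row on the left of an up step or on the right of a down step, so
  moving along these steps leads to a removable box, as the word is not constant.
\<close>

lemma ex_removable_box:
  assumes l: "l \<ge> 1" and len: "length w = 2 * l" and pm: "Plus \<in> set w" "Minus \<in> set w"
    and L: "L \<in> profiles l w" and wt: "weight l L > 0"
  shows "\<exists>M m0 i. M \<in> profiles l w \<and> L = modify l m0 ((M m0)(i := Suc (M m0 i))) M \<and>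
    weight l L = Suc (weight l M)"
proof -
  have part: "is_partition (L m)" and per: "L (m + 2 * int l) = L m" and ok: "step_ok l w L m" for m
    using L by (simp_all add: profiles_iff)
  define up where "up m \<longleftrightarrow> letter w (letter_at l m) = Plus" for m
  have nz: "\<exists>m i. L m i > 0"
  proof (rule ccontr)
    assume "\<not> ?thesis"
    then have "L = (\<lambda>_ _. 0)" by auto
    then show False using wt psize_eq_sum[of 0 "\<lambda>_. 0"] by (simp add: weight_def)
  qed
  \<comment> \<open>A nonzero part in row \<open>i\<close> forces more than \<open>i\<close> boxes,
    so part plus row index is bounded over the whole profile and attains a maximum.\<close>
  have bound: "L m i + i < 2 * weight l L + 1" if "L m i > 0" for m i
  proof -
    have "L m i \<le> psize (L m)" by (rule part_le_psize[OF part])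
    moreover have "i < psize (L m)" using that part_zero_beyond_psize[OF part, of m i] by (cases "i < psize (L m)") auto
    ultimately show ?thesis using psize_le_weight[of l L m, OF l per] by linarith
  qed
  obtain m1 i where mi: "L m1 i > 0" and max: "\<And>m k. L m k > 0 \<Longrightarrow> L m k + k \<le> L m1 i + i"
  proof -
    have "\<exists>x. (\<lambda>(m, k). L m k > 0) x \<and> (\<forall>y. (\<lambda>(m, k). L m k > 0) y \<longrightarrow>
        (\<lambda>(m, k). L m k + k) y \<le> (\<lambda>(m, k). L m k + k) x)"
    proof -
      obtain m i where "L m i > 0" using nz by blast
      then show ?thesis
        using bound by (intro ex_has_greatest_nat[of _ "(m, i)" _ "2 * weight l L + 1"]) auto
    qed
    then show ?thesis using that by auto
  qed
  define v where "v = L m1 i"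
  have v: "v > 0" using mi by (simp add: v_def)
  \<comment> \<open>By maximality no part in row \<open>i\<close> exceeds \<open>v\<close>, and
    every part in row \<open>i + 1\<close> is below \<open>v\<close>. So the partition itself
    permits removing a box from a row \<open>i\<close> of length \<open>v\<close>.\<close>
  have le: "L m i \<le> v" for m using max[of m i] by (cases "L m i = 0") (auto simp: v_def)
  have next_less: "L m (Suc i) < v" for m using max[of m "Suc i"] v by (cases "L m (Suc i) = 0") (auto simp: v_def)
  define blocked_left where "blocked_left m \<longleftrightarrow> up (m - 1) \<and> L (m - 1) i = v" for m
  define blocked_right where "blocked_right m \<longleftrightarrow> \<not> up m \<and> L (m + 1) i = v" for m
  have "\<exists>m. L m i = v \<and> \<not> blocked_left m \<and> \<not> blocked_right m"
  proof (rule ccontr)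
    assume "\<not> ?thesis"
    then have blocked: "blocked_left m \<or> blocked_right m" if "L m i = v" for m using that by blast
    show False
    proof (cases "\<exists>m. L m i = v \<and> blocked_left m")
      case True
      then obtain m where m: "L m i = v" "blocked_left m" by blast
      \<comment> \<open>A position blocked from the left has an up step before it, so the equal part
        on the left is not blocked from the right and must again be blocked from the left. All steps
        on this side would be up.\<close>
      have all: "blocked_left (m - int k)" for k
      proof (induction k)
        case (Suc k)
        then have "up (m - int k - 1)" "L (m - int k - 1) i = v" by (auto simp: blocked_left_def)
        then have "blocked_left (m - int k - 1)"
          using blocked[of "m - int k - 1"] by (auto simp: blocked_right_def)
        then show ?case by (simp add: algebra_simps)
      qed (use m in simp)
      obtain k where "letter w (letter_at l (m - 1 - int k)) = Minus"
        using ex_letter_at_left[OF len pm(2) l] .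
      moreover have "up (m - 1 - int k)" using all[of k] by (simp add: blocked_left_def algebra_simps)
      ultimately show False by (simp add: up_def)
    next
      case False
      \<comment> \<open>If no position is blocked from the left, the equal parts and the down steps
        continue to the right for ever.\<close>
      have all: "L (m1 + int k) i = v \<and> \<not> up (m1 + int k)" for k
      proof (induction k)
        case 0
        then show ?case using False blocked[of m1] by (auto simp: blocked_right_def v_def)
      next
        case (Suc k)
        have "L (m1 + int k + 1) i = v"
          using False blocked[of "m1 + int k"] Suc by (auto simp: blocked_right_def)
        moreover from this have "\<not> up (m1 + int k + 1)"
          using False blocked[of "m1 + int k + 1"] by (auto simp: blocked_right_def)
        ultimately show ?case by (simp add: algebra_simps)
      qed
      obtain k where "letter w (letter_at l (m1 + int k)) = Plus"
        using ex_letter_at[OF len pm(1) l] .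
      then show False using all[of k] by (simp add: up_def)
    qed
  qed
  then obtain m0 where m0: "L m0 i = v" "\<not> blocked_left m0" "\<not> blocked_right m0" by blast
  define p where "p = L m0"
  define q where "q = p(i := p i - 1)"
  define M where "M = modify l m0 q L"
  have pi: "p i = v" using m0(1) by (simp add: p_def)
  obtain n where n: "\<forall>i\<ge>n. p i = 0" using part[of m0] by (auto simp: is_partition_def p_def)
  have q: "is_partition q"
  proof (rule partitionI[of _ n])
    show "q (Suc k) \<le> q k" for k
      using partition_decseq[OF part, of k "Suc k" m0] next_less[of m0] pi
      by (auto simp: q_def p_def)
  qed (use n in \<open>auto simp: q_def\<close>)
  have pq: "p = q(i := Suc (q i))" using v pi by (auto simp: q_def)
  note M_apply = modify_apply[OF l, of m0 q L, folded M_def]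
  have Mpart: "is_partition (M m)" for m using part q by (simp add: M_def modify_def)
  have "step_ok l w M m0"
  proof -
    have "link (word_step w (letter_at l m0)) p (L (m0 + 1))"
      using ok[of m0] step_ok_iff_link[of l L m0 w, OF l part part] by (simp add: p_def)
    then have "link (word_step w (letter_at l m0)) q (L (m0 + 1))"
      using le[of "m0 + 1"] next_less[of "m0 + 1"] m0(3) pi
        strip_lower_lower[of _ p "L (m0 + 1)" i] strip_lower_upper[of _ "L (m0 + 1)" p i]
      by (auto simp: link_def q_def up_def blocked_right_def le_less)
    then show ?thesis using step_ok_iff_link[of l M m0 w, OF l Mpart Mpart] by (simp add: M_apply)
  qed
  moreover have "step_ok l w M (m0 - 1)"
  proof -
    have "link (word_step w (letter_at l (m0 - 1))) (L (m0 - 1)) p"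
      using ok[of "m0 - 1"] step_ok_iff_link[of l L "m0 - 1" w, OF l part part] by (simp add: p_def)
    then have "link (word_step w (letter_at l (m0 - 1))) (L (m0 - 1)) q"
      using le[of "m0 - 1"] next_less[of "m0 - 1"] m0(2) pi
        strip_lower_lower[of _ p "L (m0 - 1)" i] strip_lower_upper[of _ "L (m0 - 1)" p i]
      by (auto simp: link_def q_def up_def blocked_left_def le_less)
    then show ?thesis using step_ok_iff_link[of l M "m0 - 1" w, OF l Mpart Mpart] by (simp add: M_apply)
  qed
  ultimately have M: "M \<in> profiles l w"
    unfolding M_def by (intro modify_profile[OF l L q])
  have "modify l m0 p M = L"
    unfolding M_def modify_modify p_def by (rule modify_same[of L l m0, OF per])
  then have "L = modify l m0 ((M m0)(i := Suc (M m0 i))) M" using pq by (simp add: M_apply)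
  moreover have "weight l L = Suc (weight l M)"
    using weight_modify[of l L m0 q, OF l per] psize_add_box[OF q, of i] unfolding pq[symmetric]
    by (simp add: p_def M_def)
  ultimately show ?thesis using M by blast
qed

text \<open>Upper bound on the flip number: boxes are taken off one by one down to the zero profile,
  and the removals are read backwards as flips.\<close>

lemma profile_reached:
  assumes "l \<ge> 1" "length w = 2 * l" "Plus \<in> set w" "Minus \<in> set w" "L \<in> profiles l w"
  shows "(flip l (charge w (2 * l)) ^^ weight l L) (profile_tiling l w (\<lambda>_ _. 0)) (profile_tiling l w L)"
  using assms(5)
proof (induction "weight l L" arbitrary: L)
  case 0
  then show ?case using zero_weight[OF assms(1)] by (metis relpowp_0_I)
next
  case (Suc n)
  then have "weight l L > 0" by simp
  from ex_removable_box[OF assms(1-4) Suc.prems this] obtain M m0 i where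
    M: "M \<in> profiles l w" and LM: "L = modify l m0 ((M m0)(i := Suc (M m0 i))) M"
    and wt: "weight l L = Suc (weight l M)" by blast
  have "(flip l (charge w (2 * l)) ^^ weight l M) (profile_tiling l w (\<lambda>_ _. 0)) (profile_tiling l w M)"
    using Suc.hyps(1)[of M] Suc.hyps(2) wt M by simp
  moreover have "flip l (charge w (2 * l)) (profile_tiling l w M) (profile_tiling l w L)"
    using raise_is_flip[OF assms(1) M, of m0 i] Suc.prems unfolding LM[symmetric] by simp
  ultimately show ?case unfolding wt by (rule relpowp_Suc_I)
qed

text \<open>Lower bound: the zero profile has weight 0, and each flip adds at most one box.\<close>

lemma reached_is_profile:
  assumes l: "l \<ge> 1"
  shows "(flip l (charge w (2 * l)) ^^ n) (profile_tiling l w (\<lambda>_ _. 0)) T \<Longrightarrow>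
    \<exists>M\<in>profiles l w. T = profile_tiling l w M \<and> weight l M \<le> n"
proof (induction n arbitrary: T)
  case 0
  have "weight l (\<lambda>_ _. 0) = 0" using psize_eq_sum[of 0 "\<lambda>_. 0"] by (simp add: weight_def)
  then show ?case using 0 zero_profile[OF l] by auto
next
  case (Suc n)
  from Suc.prems obtain T1 where T1: "(flip l (charge w (2 * l)) ^^ n) (profile_tiling l w (\<lambda>_ _. 0)) T1"
    "flip l (charge w (2 * l)) T1 T" by (rule relpowp_Suc_E)
  from Suc.IH[OF T1(1)] obtain M where M: "M \<in> profiles l w" "T1 = profile_tiling l w M" "weight l M \<le> n" by blast
  from flip_profile[OF l M(1)] T1(2) obtain K where "K \<in> profiles l w" "T = profile_tiling l w K"
    "weight l K \<le> weight l M + 1" unfolding M(2) by blast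
  then show ?case using M(3) by force
qed


section \<open>The minimal tiling\<close>

lemma translate_zero: "translate 0 0 ` T = T"
proof -
  have "translate 0 0 d = d" for d by (cases d) simp_all
  then show ?thesis by simp
qed

lemma range_particle_pos_zero: "range (particle_pos c (\<lambda>_. 0)) = {..<c}"
proof (intro equalityI subsetI)
  fix x assume "x \<in> {..<c}"
  then have "x = particle_pos c (\<lambda>_. 0) (nat (c - x - 1))" by (simp add: particle_pos_def)
  then show "x \<in> range (particle_pos c (\<lambda>_. 0))" by blast
qed (auto simp: particle_pos_def)

text \<open>The prescribed occupation on diagonals 0 to \<open>2 * l\<close> determines charge and
  (empty) partition of one period, and the required invariance extends both to all diagonals. This
  gives the uniqueness demanded by \<open>THE\<close>.\<close>

lemma minimal_tiling_eq:
  assumes l: "l \<ge> 1"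
  shows "minimal_tiling l w = profile_tiling l w (\<lambda>_ _. 0)"
  unfolding minimal_tiling_def Let_def
proof (rule the_equality)
  let ?T = "profile_tiling l w (\<lambda>_ _. 0)"
  note Z = zero_profile[OF l, of w]
  have occ: "(\<forall>a::int. occupied (fundamental_domain l T) (of_int a + 1 / 2, of_int a + 1 / 2 - real m) \<longleftrightarrow>
      real_of_int a + 1 / 2 < of_int (charge w m)) \<longleftrightarrow> particles T (int m) = {..<charge w m}"
    if "plane_tiling T" "m \<in> {0..2 * l}" for T m
  proof -
    have "real_of_int a + 1 / 2 < of_int c \<longleftrightarrow> a < c" for a c by linarith
    then show ?thesis using occupied_iff[OF that(1), of m l] that(2) l by auto
  qed
  note P = profile_tiling_properties[OF Z l, of 0, unfolded translate_zero]
  have "plane_tiling ?T" using P(1) by (simp add: cylindric_steep_tiling_def)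
  moreover have "particles ?T (int m) = {..<charge w m}" if "m \<in> {0..2 * l}" for m
    using P(4)[of "int m"] that periodic_charge_nat[OF l, of m w] by (simp add: range_particle_pos_zero)
  ultimately show "cylindric_steep_tiling l ?T \<and> invariant l (charge w (2 * l)) ?T \<and>
     (\<forall>m\<in>{0..2 * l}. \<forall>a::int. occupied (fundamental_domain l ?T)
        (of_int a + 1 / 2, of_int a + 1 / 2 - real m) \<longleftrightarrow> real_of_int a + 1 / 2 < of_int (charge w m))"
    using P(1,3) occ by blast
  fix T assume T: "cylindric_steep_tiling l T \<and> invariant l (charge w (2 * l)) T \<and>
     (\<forall>m\<in>{0..2 * l}. \<forall>a::int. occupied (fundamental_domain l T)
        (of_int a + 1 / 2, of_int a + 1 / 2 - real m) \<longleftrightarrow> real_of_int a + 1 / 2 < of_int (charge w m))"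
  then have "plane_tiling T" by (simp add: cylindric_steep_tiling_def)
  then have parts: "particles T (int m) = {..<charge w m}" if "m \<in> {0..2 * l}" for m
    using T occ that by blast
  obtain C L where adm: "admissible C L" and TC: "T = tiling_of C L"
    using T l by (blast elim: steep_tilingE)
  note period = invariant_tiling_ofD[OF adm, of l "charge w (2 * l)"]
  have inv: "invariant l (charge w (2 * l)) (tiling_of C L)" using T TC by simp
  have eq: "C m = periodic_charge l w m \<and> L m = (\<lambda>_. 0)" for m
  proof (rule periodic_int_induct[OF l, where P = "\<lambda>m. C m = periodic_charge l w m \<and> L m = (\<lambda>_. 0)"])
    fix r assume r: "r < 2 * l"
    then have "range (particle_pos (C (int r)) (L (int r))) = range (particle_pos (charge w r) (\<lambda>_. 0))"
      using parts[of r] by (simp add: TC particles_tiling_of[OF adm] range_particle_pos_zero)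
    from particle_range_inject[OF _ _ this] show "C (int r) = periodic_charge l w (int r) \<and> L (int r) = (\<lambda>_. 0)"
      using adm partition_zero r periodic_charge_nat[OF l, of r w] by (simp add: admissible_def)
  next
    fix m
    show "C (m + 2 * int l) = periodic_charge l w (m + 2 * int l) \<and> L (m + 2 * int l) = (\<lambda>_. 0) \<longleftrightarrow>
      C m = periodic_charge l w m \<and> L m = (\<lambda>_. 0)"
      using period[OF inv] periodic_charge_period[OF l] by simp
  qed
  then have "C = periodic_charge l w" "L = (\<lambda>_ _. 0)" by auto
  then show "T = ?T" by (simp add: TC profile_tiling_def)
qed


section \<open>Translation classes and their flip numbers\<close>

definition profile_class :: "nat \<Rightarrow> sign list \<Rightarrow> (int \<Rightarrow> nat \<Rightarrow> nat) \<Rightarrow> domino set set" where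
  "profile_class l w L = range (\<lambda>t. translate t t ` profile_tiling l w L)"

lemma diagonal_class: "diagonal_translation `` {translate t t ` T} = range (\<lambda>t. translate t t ` T)"
proof -
  have comp: "translate u u ` translate t t ` T = translate (u + t) (u + t) ` T" for u t
  proof -
    have "translate u u (translate t t d) = translate (u + t) (u + t) d" for d by (cases d) simp_all
    then show ?thesis by (simp add: image_image)
  qed
  show ?thesis
  proof (intro equalityI subsetI)
    fix X assume "X \<in> range (\<lambda>u. translate u u ` T)"
    then obtain u where "X = translate u u ` T" by blast
    then have "X = translate (u - t) (u - t) ` translate t t ` T" by (simp add: comp)
    then show "X \<in> diagonal_translation `` {translate t t ` T}"
      unfolding diagonal_translation_def by blast
  qed (auto simp: diagonal_translation_def comp)
qed

lemma tiling_classes_eq: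
  assumes l: "l \<ge> 1"
  shows "tiling_classes l w = profile_class l w ` profiles l w"
proof (intro equalityI subsetI)
  fix K assume "K \<in> tiling_classes l w"
  then obtain T where T: "cylindric_steep_tiling l T" "asymptotic_data l w T" "K = diagonal_translation `` {T}"
    by (auto simp: tiling_classes_def quotient_def)
  obtain t L where "L \<in> profiles l w" "T = translate t t ` profile_tiling l w L"
    using steep_tiling_is_profile_tiling[OF T(1,2) l] .
  then show "K \<in> profile_class l w ` profiles l w" by (simp add: T(3) diagonal_class profile_class_def)
next
  fix K assume "K \<in> profile_class l w ` profiles l w"
  then obtain L where L: "L \<in> profiles l w" "K = profile_class l w L" by blast
  have "K = diagonal_translation `` {translate 0 0 ` profile_tiling l w L}"
    unfolding diagonal_class L(2) profile_class_def ..
  moreover have "translate 0 0 ` profile_tiling l w L \<in> {T. cylindric_steep_tiling l T \<and> asymptotic_data l w T}"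
    using profile_tiling_properties(1,2)[OF L(1) l, of 0] by simp
  ultimately show "K \<in> tiling_classes l w"
    unfolding tiling_classes_def by (simp add: quotientI)
qed

lemma inj_on_profile_class:
  assumes l: "l \<ge> 1"
  shows "inj_on (profile_class l w) (profiles l w)"
proof (rule inj_onI)
  fix L L' assume L: "L \<in> profiles l w" "L' \<in> profiles l w" "profile_class l w L = profile_class l w L'"
  have "translate 0 0 ` profile_tiling l w L \<in> profile_class l w L"
    unfolding profile_class_def by blast
  then have "translate 0 0 ` profile_tiling l w L \<in> profile_class l w L'" using L(3) by simp
  then obtain t where "translate 0 0 ` profile_tiling l w L = translate t t ` profile_tiling l w L'"
    by (auto simp: profile_class_def)
  then show "L = L'" by (rule profile_tiling_inject(2)[OF L(1,2) l])
qed

text \<open>A tiling reached by flips from the minimal one is an untranslated profile tiling. The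
  class contains a single such tiling, so every way of reaching the class ends there.\<close>

lemma reached_profile_class:
  assumes l: "l \<ge> 1" and "length w = 2 * l" "Plus \<in> set w" "Minus \<in> set w" and L: "L \<in> profiles l w"
  shows "reached_by_flips l w (weight l L) (profile_class l w L)"
    "reached_by_flips l w n (profile_class l w L) \<Longrightarrow> weight l L \<le> n"
proof -
  have "translate 0 0 ` profile_tiling l w L \<in> profile_class l w L"
    unfolding profile_class_def by blast
  then have "profile_tiling l w L \<in> profile_class l w L" by (simp only: translate_zero)
  then show "reached_by_flips l w (weight l L) (profile_class l w L)"
    using profile_reached[OF assms] unfolding reached_by_flips_def minimal_tiling_eq[OF l] by blast
next
  assume "reached_by_flips l w n (profile_class l w L)"
  then obtain t where "(flip l (charge w (2 * l)) ^^ n) (profile_tiling l w (\<lambda>_ _. 0))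
      (translate t t ` profile_tiling l w L)"
    unfolding reached_by_flips_def minimal_tiling_eq[OF l] profile_class_def by blast
  from reached_is_profile[OF l this] obtain M where M: "M \<in> profiles l w"
    "translate t t ` profile_tiling l w L = profile_tiling l w M" "weight l M \<le> n" by blast
  then have "translate t t ` profile_tiling l w L = translate 0 0 ` profile_tiling l w M"
    by (simp add: translate_zero)
  then have "L = M" by (rule profile_tiling_inject(2)[OF L M(1) l])
  then show "weight l L \<le> n" using M(3) by simp
qed

theorem theorem5:
  fixes l :: nat and w :: "sign list"
  assumes "l \<ge> 1" and "length w = 2 * l" and "Plus \<in> set w" and "Minus \<in> set w"
  shows "(\<forall>K \<in> tiling_classes l w. \<exists>n. reached_by_flips l w n K) \<and>
    (\<forall>n. finite {K \<in> tiling_classes l w. flip_number l w K = n}) \<and>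
    C_gf l w = T_gf l w *
      (\<Prod>k. let k' = Suc k in 1 / (1 - fps_X ^ (2 * k' * l)) *
         (\<Prod>(i, j) \<in> pm_pairs l w. phi i j (fps_X ^ (2 * k' * l + j - i))))"
proof -
  note l = assms(1)
  let ?e = "\<lambda>L. int (weight l L)"
  have number: "flip_number l w (profile_class l w L) = weight l L" if "L \<in> profiles l w" for L
    unfolding flip_number_def
    using reached_profile_class[OF assms that] by (intro Least_equality) auto
  have level: "{K \<in> tiling_classes l w. flip_number l w K = n} =
      profile_class l w ` {L \<in> profiles l w. ?e L = int n}" for n
    unfolding tiling_classes_eq[OF l] using number by auto
  \<comment> \<open>Carries the series and its gradedness from cyclic paths to profiles, under which
    the energy becomes the weight, that is, the flip number.\<close>
  note bij = gf_bij[OF profile_path_bij[OF l, of w], of "energy (int (2 * l)) (word_steps l w)" ?e,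
      OF energy_profile_path]
  have graded: "graded (profiles l w) ?e" using bij(2) graded_word_steps by blast
  have "C_gf l w = gf (profiles l w) ?e"
    unfolding C_gf_def gf_def level
    by (intro arg_cong[of _ _ Abs_fps] ext arg_cong[of _ _ of_nat] card_image
        inj_on_subset[OF inj_on_profile_class[OF l]]) auto
  then have "C_gf l w = gf (cyclic_paths (word_steps l w)) (energy (int (2 * l)) (word_steps l w))"
    using bij(1) by simp
  moreover have "finite {K \<in> tiling_classes l w. flip_number l w K = n}" for n
    unfolding level using graded unfolding graded_def by (intro finite_imageI) blast
  moreover have "\<exists>n. reached_by_flips l w n K" if "K \<in> tiling_classes l w" for K
    using that reached_profile_class(1)[OF assms] unfolding tiling_classes_eq[OF l] by blast
  ultimately show ?thesis using gf_cyclic_paths[OF l, of w] by simp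
qed

end
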